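(* For odd $n$, let $N=2^n$ and let $f$ be the majority function on $n$ binary digits, regarded as a function on $\{0,1,\ldots,N-1\}$ via binary expansion. Let $\Lambda$ be the von Mangoldt function. Then, as $n\to\infty$ through odd integers, $$\sum_{1\le x<N}\Lambda(x)f(x)\approx \frac N2,$$ that is, $$\lim_{\substack{n\to\infty\\ n\ \mathrm{odd}}}\ \frac{1}{2^{n}}\sum_{1\le x<2^n}\Lambda(x)f(x)=\frac12 .$$
   Context: Let $N=2^n$. The set $\{0,1,\ldots,N-1\}$ is identified with $\{0,1\}^n$ by binary expansion: $x=\sum_{0\le j<n}x_j2^j$ with $x_j\in\{0,1\}$. For odd $n$, the majority function $f:\{0,1\}^n\to\{0,1\}$ is defined by $f(x)=1$ if $\sum_{0\le j<n}x_j>n/2$ and $f(x)=0$ otherwise; note that $f$ depends on $n$. The von Mangoldt function is $\Lambda(x)=\log p$ if $x=p^k$ for some prime $p$ and integer $k\ge1$, and $\Lambda(x)=0$ otherwise. *)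

theory Defs
  imports "HOL-Number_Theory.Prime_Powers"
begin

definition digit :: "nat \<Rightarrow> nat \<Rightarrow> nat" where
  "digit x j = of_bool (bit x j)"

lemma digit_less_2: "digit x j < 2"
  by (simp add: digit_def)

lemma binary_expansion:
  assumes "x < 2 ^ n"
  shows "x = (\<Sum>j<n. digit x j * 2 ^ j)"
  using assms
proof (induction n arbitrary: x)
  case 0
  then show ?case by simp
next
  case (Suc n)
  from Suc.prems have "x div 2 < 2 ^ n" by auto
  from Suc.IH[OF this] have IH: "x div 2 = (\<Sum>j<n. digit (x div 2) j * 2 ^ j)" .
  have "(\<Sum>j<Suc n. digit x j * 2 ^ j) = x mod 2 + 2 * (\<Sum>j<n. digit (x div 2) j * 2 ^ j)"
    by (subst sum.lessThan_Suc_shift)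
       (simp add: digit_def bit_0 bit_Suc odd_iff_mod_2_eq_one sum_distrib_left mult_ac
             del: sum_of_bool_mult_eq sum_mult_of_bool_eq)
  also have "\<dots> = x" by (simp flip: IH)
  finally show ?case by simp
qed

text \<open>
  A point of \<open>{0,1}\<^sup>n\<close> is represented by a function on \<open>nat\<close>, of which only the
  values at \<open>0, \<dots>, n - 1\<close> matter. The comparison with \<open>n / 2\<close> is one of real numbers.
\<close>

definition majority :: "nat \<Rightarrow> (nat \<Rightarrow> nat) \<Rightarrow> nat" where
  "majority n b = (if real (\<Sum>j<n. b j) > real n / 2 then 1 else 0)"

end

theory Submission
  imports Defs "HOL-Probability.Probability" "HOL-Real_Asymp.Real_Asymp" "HOL-Computational_Algebra.Squarefree" "HOL-Complex_Analysis.Complex_Analysis"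
begin

text \<open>
  Weight \<open>{0, \<dots>, 2\<^sup>n - 1}\<close> by \<open>\<Lambda>\<close>; by the prime number theorem the total mass is asymptotically \<open>2\<^sup>n\<close>.
  Under these weights the signs \<open>(-1)\<^bsup>x\<^sub>j\<^esup>\<close> behave like independent random signs, so their sum obeys a
  central limit theorem and is negative (i.e. the majority of the digits is \<open>1\<close>) with probability
  tending to \<open>1/2\<close>.

  For the central limit theorem drop the \<open>8w = o(\<surd>n)\<close> lowest and highest digits and compare moments with
  those of uniform weights. Moments are combinations of Walsh functions. Each sign is exactly a finite
  Fourier sum in the characters of denominator \<open>2\<^bsup>j+1\<^esup>\<close> with odd numerator, whose coefficients have
  \<open>l\<^sup>1\<close> norm \<open>O(j)\<close>. So a Walsh function with top digit \<open>J\<close> is a short combination of characters of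
  exact denominator \<open>2\<^bsup>J+1\<^esup>\<close>, which is between \<open>2\<^bsup>8w\<^esup>\<close> and \<open>2\<^bsup>n-8w\<^esup>\<close>, and Vaughan's identity with the very
  small cutoff \<open>2\<^bsup>2w\<^esup>\<close> bounds the corresponding sums over \<open>\<Lambda>\<close> by \<open>O(n\<^sup>3 2\<^bsup>n-w\<^esup>)\<close>. The prime number theorem
  is proved by Newman's method, applied to the function \<open>\<psi>(n) - n\<close> by partial summation.
\<close>

section \<open>Exponential sums with rational frequency\<close>

text \<open>The discarded digits are a real obstacle: an odd prime has digit \<open>0\<close> equal
  to 1, and for a denominator close to 1 or to \<open>2^n\<close> the bilinear method saves nothing.
  There are \<open>16w\<close> of them, and since the sum of signs is normalised by
  \<open>sqrt n\<close>, losing them is harmless as soon as \<open>w / sqrt n\<close> tends to 0. On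
  the other side the exponential sums save only \<open>2^w\<close> (Cauchy-Schwarz takes the square
  root of the cutoff \<open>2^(2w)\<close>), while comparing moments of order \<open>K\<close> costs
  a fixed power of \<open>n\<close>. So \<open>2^w\<close> has to beat every power of
  \<open>n\<close>, and a power of \<open>n\<close> with exponent below 1/2 is taken for
  \<open>w\<close>. Moments of fixed order suffice because the Taylor remainder of even order
  \<open>K\<close> is bounded by a \<open>K\<close>-th moment, which is itself a combination of
  Walsh functions and so agrees with the uniform one: the tails under the weights
  \<open>\<Lambda>\<close> come from those of independent signs. \<open>K\<close> is chosen before
  \<open>n\<close> grows, hence a Walsh function involves at most \<open>K\<close> digits and a loss
  of \<open>O(n)\<close> for each is affordable.\<close>

definition expi :: "real \<Rightarrow> complex" where "expi x = cis (2 * pi * x)"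

lemma norm_expi [simp]: "norm (expi x) = 1"
  by (simp add: expi_def)

lemma expi_add: "expi (x + y) = expi x * expi y"
  by (simp add: expi_def cis_mult ring_distribs)

lemma cnj_expi: "cnj (expi x) = expi (- x)"
  by (simp add: expi_def cis_cnj)

lemma expi_of_int [simp]: "expi (of_int k) = 1"
  by (auto simp: expi_def cis.ctr complex_eq_iff mult.commute[of pi])

lemma expi_power: "expi (x * of_nat k) = expi x ^ k"
  by (simp add: expi_def Complex.DeMoivre mult_ac)

abbreviation echar :: "int \<Rightarrow> nat \<Rightarrow> nat \<Rightarrow> complex" where
  "echar r q x \<equiv> expi (of_int r / of_nat q * of_nat x)"

abbreviation dchar :: "int \<Rightarrow> nat \<Rightarrow> nat \<Rightarrow> complex" where
  "dchar h m x \<equiv> expi (of_int h / 2 ^ m * of_nat x)"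

abbreviation dchar' :: "nat \<Rightarrow> nat \<Rightarrow> nat \<Rightarrow> complex" where
  "dchar' l m x \<equiv> expi (of_nat l / 2 ^ m * of_nat x)"

lemma norm_one_minus_expi: "norm (1 - expi x) = 2 * \<bar>sin (pi * x)\<bar>"
proof -
  have "norm (1 - expi x) ^ 2 = (2 * \<bar>sin (pi * x)\<bar>) ^ 2"
  proof -
    have c: "cos (2 * pi * x) = 1 - 2 * sin (pi * x) ^ 2"
      using cos_double_sin[of "pi * x"] by (simp add: mult_ac)
    have "norm (1 - expi x) ^ 2 = (1 - cos (2 * pi * x))\<^sup>2 + (sin (2 * pi * x))\<^sup>2"
      by (simp add: cmod_power2 expi_def)
    also have "\<dots> = 2 - 2 * cos (2 * pi * x)"
      using sin_cos_squared_add[of "2 * pi * x"] by (simp add: power2_eq_square algebra_simps)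
    finally show ?thesis unfolding c by (simp add: power_mult_distrib)
  qed
  then show ?thesis by (rule power2_eq_imp_eq) auto
qed

lemma norm_sum_expi_le:
  assumes "expi x \<noteq> 1"
  shows "norm (\<Sum>k\<in>{a..<b}. expi (x * of_nat k)) \<le> 2 / norm (1 - expi x)"
proof (cases "a \<le> b")
  case True
  have ne: "1 - expi x \<noteq> 0" using assms by auto
  have "(1 - expi x) * (\<Sum>k\<in>{a..<b}. expi (x * of_nat k)) = expi x ^ a - expi x ^ b"
    using True
  proof (induction b rule: dec_induct)
    case (step n)
    have "(1 - expi x) * (\<Sum>k\<in>{a..<Suc n}. expi (x * of_nat k))
        = (1 - expi x) * (\<Sum>k\<in>{a..<n}. expi (x * of_nat k)) + (1 - expi x) * expi x ^ n"
      using step.hyps by (simp add: distrib_left expi_power)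
    also have "\<dots> = expi x ^ a - expi x ^ Suc n"
      unfolding step.IH by (simp add: algebra_simps)
    finally show ?case .
  qed simp
  then have "(\<Sum>k\<in>{a..<b}. expi (x * of_nat k)) = (expi x ^ a - expi x ^ b) / (1 - expi x)"
    using ne by (simp add: field_simps)
  then have "norm (\<Sum>k\<in>{a..<b}. expi (x * of_nat k)) = norm (expi x ^ a - expi x ^ b) / norm (1 - expi x)"
    by (simp only: norm_divide)
  also have "\<dots> \<le> 2 / norm (1 - expi x)"
  proof (rule divide_right_mono)
    show "norm (expi x ^ a - expi x ^ b) \<le> 2"
      by (rule order_trans[OF norm_triangle_ineq4]) (simp add: norm_power)
  qed simp
  finally show ?thesis .
qed simp

text \<open>Concavity of sin on [0, pi] gives \<open>2 * y <= sin (pi * y)\<close> up to 1/2, and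
  reflection covers the rest. The bound is symmetric in \<open>x\<close> and \<open>1 - x\<close> so
  that a sum over all residues becomes two equal harmonic sums, without a split at
  \<open>q / 2\<close>.\<close>

lemma sin_pi_ge:
  fixes x :: real
  assumes "0 < x" "x < 1"
  shows "1 / sin (pi * x) \<le> (1 / x + 1 / (1 - x)) / 2"
proof -
  have main: "1 / sin (pi * y) \<le> (1 / y + 1 / (1 - y)) / 2" if y: "0 < y" "y \<le> 1/2" for y :: real
  proof -
    have cv: "convex_on {0..pi} (\<lambda>t. - sin t)"
    proof (rule f''_ge0_imp_convex)
      show "((\<lambda>t. - sin t) has_real_derivative - cos t) (at t)" for t :: real
        by (auto intro!: derivative_eq_intros)
      show "((\<lambda>t. - cos t) has_real_derivative sin t) (at t)" for t :: real
        by (auto intro!: derivative_eq_intros)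
    qed (auto simp: sin_ge_zero)
    have "- sin ((1 - 2*y) *\<^sub>R 0 + (2*y) *\<^sub>R (pi/2)) \<le> (1 - 2*y) * (- sin 0) + (2*y) * (- sin (pi/2))"
      by (rule convex_onD[OF cv]) (use y in auto)
    then have "2 * y \<le> sin (pi * y)" by (simp add: mult_ac)
    then have "1 / sin (pi * y) \<le> 1 / (2 * y)" using y by (intro divide_left_mono) auto
    also have "\<dots> \<le> (1 / y + 1 / (1 - y)) / 2" using y by (simp add: field_simps)
    finally show ?thesis .
  qed
  show ?thesis
  proof (cases "x \<le> 1/2")
    case False
    have "sin (pi * (1 - x)) = sin (pi * x)"
      unfolding right_diff_distrib mult_1_right by (rule sin_pi_minus)
    then show ?thesis using main[of "1 - x"] False assms by (simp add: add.commute)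
  qed (use main assms in auto)
qed

lemma harmonic_sum_pow2: "(\<Sum>r\<in>{1..<2^m}. 1 / real r) \<le> real m"
proof (induction m)
  case (Suc m)
  have "(\<Sum>r\<in>{1..<2^Suc m}. 1 / real r) = (\<Sum>r\<in>{1..<2^m}. 1 / real r) + (\<Sum>r\<in>{2^m..<2^Suc m}. 1 / real r)"
    by (rule sum.atLeastLessThan_concat[symmetric]) auto
  also have "(\<Sum>r\<in>{2^m..<2^Suc m}. 1 / real r) \<le> (\<Sum>r\<in>{2^m..<2^Suc m::nat}. 1 / 2 ^ m)"
    by (rule sum_mono) (auto intro!: divide_left_mono simp: of_nat_le_iff[symmetric] simp del: of_nat_le_iff)
  also have "\<dots> = 1" by simp
  finally show ?case using Suc by simp
qed simp

text \<open>\<open>gker q B\<close> bounds an exponential sum with frequency \<open>r / q\<close> over an interval of at most \<open>B\<close> integers.\<close>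

definition gker :: "nat \<Rightarrow> real \<Rightarrow> int \<Rightarrow> real" where
  "gker q B r = (if int q dvd r then B else 2 / norm (1 - expi (of_int r / of_nat q)))"

lemma expi_div_mod: "q > 0 \<Longrightarrow> expi (of_int (r mod int q) / of_nat q) = expi (of_int r / of_nat q)"
proof -
  assume q: "q > 0"
  have "of_int r = of_int (r mod int q) + real q * of_int (r div int q)"
    by (metis add.commute mult_div_mod_eq of_int_add of_int_mult of_int_of_nat_eq)
  then have "of_int r / real q = of_int (r mod int q) / of_nat q + of_int (r div int q)"
    using q by (simp add: field_simps)
  then show ?thesis by (simp add: expi_add)
qed

lemma gker_mod: "q > 0 \<Longrightarrow> gker q B (r mod int q) = gker q B r"
  by (simp add: gker_def expi_div_mod dvd_mod_iff)

lemma gker_nonneg: "B \<ge> 0 \<Longrightarrow> gker q B r \<ge> 0"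
  by (simp add: gker_def)

lemma norm_one_minus_expi_frac:
  assumes "0 < r" "r < q"
  shows "2 / norm (1 - expi (real r / real q)) \<le> (real q / real r + real q / real (q - r)) / 2"
    and "sin (pi * (real r / real q)) > 0"
proof -
  define x where "x = real r / real q"
  have x: "0 < x" "x < 1" using assms by (auto simp: x_def)
  have s: "sin (pi * x) > 0" using x by (intro sin_gt_zero) auto
  then show "sin (pi * (real r / real q)) > 0" by (simp add: x_def)
  have "2 / norm (1 - expi x) = 1 / sin (pi * x)"
    using s by (simp add: norm_one_minus_expi)
  also have "\<dots> \<le> (1 / x + 1 / (1 - x)) / 2" by (rule sin_pi_ge) (use x in auto)
  also have "1 / x = real q / real r" by (simp add: x_def)
  also have "1 / (1 - x) = real q / real (q - r)"
    using assms by (simp add: x_def of_nat_diff field_simps)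
  finally show "2 / norm (1 - expi (real r / real q)) \<le> (real q / real r + real q / real (q - r)) / 2"
    by (simp add: x_def)
qed

lemma nonzero_residue:
  assumes "q > 0" "\<not> int q dvd r"
  obtains s where "0 < s" "s < q" "int s = r mod int q"
proof
  have "r mod int q \<noteq> 0" "r mod int q \<ge> 0" "r mod int q < int q"
    using assms mod_0_imp_dvd by auto
  then show "0 < nat (r mod int q)" "nat (r mod int q) < q" "int (nat (r mod int q)) = r mod int q"
    by linarith+
qed

lemma expi_frac_neq_1:
  assumes "q > 0" "\<not> int q dvd r"
  shows "expi (of_int r / of_nat q) \<noteq> 1"
proof -
  obtain s where s: "0 < s" "s < q" "int s = r mod int q"
    using assms by (rule nonzero_residue)
  have "expi (of_int r / of_nat q) = expi (real s / real q)"
    using expi_div_mod[of q r] assms s(3) by (metis of_int_of_nat_eq)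
  moreover have "norm (1 - expi (real s / real q)) > 0"
    using norm_one_minus_expi_frac(2)[OF s(1,2)] by (simp add: norm_one_minus_expi)
  ultimately show ?thesis by auto
qed

text \<open>The reduced residue \<open>s\<close> and \<open>q - s\<close> are both at least 1, so
  each fraction is at most \<open>q\<close>. This crude bound serves the type I sums.\<close>

lemma gker_le:
  assumes "q > 0" "\<not> int q dvd r"
  shows "gker q B r \<le> real q"
proof -
  obtain s where s: "0 < s" "s < q" "int s = r mod int q"
    using assms by (rule nonzero_residue)
  have "gker q B r = gker q B (int s)" using gker_mod[of q B r] assms(1) unfolding s(3) by simp
  also have "\<dots> = 2 / norm (1 - expi (real s / real q))"
    using s(1,2) by (auto simp: gker_def simp del: int_dvd_int_iff dest: zdvd_imp_le)
  also have "\<dots> \<le> (real q / real s + real q / real (q - s)) / 2"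
    by (rule norm_one_minus_expi_frac) (use s in auto)
  also have "\<dots> \<le> (real q / 1 + real q / 1) / 2"
    by (intro divide_right_mono add_mono divide_left_mono) (use s in auto)
  finally show ?thesis by simp
qed

text \<open>Residue 0 costs the trivial bound \<open>B\<close>; the others give \<open>2^m\<close>
  times a harmonic sum, since \<open>r\<close> and \<open>2^m - r\<close> run over the same
  set.\<close>

lemma sum_gker_le:
  assumes "B \<ge> 0"
  shows "(\<Sum>r<2^m. gker (2^m) B (int r)) \<le> B + 2 ^ m * real m"
proof -
  let ?q = "2 ^ m :: nat"
  have "{..<?q} = insert 0 {1..<?q}" by auto
  then have "(\<Sum>r<?q. gker ?q B (int r)) = B + (\<Sum>r\<in>{1..<?q}. gker ?q B (int r))"
    by (simp add: gker_def)
  also have "(\<Sum>r\<in>{1..<?q}. gker ?q B (int r)) \<le> (\<Sum>r\<in>{1..<?q}. (real ?q / real r + real ?q / real (?q - r)) / 2)"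
  proof (rule sum_mono)
    fix r assume r: "r \<in> {1..<?q}"
    then have "\<not> int ?q dvd int r" by (auto dest: zdvd_imp_le)
    then have "gker ?q B (int r) = 2 / norm (1 - expi (real r / real ?q))"
      by (simp add: gker_def)
    also have "\<dots> \<le> (real ?q / real r + real ?q / real (?q - r)) / 2"
      by (rule norm_one_minus_expi_frac) (use r in auto)
    finally show "gker ?q B (int r) \<le> \<dots>" .
  qed
  also have "\<dots> = ((\<Sum>r\<in>{1..<?q}. real ?q / real r) + (\<Sum>r\<in>{1..<?q}. real ?q / real (?q - r))) / 2"
    by (simp add: sum_divide_distrib sum.distrib add_divide_distrib)
  also have "(\<Sum>r\<in>{1..<?q}. real ?q / real (?q - r)) = (\<Sum>r\<in>{1..<?q}. real ?q / real r)"
    by (rule sum.reindex_bij_witness[of _ "\<lambda>r. ?q - r" "\<lambda>r. ?q - r"]) auto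
  also have "(\<Sum>r\<in>{1..<?q}. real ?q / real r) = real ?q * (\<Sum>r\<in>{1..<?q}. 1 / real r)"
    by (simp add: sum_distrib_left)
  also have "(\<dots> + \<dots>) / 2 \<le> real ?q * real m"
    using harmonic_sum_pow2[of m] by simp
  finally show ?thesis by simp
qed

lemma bij_betw_affine_mod:
  assumes q: "q > 0" and h: "coprime h (int q)"
  shows "bij_betw (\<lambda>l. nat ((h * (c - int l)) mod int q)) {..<q} {..<q}"
proof -
  have "inj_on (\<lambda>l. nat ((h * (c - int l)) mod int q)) {..<q}"
  proof (rule inj_onI)
    fix x y assume xy: "x \<in> {..<q}" "y \<in> {..<q}"
      and "nat ((h * (c - int x)) mod int q) = nat ((h * (c - int y)) mod int q)"
    then have "(h * (c - int x)) mod int q = (h * (c - int y)) mod int q"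
      using q by (subst (asm) eq_nat_nat_iff) auto
    then have "int q dvd h * (c - int x) - h * (c - int y)" by (simp add: mod_eq_dvd_iff)
    also have "h * (c - int x) - h * (c - int y) = h * (int y - int x)" by (simp add: algebra_simps)
    finally have "int q dvd int y - int x"
      using h by (simp add: coprime_commute coprime_dvd_mult_right_iff)
    then have "int q dvd \<bar>int y - int x\<bar>" by simp
    moreover have "\<bar>int y - int x\<bar> < int q" using xy by auto
    ultimately have "\<bar>int y - int x\<bar> = 0" using zdvd_imp_le by fastforce
    then show "x = y" by simp
  qed
  moreover have "(\<lambda>l. nat ((h * (c - int l)) mod int q)) ` {..<q} \<subseteq> {..<q}"
    using q by (auto simp: nat_less_iff)
  ultimately show ?thesis
    by (simp add: bij_betw_def endo_inj_surj)
qed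

text \<open>An odd \<open>h\<close> is invertible modulo \<open>2^m\<close>, so over a full period
  the numbers \<open>h * (c - l)\<close> run once through all residues, and
  \<open>L div 2^m + 1\<close> periods cover the range. In the bilinear sum \<open>c\<close> is one
  index and \<open>l\<close> the other; the pairs congruent modulo \<open>2^m\<close> cause the term
  \<open>B\<close>.\<close>

lemma sum_gker_affine_le:
  assumes h: "odd h" and B: "B \<ge> 0"
  shows "(\<Sum>l<L. gker (2^m) B (h * (c - int l))) \<le> (real L / 2 ^ m + 1) * (B + 2 ^ m * real m)"
proof -
  let ?q = "2 ^ m :: nat"
  have q: "?q > 0" by simp
  have cop: "coprime h (int ?q)" using h by (cases "m = 0") auto
  define T where "T = L div ?q + 1"
  have block: "(\<Sum>l<?q. gker ?q B (h * (d - int l))) \<le> B + 2 ^ m * real m" for d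
  proof -
    have "(\<Sum>l<?q. gker ?q B (h * (d - int l))) = (\<Sum>l<?q. gker ?q B (int (nat ((h * (d - int l)) mod int ?q))))"
      by (intro sum.cong refl) (subst gker_mod[OF q, symmetric], simp)
    also have "\<dots> = (\<Sum>r<?q. gker ?q B (int r))"
      by (rule sum.reindex_bij_betw[OF bij_betw_affine_mod[OF q cop]])
    finally show ?thesis using sum_gker_le[OF B, of m] by simp
  qed
  have "(\<Sum>l<L. gker ?q B (h * (c - int l))) \<le> (\<Sum>l<T * ?q. gker ?q B (h * (c - int l)))"
  proof (rule sum_mono2)
    have "L < T * ?q" unfolding T_def using dividend_less_div_times[of ?q L] by simp
    then show "{..<L} \<subseteq> {..<T * ?q}" by auto
  qed (use gker_nonneg[OF B] in auto)
  also have "\<dots> = (\<Sum>t<T. sum (\<lambda>l. gker ?q B (h * (c - int l))) {t * ?q..<t * ?q + ?q})"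
    by (rule sum.nat_group[symmetric])
  also have "\<dots> \<le> (\<Sum>t<T. B + 2 ^ m * real m)"
  proof (rule sum_mono)
    fix t
    have "sum (\<lambda>l. gker ?q B (h * (c - int l))) {t * ?q..<t * ?q + ?q} = (\<Sum>l<?q. gker ?q B (h * ((c - int (t * ?q)) - int l)))"
      by (rule sum.reindex_bij_witness[of _ "\<lambda>l. l + t * ?q" "\<lambda>l. l - t * ?q"]) (auto simp: of_nat_diff algebra_simps)
    then show "sum (\<lambda>l. gker ?q B (h * (c - int l))) {t * ?q..<t * ?q + ?q} \<le> B + 2 ^ m * real m"
      using block by simp
  qed
  also have "\<dots> = real T * (B + 2 ^ m * real m)" by simp
  also have "\<dots> \<le> (real L / 2 ^ m + 1) * (B + 2 ^ m * real m)"
  proof (rule mult_right_mono)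
    have "real (L div ?q) \<le> real L / real ?q" using of_nat_div_le_of_nat[of L ?q, where 'a=real] by blast
    then show "real T \<le> real L / 2 ^ m + 1" by (simp add: T_def)
  qed (use B in auto)
  finally show ?thesis .
qed

lemma norm_sum_expi_gker:
  assumes q: "q > 0" and B: "real (b - a) \<le> B"
  shows "norm (\<Sum>k\<in>{a..<b}. echar r q k) \<le> gker q B r"
proof (cases "int q dvd r")
  case True
  have "norm (\<Sum>k\<in>{a..<b}. echar r q k) \<le> (\<Sum>k\<in>{a..<b}. 1)"
    by (rule sum_norm_le) simp
  with True B show ?thesis by (simp add: gker_def)
next
  case False
  then show ?thesis using norm_sum_expi_le[OF expi_frac_neq_1[OF q False]] by (simp add: gker_def)
qed

text \<open>A condition such as \<open>b * k < N\<close> passes to smaller values, so the set that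
  it cuts out is again an interval, over which characters sum geometrically.\<close>

lemma initial_segment_interval:
  fixes A :: "nat set"
  assumes "A \<subseteq> {a..<c}" "\<And>x y. x \<in> A \<Longrightarrow> a \<le> y \<Longrightarrow> y < x \<Longrightarrow> y \<in> A"
  shows "\<exists>d\<le>max a c. A = {a..<d}"
proof (cases "A = {}")
  case True
  then show ?thesis by (intro exI[of _ a]) auto
next
  case False
  have fin: "finite A" using assms(1) finite_subset by blast
  have M: "Max A \<in> A" using fin False by simp
  have "A = {a..<Suc (Max A)}"
    using assms fin M Max_ge[OF fin] by (auto simp: less_Suc_eq_le le_less)
  then show ?thesis using M assms(1) by (intro exI[of _ "Suc (Max A)"]) auto
qed

section \<open>Moebius function and Vaughan's identity\<close>

definition mobius :: "nat \<Rightarrow> real" where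
  "mobius n = (if squarefree n then (- 1) ^ card (prime_factors n) else 0)"

lemma abs_mobius_le: "\<bar>mobius n\<bar> \<le> 1"
  by (simp add: mobius_def)

lemma mobius_mult_prime:
  assumes "prime p" "\<not> p dvd d"
  shows "mobius (p * d) = - mobius d"
proof (cases "squarefree d")
  case True
  then have d: "d > 0" by (auto intro: Nat.gr0I)
  have cop: "coprime p d" using assms by (simp add: prime_imp_coprime)
  have "squarefree (p * d)" using True assms(1) cop
    by (simp add: squarefree_mult_coprime squarefree_prime)
  moreover have "prime_factors (p * d) = insert p (prime_factors d)"
    using assms d by (subst prime_factors_product) (auto simp: prime_prime_factors prime_gt_0_nat)
  moreover have "p \<notin> prime_factors d" using assms by auto
  ultimately show ?thesis using True by (simp add: mobius_def)
next
  case False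
  then have "\<not> squarefree (p * d)" using squarefree_mono[of d "p * d"] by auto
  with False show ?thesis by (simp add: mobius_def)
qed

text \<open>The divisors \<open>d\<close> and \<open>p d\<close> with \<open>p\<close> a fixed prime factor and \<open>p \<nmid> d\<close> cancel.\<close>

lemma sum_mobius_divisors:
  assumes "n > 0"
  shows "(\<Sum>d | d dvd n. mobius d) = (if n = 1 then 1 else 0)"
proof (cases "n = 1")
  case True
  then show ?thesis by (simp add: mobius_def)
next
  case False
  then obtain p where p: "prime p" "p dvd n" using prime_factor_nat by blast
  have fin: "finite {d. d dvd n}" using assms by simp
  define A where "A = {d. d dvd n \<and> \<not> p dvd d}"
  define B where "B = {d. d dvd n \<and> p dvd d \<and> \<not> p ^ 2 dvd d}"
  have p0: "p > 0" using p prime_gt_0_nat by blast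
  have "(\<Sum>d | d dvd n. mobius d) = (\<Sum>d\<in>A \<union> B. mobius d)"
  proof (rule sum.mono_neutral_right[OF fin])
    show "\<forall>d\<in>{d. d dvd n} - (A \<union> B). mobius d = 0"
    proof
      fix d assume "d \<in> {d. d dvd n} - (A \<union> B)"
      then have "p ^ 2 dvd d" by (auto simp: A_def B_def)
      then have "\<not> squarefree d" using p by (auto simp: squarefree_def)
      then show "mobius d = 0" by (simp add: mobius_def)
    qed
  qed (auto simp: A_def B_def)
  also have "\<dots> = (\<Sum>d\<in>A. mobius d) + (\<Sum>d\<in>B. mobius d)"
    by (rule sum.union_disjoint) (use fin in \<open>auto simp: A_def B_def\<close>)
  also have "(\<Sum>d\<in>B. mobius d) = (\<Sum>d\<in>A. mobius (p * d))"
  proof (rule sum.reindex_bij_witness[of _ "\<lambda>d. p * d" "\<lambda>d. d div p"])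
    fix d assume "d \<in> A"
    then have d: "d dvd n" "\<not> p dvd d" by (auto simp: A_def)
    then have "coprime p d" using p by (simp add: prime_imp_coprime)
    then have "p * d dvd n" using d p by (simp add: divides_mult)
    then show "p * d \<in> B" using d p0 by (auto simp: B_def power2_eq_square)
  next
    fix d assume "d \<in> B"
    then obtain e where e: "d = p * e" "d dvd n" "\<not> p ^ 2 dvd d" by (auto simp: B_def)
    then have "\<not> p dvd e" by (auto simp: power2_eq_square)
    moreover have "e dvd n" using e(1,2) by (metis dvd_trans dvd_triv_right)
    ultimately show "d div p \<in> A" using e p0 by (auto simp: A_def)
  qed (use p0 in \<open>auto simp: A_def B_def\<close>)
  also have "\<dots> = (\<Sum>d\<in>A. - mobius d)"
    by (rule sum.cong) (auto simp: A_def mobius_mult_prime[OF p(1)])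
  finally show ?thesis using False by (simp add: sum_negf)
qed

lemma div_pos_of_dvd: "b dvd n \<Longrightarrow> n > 0 \<Longrightarrow> n div b > (0 :: nat)"
  using dvd_pos_nat[of n b] by (simp add: div_greater_zero_iff dvd_imp_le)

text \<open>Both sides run over the pairs whose product \<open>b * c\<close> divides
  \<open>n\<close>.\<close>

lemma sum_divisors_assoc:
  fixes n :: nat and H :: "nat \<Rightarrow> nat \<Rightarrow> 'a :: comm_monoid_add"
  assumes "n > 0"
  shows "(\<Sum>b | b dvd n. \<Sum>c | c dvd n div b. H b c) =
         (\<Sum>c | c dvd n. \<Sum>b | b dvd n div c. H b c)"
proof -
  have fin: "finite {b. b dvd m}" if "m > 0" for m :: nat using that by simp
  have f1: "\<forall>b\<in>{b. b dvd n}. finite {c. c dvd n div b}"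
  proof safe
    fix b assume "b dvd n"
    then have "n div b > 0" using assms by (intro div_pos_of_dvd) auto
    then show "finite {c. c dvd n div b}" by (rule fin)
  qed
  have "(\<Sum>b | b dvd n. \<Sum>c | c dvd n div b. H b c) =
     (\<Sum>(b, c)\<in>Sigma {b. b dvd n} (\<lambda>b. {c. c dvd n div b}). H b c)"
    by (rule sum.Sigma) (use f1 fin[OF assms] in auto)
  also have "\<dots> = (\<Sum>(c, b)\<in>Sigma {b. b dvd n} (\<lambda>b. {c. c dvd n div b}). H b c)"
  proof (rule sum.reindex_bij_witness[of _ prod.swap prod.swap])
    have sw: "(c, b) \<in> Sigma {b. b dvd n} (\<lambda>b. {c. c dvd n div b})"
      if "(b, c) \<in> Sigma {b. b dvd n} (\<lambda>b. {c. c dvd n div b})" for b c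
    proof -
      from that obtain k where k: "n = b * k" by auto
      with that assms obtain l where l: "k = c * l" by auto
      have "n = c * (b * l)" "c > 0" using k l assms by auto
      then show ?thesis by auto
    qed
    fix p assume p: "p \<in> Sigma {b. b dvd n} (\<lambda>b. {c. c dvd n div b})"
    then have "(fst p, snd p) \<in> Sigma {b. b dvd n} (\<lambda>b. {c. c dvd n div b})" by simp
    then have "(snd p, fst p) \<in> Sigma {b. b dvd n} (\<lambda>b. {c. c dvd n div b})" by (rule sw)
    then show "prod.swap p \<in> Sigma {b. b dvd n} (\<lambda>b. {c. c dvd n div b})"
      by (simp only: prod.swap_def)
    then show "prod.swap p \<in> Sigma {b. b dvd n} (\<lambda>b. {c. c dvd n div b})" .
  qed (auto simp: case_prod_unfold)
  also have "\<dots> = (\<Sum>c | c dvd n. \<Sum>b | b dvd n div c. H b c)"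
    by (rule sum.Sigma[symmetric]) (use f1 fin[OF assms] in auto)
  finally show ?thesis .
qed

lemma mobius_inversion:
  assumes "n > 0"
  shows "(\<Sum>b | b dvd n. mobius b * (\<Sum>c | c dvd n div b. g c)) = g n"
proof -
  have "(\<Sum>b | b dvd n. mobius b * (\<Sum>c | c dvd n div b. g c)) =
        (\<Sum>b | b dvd n. \<Sum>c | c dvd n div b. mobius b * g c)"
    by (simp add: sum_distrib_left)
  also have "\<dots> = (\<Sum>c | c dvd n. \<Sum>b | b dvd n div c. mobius b * g c)"
    by (rule sum_divisors_assoc[OF assms])
  also have "\<dots> = (\<Sum>c | c dvd n. g c * (\<Sum>b | b dvd n div c. mobius b))"
    by (simp add: sum_distrib_left mult.commute)
  also have "\<dots> = (\<Sum>c | c dvd n. if c = n then g c else 0)"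
  proof (rule sum.cong[OF refl])
    fix c assume "c \<in> {c. c dvd n}"
    then obtain k where k: "n = c * k" by auto
    then have "n div c > 0" "n div c = 1 \<longleftrightarrow> c = n" using assms by auto
    then show "g c * (\<Sum>b | b dvd n div c. mobius b) = (if c = n then g c else 0)"
      by (simp add: sum_mobius_divisors)
  qed
  also have "\<dots> = g n" using assms by simp
  finally show ?thesis .
qed

text \<open>
  In Vaughan's identity the factor \<open>1\<close> is grouped with \<open>\<Lambda>\<close> instead of \<open>\<mu>\<close>: both coefficient
  sequences of the type II sum are then bounded pointwise, by \<open>1\<close> and \<open>ln\<close>, and no divisor sums occur.
\<close>

definition mangoldt_tail :: "nat \<Rightarrow> nat \<Rightarrow> real" where
  "mangoldt_tail U k = (\<Sum>c | c dvd k \<and> U \<le> c. mangoldt c)"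

lemma mangoldt_le_ln: "n > 0 \<Longrightarrow> (mangoldt n :: real) \<le> ln (real n)"
  using mangoldt_sum[of n, where 'a=real] member_le_sum[of n "{d. d dvd n}" "mangoldt :: nat \<Rightarrow> real"]
  by (auto simp: mangoldt_nonneg)

lemma mangoldt_tail_split:
  assumes "k > 0"
  shows "ln (real k) = (\<Sum>c | c dvd k \<and> c < U. mangoldt c) + mangoldt_tail U k"
proof -
  have eq: "{c. c dvd k} = {c. c dvd k \<and> c < U} \<union> {c. c dvd k \<and> U \<le> c}" by auto
  have "(\<Sum>c | c dvd k. mangoldt c :: real) = (\<Sum>c | c dvd k \<and> c < U. mangoldt c) + mangoldt_tail U k"
    unfolding mangoldt_tail_def using assms
    by (subst eq, intro sum.union_disjoint) auto
  then show ?thesis using mangoldt_sum[of k, where 'a=real] assms by simp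
qed

lemma mangoldt_tail_bounds:
  assumes "k > 0"
  shows "0 \<le> mangoldt_tail U k" "mangoldt_tail U k \<le> ln (real k)"
proof -
  show "0 \<le> mangoldt_tail U k" by (simp add: mangoldt_tail_def sum_nonneg mangoldt_nonneg)
  have "0 \<le> (\<Sum>c | c dvd k \<and> c < U. mangoldt c :: real)" by (simp add: sum_nonneg mangoldt_nonneg)
  then show "mangoldt_tail U k \<le> ln (real k)" using mangoldt_tail_split[OF assms, of U] by simp
qed

lemma mangoldt_tail_eq_0:
  assumes "0 < k" "k < U"
  shows "mangoldt_tail U k = 0"
proof -
  have "{c. c dvd k \<and> U \<le> c} = {}" using assms by (auto dest: dvd_imp_le)
  then show ?thesis unfolding mangoldt_tail_def by (simp only: sum.empty)
qed

text \<open>Moebius inversion is applied to \<open>mangoldt\<close> restricted to arguments from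
  \<open>U\<close> on, whose divisor sum is \<open>mangoldt_tail U\<close>. For \<open>b < U\<close>
  this tail is rewritten as the logarithm minus the short sum over \<open>c < U\<close>. The lines
  are the small arguments, two type I terms, and the type II term, where both factors are at least
  \<open>U\<close> because the tail vanishes below \<open>U\<close>.\<close>

lemma vaughan_identity:
  assumes "n > 0"
  shows "mangoldt n = (if n < U then mangoldt n else 0)
    + (\<Sum>b | b dvd n. (if b < U then mobius b * ln (real (n div b)) else 0))
    - (\<Sum>b | b dvd n. (if b < U then mobius b * (\<Sum>c | c dvd n div b \<and> c < U. mangoldt c) else 0))
    + (\<Sum>b | b dvd n. (if b < U then 0 else mobius b * mangoldt_tail U (n div b)))"
proof -
  let ?g = "\<lambda>c. if c < U then 0 else mangoldt c :: real"
  have "?g n = (\<Sum>b | b dvd n. mobius b * (\<Sum>c | c dvd n div b. ?g c))"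
    by (rule mobius_inversion[OF assms, symmetric])
  also have "\<dots> = (\<Sum>b | b dvd n. mobius b * mangoldt_tail U (n div b))"
  proof (rule sum.cong[OF refl])
    fix b assume "b \<in> {b. b dvd n}"
    then have "n div b > 0" using assms by (intro div_pos_of_dvd) auto
    then have "(\<Sum>c | c dvd n div b. ?g c) = mangoldt_tail U (n div b)"
      unfolding mangoldt_tail_def by (intro sum.mono_neutral_cong_right) auto
    then show "mobius b * (\<Sum>c | c dvd n div b. ?g c) = mobius b * mangoldt_tail U (n div b)" by simp
  qed
  also have "\<dots> = (\<Sum>b | b dvd n.
      (if b < U then mobius b * ln (real (n div b)) else 0)
      - (if b < U then mobius b * (\<Sum>c | c dvd n div b \<and> c < U. mangoldt c) else 0)
      + (if b < U then 0 else mobius b * mangoldt_tail U (n div b)))"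
  proof (rule sum.cong[OF refl])
    fix b assume "b \<in> {b. b dvd n}"
    then have "n div b > 0" using assms by (intro div_pos_of_dvd) auto
    from mangoldt_tail_split[OF this, of U]
    show "mobius b * mangoldt_tail U (n div b) = (if b < U then mobius b * ln (real (n div b)) else 0)
      - (if b < U then mobius b * (\<Sum>c | c dvd n div b \<and> c < U. mangoldt c) else 0)
      + (if b < U then 0 else mobius b * mangoldt_tail U (n div b))"
      by (simp add: algebra_simps)
  qed
  finally have "?g n = \<dots>" .
  moreover have "mangoldt n = (if n < U then mangoldt n else 0) + ?g n" by simp
  ultimately show ?thesis unfolding sum.distrib sum_subtractf by linarith
qed

lemma sum_divisors_swap:
  fixes H :: "nat \<Rightarrow> nat \<Rightarrow> 'a :: comm_monoid_add"
  shows "(\<Sum>n\<in>{1..<N}. \<Sum>b | b dvd n. H b (n div b)) = (\<Sum>b\<in>{1..<N}. \<Sum>k | 0 < k \<and> b * k < N. H b k)"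
proof -
  have fin: "finite {k. 0 < k \<and> b * k < N}" if "b \<in> {1..<N}" for b
  proof (rule finite_subset[of _ "{..<N}"])
    have "k \<le> b * k" for k using that by simp
    then show "{k. 0 < k \<and> b * k < N} \<subseteq> {..<N}" using le_less_trans by blast
  qed simp
  have "(\<Sum>n\<in>{1..<N}. \<Sum>b | b dvd n. H b (n div b)) = (\<Sum>(n, b)\<in>Sigma {1..<N} (\<lambda>n. {b. b dvd n}). H b (n div b))"
    by (rule sum.Sigma) auto
  also have "\<dots> = (\<Sum>(b, k)\<in>Sigma {1..<N} (\<lambda>b. {k. 0 < k \<and> b * k < N}). H b k)"
  proof (rule sum.reindex_bij_witness[of _ "\<lambda>(b, k). (b * k, b)" "\<lambda>(n, b). (b, n div b)"])
    fix x assume "x \<in> Sigma {1..<N} (\<lambda>n. {b. b dvd n})"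
    then obtain n b where x: "x = (n, b)" "0 < n" "n < N" "b dvd n" by (cases x) auto
    then obtain k where k: "n = b * k" by auto
    then show "(\<lambda>(n, b). (b, n div b)) x \<in> Sigma {1..<N} (\<lambda>b. {k. 0 < k \<and> b * k < N})"
      using x by (auto simp: Suc_le_eq intro: le_less_trans[of b "b * k"])
  next
    fix x assume "x \<in> Sigma {1..<N} (\<lambda>b. {k. 0 < k \<and> b * k < N})"
    then show "(\<lambda>(b, k). (b * k, b)) x \<in> Sigma {1..<N} (\<lambda>n. {b. b dvd n})" by (cases x) (auto simp: Suc_le_eq)
  qed auto
  also have "\<dots> = (\<Sum>b\<in>{1..<N}. \<Sum>k | 0 < k \<and> b * k < N. H b k)"
    by (rule sum.Sigma[symmetric]) (use fin in auto)
  finally show ?thesis .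
qed

section \<open>Sums of the von Mangoldt function against characters\<close>

text \<open>Abel summation: \<open>ln k\<close> is the sum of the increments
  \<open>\<delta> j\<close> over \<open>1 <= j < k\<close>. Each final segment of the sum of
  \<open>z\<close> thus gets a nonnegative weight, and the weights telescope to
  \<open>ln K\<close>.\<close>

lemma norm_sum_ln_le:
  fixes z :: "nat \<Rightarrow> complex"
  assumes G: "\<And>a b. norm (\<Sum>k\<in>{a..<b}. z k) \<le> G" and K: "K \<ge> 1"
  shows "norm (\<Sum>k\<in>{1..<K}. ln (real k) *\<^sub>R z k) \<le> G * ln (real K)"
proof -
  define \<delta> where "\<delta> j = ln (real (Suc j)) - ln (real j)" for j
  have d0: "\<delta> j \<ge> 0" if "j \<ge> 1" for j using that by (simp add: \<delta>_def)
  have sd: "(\<Sum>j\<in>{1..<K}. \<delta> j) = ln (real K)" if "K \<ge> 1" for K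
    unfolding \<delta>_def using that by (subst sum_Suc_diff') auto
  have "(\<Sum>k\<in>{1..<K}. ln (real k) *\<^sub>R z k) = (\<Sum>j\<in>{1..<K}. \<delta> j *\<^sub>R (\<Sum>k\<in>{Suc j..<K}. z k))"
    using K
  proof (induction K rule: dec_induct)
    case (step K)
    have "(\<Sum>j\<in>{1..<Suc K}. \<delta> j *\<^sub>R (\<Sum>k\<in>{Suc j..<Suc K}. z k))
        = (\<Sum>j\<in>{1..<K}. \<delta> j *\<^sub>R (\<Sum>k\<in>{Suc j..<Suc K}. z k))"
      using step.hyps by simp
    also have "\<dots> = (\<Sum>j\<in>{1..<K}. \<delta> j *\<^sub>R (\<Sum>k\<in>{Suc j..<K}. z k) + \<delta> j *\<^sub>R z K)"
      by (rule sum.cong) (auto simp: scaleR_add_right)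
    also have "\<dots> = (\<Sum>j\<in>{1..<K}. \<delta> j *\<^sub>R (\<Sum>k\<in>{Suc j..<K}. z k)) + (\<Sum>j\<in>{1..<K}. \<delta> j) *\<^sub>R z K"
      by (simp only: sum.distrib scaleR_sum_left)
    finally show ?case using step sd[of K] by simp
  qed simp
  also have "norm \<dots> \<le> (\<Sum>j\<in>{1..<K}. \<delta> j * G)"
    by (rule sum_norm_le) (use d0 G in \<open>auto intro!: mult_left_mono\<close>)
  also have "\<dots> = G * ln (real K)" using sd[OF K] by (simp flip: sum_distrib_right)
  finally show ?thesis .
qed

lemma multiples_below_interval:
  fixes b N :: nat
  assumes "b > 0" "N > 0"
  shows "\<exists>c. 1 \<le> c \<and> c \<le> N \<and> {k. 0 < k \<and> b * k < N} = {1..<c}"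
proof -
  have "\<exists>d\<le>max 1 N. {k. 0 < k \<and> b * k < N} = {1..<d}"
  proof (rule initial_segment_interval)
    show "{k. 0 < k \<and> b * k < N} \<subseteq> {1..<N}"
    proof
      fix k assume k: "k \<in> {k. 0 < k \<and> b * k < N}"
      have "k \<le> b * k" using assms by simp
      also have "\<dots> < N" using k by simp
      finally show "k \<in> {1..<N}" using k by simp
    qed
    fix x y :: nat assume x: "x \<in> {k. 0 < k \<and> b * k < N}" and y: "1 \<le> y" "y < x"
    have "b * y \<le> b * x" using y by simp
    also have "\<dots> < N" using x by simp
    finally show "y \<in> {k. 0 < k \<and> b * k < N}" using y by simp
  qed
  then obtain d where d: "d \<le> max 1 N" "{k. 0 < k \<and> b * k < N} = {1..<d}" by blast
  have "{k. 0 < k \<and> b * k < N} = {1..<max 1 d}" unfolding d(2) by auto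
  moreover have "1 \<le> max 1 d" "max 1 d \<le> N" using d(1) assms by auto
  ultimately show ?thesis by blast
qed

text \<open>\<open>h\<close> is prime to \<open>2^m\<close>, so \<open>h * d\<close> is a nonzero
  residue and the geometric sum never degenerates.\<close>

lemma expi_sum_multiples_le:
  assumes h: "odd h" and d: "\<not> 2 ^ m dvd (d :: nat)"
  shows "norm (\<Sum>k\<in>{a..<b}. dchar h m (d * k)) \<le> 2 ^ m"
proof -
  let ?q = "2 ^ m :: nat"
  have "coprime (int ?q) h" using h by (cases "m = 0") auto
  then have nd: "\<not> int ?q dvd h * int d"
    using d by (metis coprime_dvd_mult_right_iff int_dvd_int_iff)
  have "(\<Sum>k\<in>{a..<b}. dchar h m (d * k))
      = (\<Sum>k\<in>{a..<b}. echar (h * int d) ?q k)"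
    by (simp add: mult_ac)
  also have "norm \<dots> \<le> gker ?q (real (b - a)) (h * int d)"
    by (rule norm_sum_expi_gker) auto
  also have "\<dots> \<le> real ?q" by (rule gker_le) (use nd in auto)
  finally show ?thesis by simp
qed

text \<open>Cauchy-Schwarz in \<open>b\<close> removes the unknown \<open>\<beta>\<close>. After the
  square is opened, each pair \<open>k\<close>, \<open>l\<close> leaves a character of frequency
  \<open>h * (k - l)\<close> summed over an interval of \<open>b\<close>, and the bounds for these
  are added up over \<open>l\<close>. The condition \<open>b * k < N\<close> is a factor of the
  summand, so that the range of \<open>k\<close> is independent of \<open>b\<close> and the sums can
  be exchanged.\<close>

lemma bilinear_bound:
  fixes \<beta> \<gamma> :: "nat \<Rightarrow> real"
  assumes h: "odd h" and \<beta>: "\<And>b. \<bar>\<beta> b\<bar> \<le> 1" and \<gamma>: "\<And>k. k \<in> {1..<M} \<Longrightarrow> \<bar>\<gamma> k\<bar> \<le> G"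
  shows "norm (\<Sum>b\<in>{B..<2*B}. \<beta> b *\<^sub>R (\<Sum>k\<in>{1..<M}. (of_bool (b * k < N) * \<gamma> k) *\<^sub>R dchar h m (b * k))) ^ 2
    \<le> real B * (G ^ 2 * (real M * ((real M / 2 ^ m + 1) * (real B + 2 ^ m * real m))))"
proof -
  define z where "z b = (\<Sum>k\<in>{1..<M}. (of_bool (b * k < N) * \<gamma> k) *\<^sub>R dchar h m (b * k))" for b
  let ?D = "(real M / 2 ^ m + 1) * (real B + 2 ^ m * real m)"
  have "norm (\<Sum>b\<in>{B..<2*B}. \<beta> b *\<^sub>R z b) \<le> (\<Sum>b\<in>{B..<2*B}. norm (z b))"
  proof (rule sum_norm_le)
    show "norm (\<beta> b *\<^sub>R z b) \<le> norm (z b)" for b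
      using mult_right_mono[OF \<beta>, of "norm (z b)"] by simp
  qed
  then have "norm (\<Sum>b\<in>{B..<2*B}. \<beta> b *\<^sub>R z b) ^ 2 \<le> (\<Sum>b\<in>{B..<2*B}. norm (z b)) ^ 2"
    by (rule power_mono) simp
  also have "\<dots> \<le> (\<Sum>b\<in>{B..<2*B}. norm (z b) ^ 2) * card {B..<2*B}"
    by (rule sum_squared_le_sum_of_squares) 
  finally have 1: "norm (\<Sum>b\<in>{B..<2*B}. \<beta> b *\<^sub>R z b) ^ 2 \<le> real B * (\<Sum>b\<in>{B..<2*B}. norm (z b) ^ 2)"
    by (simp add: mult.commute)
  have zz: "z b * cnj (z b) = (\<Sum>k\<in>{1..<M}. \<Sum>l\<in>{1..<M}. (\<gamma> k * \<gamma> l) *\<^sub>R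
      (of_bool (b * k < N \<and> b * l < N) * echar (h * (int k - int l)) (2 ^ m) b))" for b
  proof -
    have "z b * cnj (z b) = (\<Sum>k\<in>{1..<M}. \<Sum>l\<in>{1..<M}. 
      ((of_bool (b * k < N) * \<gamma> k) *\<^sub>R dchar h m (b * k)) *
      ((of_bool (b * l < N) * \<gamma> l) *\<^sub>R expi (- (of_int h / 2 ^ m * of_nat (b * l)))))"
      by (simp add: z_def sum_product cnj_expi)
    also have "\<dots> = (\<Sum>k\<in>{1..<M}. \<Sum>l\<in>{1..<M}. (\<gamma> k * \<gamma> l) *\<^sub>R
      (of_bool (b * k < N \<and> b * l < N) * echar (h * (int k - int l)) (2 ^ m) b))"
    proof (intro sum.cong refl)
      fix k l
      have "echar (h * (int k - int l)) (2 ^ m) b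
         = dchar h m (b * k) * expi (- (of_int h / 2 ^ m * of_nat (b * l)))"
        unfolding expi_add[symmetric] by (simp add: field_simps)
      then show "((of_bool (b * k < N) * \<gamma> k) *\<^sub>R dchar h m (b * k)) *
      ((of_bool (b * l < N) * \<gamma> l) *\<^sub>R expi (- (of_int h / 2 ^ m * of_nat (b * l)))) = (\<gamma> k * \<gamma> l) *\<^sub>R
      (of_bool (b * k < N \<and> b * l < N) * echar (h * (int k - int l)) (2 ^ m) b)"
        by simp
    qed
    finally show ?thesis .
  qed
  have "of_real (\<Sum>b\<in>{B..<2*B}. norm (z b) ^ 2) = (\<Sum>b\<in>{B..<2*B}. z b * cnj (z b))"
    by (simp only: of_real_sum complex_norm_square)
  also have "\<dots> = (\<Sum>k\<in>{1..<M}. \<Sum>b\<in>{B..<2*B}. \<Sum>l\<in>{1..<M}. (\<gamma> k * \<gamma> l) *\<^sub>R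
      (of_bool (b * k < N \<and> b * l < N) * echar (h * (int k - int l)) (2 ^ m) b))"
    unfolding zz by (rule sum.swap)
  also have "\<dots> = (\<Sum>k\<in>{1..<M}. \<Sum>l\<in>{1..<M}. \<Sum>b\<in>{B..<2*B}. (\<gamma> k * \<gamma> l) *\<^sub>R
      (of_bool (b * k < N \<and> b * l < N) * echar (h * (int k - int l)) (2 ^ m) b))"
    by (intro sum.cong refl sum.swap)
  also have "\<dots> = (\<Sum>k\<in>{1..<M}. \<Sum>l\<in>{1..<M}. (\<gamma> k * \<gamma> l) *\<^sub>R (\<Sum>b\<in>{b\<in>{B..<2*B}. b * k < N \<and> b * l < N}.
      echar (h * (int k - int l)) (2 ^ m) b))"
    by (intro sum.cong refl) (simp add: scaleR_sum_right[symmetric] sum.inter_filter[symmetric] of_bool_def if_distrib if_distribR cong: if_cong)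
  finally have eq: "of_real (\<Sum>b\<in>{B..<2*B}. norm (z b) ^ 2) = \<dots>" .
  have "(\<Sum>b\<in>{B..<2*B}. norm (z b) ^ 2) = norm (of_real (\<Sum>b\<in>{B..<2*B}. norm (z b) ^ 2) :: complex)"
    by (subst norm_of_real) (simp add: sum_nonneg)
  also have "\<dots> \<le> (\<Sum>k\<in>{1..<M}. \<Sum>l\<in>{1..<M}. G ^ 2 * gker (2 ^ m) (real B) (h * (int k - int l)))"
    unfolding eq
  proof (intro sum_norm_le)
    fix k l assume kl: "k \<in> {1..<M}" "l \<in> {1..<M}"
    have "\<exists>d\<le>max B (2*B). {b\<in>{B..<2*B}. b * k < N \<and> b * l < N} = {B..<d}"
    proof (rule initial_segment_interval)
      fix x y assume x: "x \<in> {b \<in> {B..<2 * B}. b * k < N \<and> b * l < N}" and y: "B \<le> y" "y < x"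
      have "y * k \<le> x * k" "y * l \<le> x * l" using y by auto
      moreover have "x * k < N" "x * l < N" "x < 2 * B" using x by auto
      ultimately have "y * k < N" "y * l < N" using le_less_trans by blast+
      with x y show "y \<in> {b \<in> {B..<2 * B}. b * k < N \<and> b * l < N}" by auto
    qed auto
    then obtain d where d: "d \<le> 2 * B" "{b\<in>{B..<2*B}. b * k < N \<and> b * l < N} = {B..<d}" by auto
    have "norm (\<Sum>b\<in>{b\<in>{B..<2*B}. b * k < N \<and> b * l < N}. echar (h * (int k - int l)) (2 ^ m) b)
      \<le> gker (2 ^ m) (real B) (h * (int k - int l))"
      unfolding d(2) by (rule norm_sum_expi_gker) (use d(1) in auto)
    moreover have "\<bar>\<gamma> k * \<gamma> l\<bar> \<le> G ^ 2"
      unfolding power2_eq_square abs_mult by (intro mult_mono \<gamma> kl) (use \<gamma>[OF kl(1)] in auto)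
    ultimately show "norm ((\<gamma> k * \<gamma> l) *\<^sub>R (\<Sum>b\<in>{b\<in>{B..<2*B}. b * k < N \<and> b * l < N}.
      echar (h * (int k - int l)) (2 ^ m) b)) \<le> G ^ 2 * gker (2 ^ m) (real B) (h * (int k - int l))"
      unfolding norm_scaleR by (intro mult_mono) auto
  qed
  also have "\<dots> \<le> (\<Sum>k\<in>{1..<M}. G ^ 2 * ?D)"
  proof (rule sum_mono)
    fix k
    have "(\<Sum>l\<in>{1..<M}. gker (2 ^ m) (real B) (h * (int k - int l))) \<le> (\<Sum>l<M. gker (2 ^ m) (real B) (h * (int k - int l)))"
      by (rule sum_mono2) (auto intro: gker_nonneg)
    also have "\<dots> \<le> ?D" by (rule sum_gker_affine_le[OF h]) simp
    finally show "(\<Sum>l\<in>{1..<M}. G ^ 2 * gker (2 ^ m) (real B) (h * (int k - int l))) \<le> G ^ 2 * ?D"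
      by (simp add: sum_distrib_left[symmetric] mult_left_mono)
  qed
  also have "\<dots> = real (M - 1) * (G ^ 2 * ?D)" by simp
  also have "\<dots> \<le> real M * (G ^ 2 * ?D)"
    by (intro mult_right_mono mult_nonneg_nonneg add_nonneg_nonneg) auto
  finally have "(\<Sum>b\<in>{B..<2*B}. norm (z b) ^ 2) \<le> G ^ 2 * (real M * ?D)" by (simp add: mult_ac)
  then show ?thesis using 1 unfolding z_def[symmetric]
    by (meson mult_left_mono of_nat_0_le_iff order_trans)
qed

lemma sum_dyadic_blocks:
  fixes g :: "nat \<Rightarrow> 'a :: comm_monoid_add"
  assumes "a \<le> n"
  shows "(\<Sum>i\<in>{a..<n}. \<Sum>b\<in>{2^i..<2*2^i}. g b) = (\<Sum>b\<in>{2^a..<2^n}. g b)"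
  using assms
proof (induction n rule: dec_induct)
  case (step n)
  have "(\<Sum>i\<in>{a..<Suc n}. \<Sum>b\<in>{2^i..<2*2^i}. g b) = (\<Sum>b\<in>{2^a..<2^n}. g b) + (\<Sum>b\<in>{2^n..<2*2^n}. g b)"
    using step by simp
  also have "\<dots> = (\<Sum>b\<in>{2^a..<2^Suc n}. g b)"
    using step.hyps by (subst sum.atLeastLessThan_concat) (auto intro: power_increasing)
  finally show ?case .
qed simp

lemma ln_less_pow2: "0 < k \<Longrightarrow> k < 2 ^ n \<Longrightarrow> ln (real k) \<le> real n"
proof -
  assume k: "0 < k" "k < 2 ^ n"
  have "ln (real k) \<le> ln (2 ^ n)" using k by (simp add: of_nat_less_iff[symmetric] del: of_nat_less_iff)
  also have "\<dots> = real n * ln 2" by (simp add: ln_realpow)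
  also have "\<dots> \<le> real n * 1" by (intro mult_left_mono) (use ln_le_minus_one[of 2] in auto)
  finally show ?thesis by simp
qed

text \<open>For \<open>b\<close> between \<open>2^i\<close> and \<open>2^(i+1)\<close> only
  \<open>k < 2^(n - i)\<close> matter. There are at most \<open>n\<close> such dyadic blocks, and in
  each the bilinear bound saves \<open>2^(2w)\<close> for the square of the norm, hence
  \<open>2^w\<close> for the norm.\<close>

lemma type_II_bound:
  assumes h: "odd h" and m: "8 * w \<le> m" "m + 8 * w \<le> n"
    and \<beta>: "\<And>b. \<bar>\<beta> b\<bar> \<le> 1"
    and \<gamma>: "\<And>k. 0 < k \<Longrightarrow> k < 2 ^ n \<Longrightarrow> \<bar>\<gamma> k\<bar> \<le> real n" and \<gamma>0: "\<And>k. 0 < k \<Longrightarrow> k < 2 ^ (2 * w) \<Longrightarrow> \<gamma> k = 0"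
  shows "norm (\<Sum>b\<in>{2 ^ (2 * w)..<2 ^ n}. \<beta> b *\<^sub>R (\<Sum>k | 0 < k \<and> b * k < 2 ^ n. \<gamma> k *\<^sub>R dchar h m (b * k)))
    \<le> 2 * real n ^ 3 * 2 ^ n / 2 ^ w" 
proof -
  let ?N = "2 ^ n :: nat" and ?F = "\<lambda>x::nat. dchar h m x"
  let ?g = "\<lambda>b. \<beta> b *\<^sub>R (\<Sum>k | 0 < k \<and> b * k < ?N. \<gamma> k *\<^sub>R ?F (b * k))"
  have n2w: "2 * w \<le> n" using m by simp
  have block: "norm (\<Sum>b\<in>{2^i..<2*2^i}. ?g b) \<le> 2 * real n ^ 2 * 2 ^ n / 2 ^ w" if i: "i \<in> {2*w..<n}" for i
  proof -
    let ?M = "2 ^ (n - i) :: nat"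
    have iN: "2 ^ i * ?M = ?N" using i by (simp flip: power_add)
    have eqg: "?g b = \<beta> b *\<^sub>R (\<Sum>k\<in>{1..<?M}. (of_bool (b * k < ?N) * \<gamma> k) *\<^sub>R ?F (b * k))"
      if b: "b \<in> {2^i..<2*2^i}" for b
    proof -
      have "k < ?M" if "b * k < ?N" for k
      proof (rule ccontr)
        assume "\<not> k < ?M"
        then have "2 ^ i * ?M \<le> b * k" using b by (intro mult_le_mono) auto
        then show False using that iN by simp
      qed
      then have eq: "{k. 0 < k \<and> b * k < ?N} = {k\<in>{1..<?M}. b * k < ?N}" by (auto simp: Suc_le_eq)
      show ?thesis
        unfolding eq sum.inter_filter[OF finite_atLeastLessThan]
        by (intro arg_cong[where f = "scaleR (\<beta> b)"] sum.cong) auto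
    qed
    show ?thesis
    proof (cases "i < n - 2 * w")
      \<comment> \<open>Here \<open>k < 2^(n - i) <= 2^(2w)\<close>, which is where
        \<open>\<gamma>\<close> vanishes.\<close>
      case False
      have "\<gamma> k = 0" if "k \<in> {1..<?M}" for k
      proof (rule \<gamma>0)
        have "?M \<le> 2 ^ (2 * w)" using False by (intro power_increasing) auto
        with that show "k < 2 ^ (2 * w)" by (auto intro: less_le_trans)
      qed (use that in auto)
      then have "?g b = 0" if "b \<in> {2^i..<2*2^i}" for b
        unfolding eqg[OF that] by simp
      then have "(\<Sum>b\<in>{2^i..<2*2^i}. ?g b) = 0" by (intro sum.neutral) auto
      then show ?thesis by simp
    next
      case True
      have "norm (\<Sum>b\<in>{2^i..<2*2^i}. ?g b) ^ 2 = norm (\<Sum>b\<in>{2^i..<2*2^i}. \<beta> b *\<^sub>R (\<Sum>k\<in>{1..<?M}. (of_bool (b * k < ?N) * \<gamma> k) *\<^sub>R ?F (b * k))) ^ 2"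
        by (simp only: eqg cong: sum.cong)
      also have "\<dots> \<le> real (2^i) * (real n ^ 2 * (real ?M * ((real ?M / 2 ^ m + 1) * (real (2^i) + 2 ^ m * real m))))"
      proof (rule bilinear_bound[OF h \<beta>])
        fix k assume k: "k \<in> {1..<?M}"
        then have "k < ?M" by simp
        also have "?M \<le> ?N" by (intro power_increasing) auto
        finally show "\<bar>\<gamma> k\<bar> \<le> real n" using k by (intro \<gamma>) auto
      qed
      also have "\<dots> = real n ^ 2 * 2 ^ n * ((real ?M / 2 ^ m + 1) * (2^i + 2 ^ m * real m))"
        using arg_cong[OF iN, of real] by (simp add: mult_ac)
      also have "\<dots> \<le> real n ^ 2 * 2 ^ n * (4 * real n * (2 ^ n / 2 ^ (2 * w)))"
      proof (rule mult_left_mono)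
        have nn: "real n \<ge> 1" using i by simp
        have p: "(2::real) ^ j \<le> 2 ^ n / 2 ^ (2 * w)" if "j + 2 * w \<le> n" for j
          using power_increasing[of "j + 2 * w" n "2 :: real"] that by (simp add: field_simps power_add)
        \<comment> \<open>The four terms of the expanded product, up to a factor \<open>n\<close>,
          are at most \<open>2^n / 2^(2w)\<close> for four different reasons: \<open>m >= 2w\<close>
          in \<open>a1\<close>, \<open>i >= 2w\<close> in \<open>a2\<close>,
          \<open>i < n - 2w\<close> in \<open>a3\<close> and \<open>m + 2w <= n\<close> in
          \<open>a4\<close>.\<close>
        have a1: "real ?M / 2 ^ m * 2 ^ i \<le> 2 ^ n / 2 ^ (2 * w)"
        proof -
          have "real ?M / 2 ^ m * 2 ^ i = 2 ^ n / 2 ^ m"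
            using arg_cong[OF iN, of real] by (simp add: mult_ac)
          also have "\<dots> \<le> 2 ^ n / 2 ^ (2 * w)" using m by (intro divide_left_mono power_increasing) auto
          finally show ?thesis .
        qed
        have a2: "real ?M / 2 ^ m * (2 ^ m * real m) \<le> 2 ^ n / 2 ^ (2 * w) * real n"
        proof -
          have "real ?M / 2 ^ m * (2 ^ m * real m) = real ?M * real m" by simp
          also have "\<dots> \<le> 2 ^ n / 2 ^ (2 * w) * real n"
            by (intro mult_mono) (use p[of "n - i"] i m in auto)
          finally show ?thesis .
        qed
        have a3: "(2::real) ^ i \<le> 2 ^ n / 2 ^ (2 * w)" using True by (intro p) auto
        have a4: "(2::real) ^ m * real m \<le> 2 ^ n / 2 ^ (2 * w) * real n"
          by (intro mult_mono p) (use m in auto)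
        have a5: "2 ^ n / 2 ^ (2 * w) \<le> (2 ^ n / 2 ^ (2 * w)) * real n"
          using mult_left_mono[OF nn, of "2 ^ n / 2 ^ (2 * w)"] by simp
        have "(real ?M / 2 ^ m + 1) * (2^i + 2 ^ m * real m) = real ?M / 2 ^ m * 2 ^ i + real ?M / 2 ^ m * (2 ^ m * real m) + 2 ^ i + 2 ^ m * real m"
          by (simp only: distrib_left distrib_right mult_1_left add.assoc)
        then show "(real ?M / 2 ^ m + 1) * (2^i + 2 ^ m * real m) \<le> 4 * real n * (2 ^ n / 2 ^ (2 * w))"
          using a1 a2 a3 a4 a5 by (simp only: mult.commute[of "real n"] mult.assoc)
      qed simp
      \<comment> \<open>One more factor \<open>n\<close> makes the bound a perfect square.\<close>
      also have "\<dots> \<le> real n ^ 2 * 2 ^ n * (4 * real n ^ 2 * (2 ^ n / 2 ^ (2 * w)))"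
        using i by (intro mult_left_mono mult_right_mono) (auto simp: power2_eq_square)
      also have "\<dots> = (2 * real n ^ 2 * 2 ^ n / 2 ^ w) ^ 2"
      proof -
        have "x ^ 2 * y * (4 * x ^ 2 * (y / v ^ 2)) = (2 * x ^ 2 * y / v) ^ 2" for x y v :: real
          by (simp add: power2_eq_square)
        moreover have "(2::real) ^ (2 * w) = (2 ^ w) ^ 2" by (simp add: power_mult[symmetric] mult.commute)
        ultimately show ?thesis by metis
      qed
      finally show ?thesis by (rule power2_le_imp_le) simp
    qed
  qed
  have "norm (\<Sum>b\<in>{2 ^ (2 * w)..<2 ^ n}. ?g b) \<le> (\<Sum>i\<in>{2*w..<n}. 2 * real n ^ 2 * 2 ^ n / 2 ^ w)"
    unfolding sum_dyadic_blocks[OF n2w, symmetric] by (rule sum_norm_le) (rule block)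
  also have "\<dots> = real (n - 2 * w) * (2 * real n ^ 2 * 2 ^ n / 2 ^ w)"
    by (simp only: sum_constant card_atLeastLessThan)
  also have "\<dots> \<le> real n * (2 * real n ^ 2 * 2 ^ n / 2 ^ w)"
    by (rule mult_right_mono) simp_all
  also have "\<dots> = 2 * real n ^ 3 * 2 ^ n / 2 ^ w" by (simp add: power3_eq_cube power2_eq_square)
  finally show ?thesis .
qed

text \<open>Vaughan's identity with \<open>U = 2^(2w)\<close>, summed against the character. In the
  type I parts the multiplier of the frequency is positive and below \<open>U * U <= 2^m\<close>, so
  each innermost sum is at most \<open>2^m\<close>, and there are at most \<open>U * U\<close> of
  them. The constant 5 is 1 + 1 + 1 for the small arguments and the type I parts, plus 2 for type
  II.\<close>

lemma mangoldt_exp_sum_bound: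
  assumes h: "odd h" and m: "8 * w \<le> m" "m + 8 * w \<le> n" and w: "w > 0"
  shows "norm (\<Sum>x\<in>{1..<2 ^ n}. mangoldt x *\<^sub>R dchar h m x) \<le> 5 * real n ^ 3 * 2 ^ n / 2 ^ w"
proof -
  let ?N = "2 ^ n :: nat" and ?U = "2 ^ (2 * w) :: nat" and ?F = "\<lambda>x::nat. dchar h m x"
  define \<Lambda> where "\<Lambda> = (mangoldt :: nat \<Rightarrow> real)"
  have \<Lambda>0: "\<Lambda> x \<ge> 0" for x by (simp add: \<Lambda>_def mangoldt_nonneg)
  have \<Lambda>n: "\<Lambda> x \<le> real n" if "x < ?N" for x
  proof (cases "x = 0")
    case False
    then show ?thesis using mangoldt_le_ln[of x] ln_less_pow2[of x n] that unfolding \<Lambda>_def by linarith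
  qed (simp add: \<Lambda>_def)
  have n: "n > 0" using m w by simp
  have UN: "?U \<le> ?N" using m by (intro power_increasing) auto
  have UUq: "?U * ?U \<le> 2 ^ m" unfolding power_add[symmetric] using m by (intro power_increasing) auto
  have ndvd: "\<not> 2 ^ m dvd d" if "0 < d" "d < ?U * ?U" for d :: nat
    using that UUq by (auto dest: dvd_imp_le)
  define H1 where "H1 b k = (if b < ?U then mobius b * ln (real k) else 0) *\<^sub>R ?F (b * k)" for b k
  define H2 where "H2 b k = (if b < ?U then mobius b * (\<Sum>c | c dvd k \<and> c < ?U. \<Lambda> c) else 0) *\<^sub>R ?F (b * k)" for b k
  define H3 where "H3 b k = (if b < ?U then 0 else mobius b * mangoldt_tail ?U k) *\<^sub>R ?F (b * k)" for b k
  define T0 where "T0 = (\<Sum>x\<in>{1..<?N}. (if x < ?U then \<Lambda> x else 0) *\<^sub>R ?F x)"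
  define T where "T H = (\<Sum>b\<in>{1..<?N}. \<Sum>k | 0 < k \<and> b * k < ?N. H b k)" for H :: "nat \<Rightarrow> nat \<Rightarrow> complex"
  have split: "(\<Sum>x\<in>{1..<?N}. \<Lambda> x *\<^sub>R ?F x) = T0 + T H1 - T H2 + T H3"
  proof -
    have "(\<Sum>x\<in>{1..<?N}. \<Lambda> x *\<^sub>R ?F x) = (\<Sum>x\<in>{1..<?N}. (if x < ?U then \<Lambda> x else 0) *\<^sub>R ?F x
       + (\<Sum>b | b dvd x. H1 b (x div b)) - (\<Sum>b | b dvd x. H2 b (x div b)) + (\<Sum>b | b dvd x. H3 b (x div b)))"
    proof (rule sum.cong[OF refl])
      fix x assume x: "x \<in> {1..<?N}"
      have e: "(\<Sum>b | b dvd x. a b *\<^sub>R ?F (b * (x div b))) = (\<Sum>b | b dvd x. a b) *\<^sub>R ?F x" for a :: "nat \<Rightarrow> real"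
        unfolding scaleR_sum_left by (rule sum.cong) auto
      show "\<Lambda> x *\<^sub>R ?F x = (if x < ?U then \<Lambda> x else 0) *\<^sub>R ?F x
       + (\<Sum>b | b dvd x. H1 b (x div b)) - (\<Sum>b | b dvd x. H2 b (x div b)) + (\<Sum>b | b dvd x. H3 b (x div b))"
        unfolding H1_def H2_def H3_def e scaleR_add_left[symmetric] scaleR_diff_left[symmetric] \<Lambda>_def
        by (subst vaughan_identity[of x ?U]) (use x in auto)
    qed
    then show ?thesis
      by (simp only: sum.distrib sum_subtractf sum_divisors_swap T0_def T_def)
  qed
  have "norm T0 \<le> (\<Sum>x\<in>{1..<?N}. if x < ?U then real n else 0)"
    unfolding T0_def by (rule sum_norm_le) (auto simp: \<Lambda>0 \<Lambda>n)
  also have "\<dots> \<le> (\<Sum>x<?U. real n)"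
    unfolding sum.inter_filter[symmetric, OF finite_atLeastLessThan] by (rule sum_mono2) auto
  finally have b0: "norm T0 \<le> ?U * real n" by simp
  have ln_N: "ln (real c) \<le> real n" if "c \<le> ?N" "1 \<le> c" for c
  proof (cases "c = ?N")
    case True
    then show ?thesis using ln_le_minus_one[of "2::real"] by (simp add: ln_realpow mult_left_le)
  qed (use that ln_less_pow2 in auto)
  have b1: "norm (T H1) \<le> ?U * (2 ^ m * real n)"
  proof -
    have "norm (T H1) \<le> (\<Sum>b\<in>{1..<?N}. if b < ?U then 2 ^ m * real n else 0)"
      unfolding T_def
    proof (rule sum_norm_le)
      fix b assume b: "b \<in> {1..<?N}"
      show "norm (\<Sum>k | 0 < k \<and> b * k < ?N. H1 b k) \<le> (if b < ?U then 2 ^ m * real n else 0)"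
      proof (cases "b < ?U")
        case True
        obtain c where c: "1 \<le> c" "c \<le> ?N" "{k. 0 < k \<and> b * k < ?N} = {1..<c}"
          using multiples_below_interval[of b ?N] b by auto
        have "norm (\<Sum>k\<in>{1..<c}. ln (real k) *\<^sub>R ?F (b * k)) \<le> 2 ^ m * ln (real c)"
        proof (rule norm_sum_ln_le[OF _ c(1)])
          have "b < ?U * ?U" using True by (rule less_le_trans) simp
          then show "norm (\<Sum>k = d..<e. ?F (b * k)) \<le> 2 ^ m" for d e
            using b by (intro expi_sum_multiples_le[OF h] ndvd) auto
        qed
        also have "\<dots> \<le> 2 ^ m * real n" by (intro mult_left_mono ln_N c) auto
        finally have 1: "norm (\<Sum>k\<in>{1..<c}. ln (real k) *\<^sub>R ?F (b * k)) \<le> 2 ^ m * real n" .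
        have "(\<Sum>k | 0 < k \<and> b * k < ?N. H1 b k) = mobius b *\<^sub>R (\<Sum>k\<in>{1..<c}. ln (real k) *\<^sub>R ?F (b * k))"
          unfolding c(3) scaleR_sum_right by (rule sum.cong) (use True in \<open>auto simp: H1_def\<close>)
        then have "norm (\<Sum>k | 0 < k \<and> b * k < ?N. H1 b k) \<le> 1 * (2 ^ m * real n)"
          unfolding norm_scaleR by (simp only: norm_scaleR) (intro mult_mono abs_mobius_le 1, auto)
        with True show ?thesis by simp
      qed (simp add: H1_def)
    qed
    also have "\<dots> \<le> (\<Sum>b<?U. 2 ^ m * real n)"
      unfolding sum.inter_filter[symmetric, OF finite_atLeastLessThan] by (rule sum_mono2) auto
    finally show ?thesis by simp
  qed
  have b2: "norm (T H2) \<le> ?U * (?U * (real n * 2 ^ m))"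
  proof -
    have "norm (T H2) \<le> (\<Sum>b\<in>{1..<?N}. if b < ?U then ?U * (real n * 2 ^ m) else 0)"
      unfolding T_def
    proof (rule sum_norm_le)
      fix b assume b: "b \<in> {1..<?N}"
      show "norm (\<Sum>k | 0 < k \<and> b * k < ?N. H2 b k) \<le> (if b < ?U then ?U * (real n * 2 ^ m) else 0)"
      proof (cases "b < ?U")
        case True
        obtain c where c: "1 \<le> c" "c \<le> ?N" "{k. 0 < k \<and> b * k < ?N} = {1..<c}"
          using multiples_below_interval[of b ?N] b by auto
        \<comment> \<open>With \<open>k = d * j\<close> for the divisor \<open>d < U\<close>, the
          sum over \<open>j\<close> is geometric with multiplier
          \<open>b * d < U * U\<close>.\<close>
        define H where "H d j = (if d < ?U then \<Lambda> d else 0) *\<^sub>R ?F (b * d * j)" for d j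
        have "(\<Sum>k | 0 < k \<and> b * k < ?N. H2 b k) = mobius b *\<^sub>R (\<Sum>k\<in>{1..<c}. \<Sum>d | d dvd k. H d (k div d))"
          unfolding c(3) scaleR_sum_right
        proof (rule sum.cong[OF refl])
          fix k assume k: "k \<in> {1..<c}"
          have "(\<Sum>d | d dvd k. mobius b *\<^sub>R H d (k div d)) = (\<Sum>d | d dvd k. (mobius b * (if d < ?U then \<Lambda> d else 0)) *\<^sub>R ?F (b * k))"
            by (rule sum.cong) (auto simp: H_def mult.assoc)
          also have "\<dots> = (mobius b * (\<Sum>d | d dvd k. if d < ?U then \<Lambda> d else 0)) *\<^sub>R ?F (b * k)"
            by (simp only: scaleR_sum_left sum_distrib_left)
          also have "(\<Sum>d | d dvd k. if d < ?U then \<Lambda> d else 0) = (\<Sum>d | d dvd k \<and> d < ?U. \<Lambda> d)"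
            using k by (intro sum.mono_neutral_cong_right) auto
          finally show "H2 b k = (\<Sum>d | d dvd k. mobius b *\<^sub>R H d (k div d))" using True by (simp add: H2_def)
        qed
        also have "\<dots> = mobius b *\<^sub>R (\<Sum>d\<in>{1..<c}. \<Sum>j | 0 < j \<and> d * j < c. H d j)"
          by (simp only: sum_divisors_swap)
        also have "norm \<dots> \<le> 1 * (\<Sum>d\<in>{1..<c}. if d < ?U then real n * 2 ^ m else 0)"
          unfolding norm_scaleR
        proof (intro mult_mono abs_mobius_le sum_norm_le)
          fix d assume d: "d \<in> {1..<c}"
          show "norm (\<Sum>j | 0 < j \<and> d * j < c. H d j) \<le> (if d < ?U then real n * 2 ^ m else 0)"
          proof (cases "d < ?U")
            case dU: True
            obtain e where e: "{j. 0 < j \<and> d * j < c} = {1..<e}"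
              using multiples_below_interval[of d c] d by auto
            have "(\<Sum>j | 0 < j \<and> d * j < c. H d j) = \<Lambda> d *\<^sub>R (\<Sum>j\<in>{1..<e}. ?F (b * d * j))"
              unfolding e scaleR_sum_right using dU by (simp add: H_def)
            also have "norm \<dots> \<le> real n * 2 ^ m"
              unfolding norm_scaleR
            proof (rule mult_mono)
              show "\<bar>\<Lambda> d\<bar> \<le> real n" using \<Lambda>0 \<Lambda>n[of d] d c by simp
              have "b * d < ?U * ?U" using True dU by (intro mult_strict_mono) auto
              then show "norm (\<Sum>j\<in>{1..<e}. ?F (b * d * j)) \<le> 2 ^ m"
                using b d by (intro expi_sum_multiples_le[OF h] ndvd) auto
            qed auto
            finally show ?thesis using dU by simp
          qed (simp add: H_def)
        qed (auto intro: sum_nonneg)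
        also have "\<dots> \<le> (\<Sum>d<?U. real n * 2 ^ m)"
          unfolding sum.inter_filter[symmetric, OF finite_atLeastLessThan] mult_1_left by (rule sum_mono2) auto
        finally show ?thesis using True by simp
      qed (simp add: H2_def)
    qed
    also have "\<dots> \<le> (\<Sum>b<?U. ?U * (real n * 2 ^ m))"
      unfolding sum.inter_filter[symmetric, OF finite_atLeastLessThan] by (rule sum_mono2) auto
    finally show ?thesis by simp
  qed
  have b3: "norm (T H3) \<le> 2 * real n ^ 3 * 2 ^ n / 2 ^ w"
  proof -
    have "T H3 = (\<Sum>b\<in>{?U..<?N}. \<Sum>k | 0 < k \<and> b * k < ?N. H3 b k)"
      unfolding T_def by (rule sum.mono_neutral_right) (auto simp: H3_def Suc_le_eq intro: less_le_trans[of 0 ?U])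
    also have "\<dots> = (\<Sum>b\<in>{?U..<?N}. mobius b *\<^sub>R (\<Sum>k | 0 < k \<and> b * k < ?N. mangoldt_tail ?U k *\<^sub>R ?F (b * k)))"
      by (rule sum.cong) (auto simp: H3_def scaleR_sum_right)
    also have "norm \<dots> \<le> 2 * real n ^ 3 * 2 ^ n / 2 ^ w"
    proof (rule type_II_bound[OF h m abs_mobius_le])
      fix k :: nat assume "0 < k" "k < 2 ^ n"
      then show "\<bar>mangoldt_tail ?U k\<bar> \<le> real n"
        using mangoldt_tail_bounds[of k ?U] ln_less_pow2[of k n] by simp
    qed (rule mangoldt_tail_eq_0)
    finally show ?thesis .
  qed
  have c: "real ?U * (real ?U * (real n * 2 ^ m)) \<le> real n ^ 3 * 2 ^ n / 2 ^ w"
  proof -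
    \<comment> \<open>The exponent is \<open>m + 5w\<close>: the gap between \<open>m\<close> and
      \<open>n\<close> pays for both factors \<open>U\<close> and for the saving
      \<open>2^w\<close>.\<close>
    have "real ?U * (real ?U * 2 ^ m) * 2 ^ w = 2 ^ (2 * w + 2 * w + m + w)" unfolding power_add by simp
    also have "\<dots> \<le> (2::real) ^ n" using m by (intro power_increasing) auto
    finally have "real ?U * (real ?U * 2 ^ m) \<le> 2 ^ n / 2 ^ w" by (simp add: field_simps)
    then have "real n * (real ?U * (real ?U * 2 ^ m)) \<le> real n ^ 3 * (2 ^ n / 2 ^ w)"
      using n by (intro mult_mono) (auto intro: self_le_power)
    then show ?thesis by (simp add: mult_ac)
  qed
  have "(1::real) \<le> 2 ^ (2 * w + m)" by simp
  then have "real ?U * real n * 1 \<le> real ?U * real n * (real ?U * 2 ^ m)"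
    by (intro mult_left_mono) (auto simp: power_add)
  then have c0: "real ?U * real n \<le> real ?U * (real ?U * (real n * 2 ^ m))" by (simp add: mult_ac)
  have "real ?U * (real n * 2 ^ m) * 1 \<le> real ?U * (real n * 2 ^ m) * real ?U"
    by (intro mult_left_mono) auto
  then have c1: "real ?U * (2 ^ m * real n) \<le> real ?U * (real ?U * (real n * 2 ^ m))" by (simp add: mult_ac)
  have "norm (T0 + T H1 - T H2 + T H3) \<le> norm T0 + norm (T H1) + norm (T H2) + norm (T H3)"
    by (meson add_mono norm_triangle_ineq norm_triangle_ineq4 norm_triangle_le order_refl order_trans)
  also have "\<dots> \<le> 5 * real n ^ 3 * 2 ^ n / 2 ^ w"
    using b0 b1 b2 b3 c c0 c1 by linarith
  finally show ?thesis unfolding split[symmetric] \<Lambda>_def .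
qed

section \<open>Walsh functions\<close>

definition rademacher :: "nat \<Rightarrow> nat \<Rightarrow> real" where
  "rademacher j x = (if bit x j then - 1 else 1)"

abbreviation walsh :: "nat set \<Rightarrow> nat \<Rightarrow> real" where
  "walsh A x \<equiv> \<Prod>j\<in>A. rademacher j x"

lemma rademacher_square [simp]: "rademacher j x * rademacher j x = 1"
  by (simp add: rademacher_def)

lemma abs_rademacher [simp]: "\<bar>rademacher j x\<bar> = 1"
  by (simp add: rademacher_def)

lemma rademacher_mod: "rademacher j (x mod 2 ^ Suc j) = rademacher j x"
  by (simp only: rademacher_def take_bit_eq_mod[symmetric] bit_take_bit_iff) simp

lemma rademacher_low: "x < 2 ^ j \<Longrightarrow> rademacher j x = 1"
  by (simp add: rademacher_def bit_iff_odd)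

lemma rademacher_high: "x < 2 ^ j \<Longrightarrow> rademacher j (x + 2 ^ j) = - 1"
  by (simp add: rademacher_def bit_iff_odd)

lemma sum_expi_orthogonal:
  assumes "q > 0"
  shows "(\<Sum>l<q. echar r q l) = (if int q dvd r then of_nat q else 0)"
proof (cases "int q dvd r")
  case True
  then obtain k where "r = int q * k" by auto
  then have "echar r q l = 1" for l
    using assms expi_of_int[of "k * int l"] by simp
  then show ?thesis using True by simp
next
  case False
  let ?x = "of_int r / of_nat q :: real"
  have ne: "expi ?x \<noteq> 1" by (rule expi_frac_neq_1) (use assms False in auto)
  have "expi ?x ^ q = expi (of_int r)" using assms by (simp flip: expi_power)
  then have "expi ?x ^ q = 1" by simp
  then have "(\<Sum>l<q. expi ?x ^ l) = 0" using ne geometric_sum[of "expi ?x" q] by simp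
  then show ?thesis using False by (simp only: expi_power if_False)
qed

text \<open>The discrete Fourier coefficient at \<open>l\<close> of the sign of digit
  \<open>j\<close>, which has period \<open>2^(j+1)\<close>.\<close>

definition rademacher_coeff :: "nat \<Rightarrow> nat \<Rightarrow> complex" where
  "rademacher_coeff j l = (\<Sum>y<2 ^ Suc j. rademacher j y *\<^sub>R echar (- int l) (2 ^ Suc j) y) / 2 ^ Suc j"

lemma rademacher_coeff_halves:
  "rademacher_coeff j l =
     ((\<Sum>y\<in>{0..<2^j}. echar (- int l) (2 ^ Suc j) y)
      - (\<Sum>y\<in>{2^j..<2^Suc j}. echar (- int l) (2 ^ Suc j) y)) / 2 ^ Suc j"
proof -
  let ?e = "\<lambda>y. echar (- int l) (2 ^ Suc j) y"
  have "(\<Sum>y<2 ^ Suc j. rademacher j y *\<^sub>R ?e y) = (\<Sum>y\<in>{0..<2^j}. rademacher j y *\<^sub>R ?e y) + (\<Sum>y\<in>{2^j..<2^Suc j}. rademacher j y *\<^sub>R ?e y)"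
    unfolding lessThan_atLeast0 by (rule sum.atLeastLessThan_concat[symmetric]) auto
  also have "(\<Sum>y\<in>{0..<2^j}. rademacher j y *\<^sub>R ?e y) = (\<Sum>y\<in>{0..<2^j}. ?e y)"
    by (rule sum.cong) (auto simp: rademacher_low)
  also have "(\<Sum>y\<in>{2^j..<2^Suc j}. rademacher j y *\<^sub>R ?e y) = (\<Sum>y\<in>{2^j..<2^Suc j}. - ?e y)"
  proof (rule sum.cong[OF refl])
    fix y :: nat assume "y \<in> {2^j..<2^Suc j}"
    then have "rademacher j y = - 1" using rademacher_high[of "y - 2 ^ j" j] by auto
    then show "rademacher j y *\<^sub>R ?e y = - ?e y" by simp
  qed
  finally show ?thesis by (simp add: rademacher_coeff_def sum_negf)
qed

text \<open>Adding \<open>2^j\<close> flips the sign of digit \<open>j\<close> but leaves a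
  character with even numerator unchanged, so the two halves of the period cancel. Only characters
  of exact denominator \<open>2^(j+1)\<close> survive.\<close>

lemma rademacher_coeff_even:
  assumes "even l"
  shows "rademacher_coeff j l = 0"
proof -
  let ?e = "\<lambda>y. echar (- int l) (2 ^ Suc j) y"
  have "(\<Sum>y\<in>{2^j..<2^Suc j}. ?e y) = (\<Sum>y\<in>{0..<2^j}. ?e (y + 2 ^ j))"
    by (rule sum.reindex_bij_witness[of _ "\<lambda>y. y + 2 ^ j" "\<lambda>y. y - 2 ^ j"]) auto
  also have "\<dots> = (\<Sum>y\<in>{0..<2^j}. ?e y)"
  proof (rule sum.cong[OF refl])
    fix y
    obtain k where k: "l = 2 * k" using assms by auto
    have "of_int (- int l) / of_nat (2 ^ Suc j) * of_nat (y + 2 ^ j)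
       = of_int (- int l) / of_nat (2 ^ Suc j) * of_nat y + (of_int (- int k) :: real)"
      by (simp add: k field_simps)
    then show "?e (y + 2 ^ j) = ?e y" by (simp only: expi_add expi_of_int mult_1_right)
  qed
  finally show ?thesis unfolding rademacher_coeff_halves by simp
qed

text \<open>Both halves of the period are geometric sums. The value 0 for the argument
  \<open>B\<close> of \<open>gker\<close> has no influence: the branch with \<open>B\<close> applies
  only when \<open>2^(j+1)\<close> divides \<open>l\<close>.\<close>

lemma norm_rademacher_coeff_le:
  assumes "l < 2 ^ Suc j" "odd l"
  shows "norm (rademacher_coeff j l) \<le> 2 * gker (2 ^ Suc j) 0 (- int l) / 2 ^ Suc j"
proof -
  have nd: "\<not> int (2 ^ Suc j) dvd - int l"
  proof -
    have "\<not> 2 ^ Suc j dvd l" using assms odd_pos[of l] by (auto dest: dvd_imp_le)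
    then show ?thesis by (simp only: dvd_minus_iff int_dvd_int_iff) simp
  qed
  have g: "gker (2 ^ Suc j) B (- int l) = gker (2 ^ Suc j) 0 (- int l)" for B
    unfolding gker_def by (simp only: nd if_False)
  let ?s = "\<lambda>a b. (\<Sum>y\<in>{a..<b::nat}. echar (- int l) (2 ^ Suc j) y)"
  have s: "norm (?s a b) \<le> gker (2 ^ Suc j) 0 (- int l)" for a b
    by (rule order_trans[OF norm_sum_expi_gker[of "2 ^ Suc j" b a "real (b - a)" "- int l"] eq_refl[OF g]]) simp_all
  have "norm (rademacher_coeff j l) = norm (?s 0 (2 ^ j) - ?s (2 ^ j) (2 ^ Suc j)) / 2 ^ Suc j"
    unfolding rademacher_coeff_halves norm_divide by (simp add: norm_power)
  also have "\<dots> \<le> (gker (2 ^ Suc j) 0 (- int l) + gker (2 ^ Suc j) 0 (- int l)) / 2 ^ Suc j"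
    by (intro divide_right_mono order_trans[OF norm_triangle_ineq4] add_mono s) simp
  finally show ?thesis by simp
qed

text \<open>The numerators \<open>- l\<close> are read as the progression \<open>1 * (0 - l)\<close>
  over one period, for which \<open>sum_gker_affine_le\<close> yields a factor 2. The two half
  periods in each coefficient yield the other 2.\<close>

lemma sum_norm_rademacher_coeff_le:
  "(\<Sum>l | l < 2 ^ Suc j \<and> odd l. norm (rademacher_coeff j l)) \<le> 4 * real (Suc j)"
proof -
  have "(\<Sum>l | l < 2 ^ Suc j \<and> odd l. norm (rademacher_coeff j l))
      \<le> (\<Sum>l | l < 2 ^ Suc j \<and> odd l. 2 * gker (2 ^ Suc j) 0 (1 * (0 - int l)) / 2 ^ Suc j)"
    by (rule sum_mono) (use norm_rademacher_coeff_le in auto)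
  also have "\<dots> \<le> (\<Sum>l<2 ^ Suc j. 2 * gker (2 ^ Suc j) 0 (1 * (0 - int l)) / 2 ^ Suc j)"
    by (rule sum_mono2) (auto intro!: divide_nonneg_pos mult_nonneg_nonneg gker_nonneg)
  also have "\<dots> = 2 / 2 ^ Suc j * (\<Sum>l<2 ^ Suc j. gker (2 ^ Suc j) 0 (1 * (0 - int l)))"
    by (simp add: sum_distrib_left)
  also have "\<dots> \<le> 2 / 2 ^ Suc j * ((real (2 ^ Suc j) / 2 ^ Suc j + 1) * (0 + 2 ^ Suc j * real (Suc j)))"
    by (intro mult_left_mono sum_gker_affine_le) auto
  also have "\<dots> = 4 * real (Suc j)" by simp
  finally show ?thesis .
qed

lemma rademacher_expansion:
  "of_real (rademacher j x) = (\<Sum>l | l < 2 ^ Suc j \<and> odd l. rademacher_coeff j l * dchar' l (Suc j) x)"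
proof -
  let ?q = "2 ^ Suc j :: nat"
  have "(\<Sum>l | l < ?q \<and> odd l. rademacher_coeff j l * dchar' l (Suc j) x)
      = (\<Sum>l<?q. rademacher_coeff j l * dchar' l (Suc j) x)"
    by (rule sum.mono_neutral_left) (auto simp: rademacher_coeff_even)
  also have "\<dots> = (\<Sum>l<?q. \<Sum>y<?q. (rademacher j y / ?q) *\<^sub>R echar (int x - int y) ?q l)"
  proof (rule sum.cong[OF refl])
    fix l
    have "rademacher_coeff j l * dchar' l (Suc j) x
      = (\<Sum>y<?q. (rademacher j y / ?q) *\<^sub>R (echar (- int l) ?q y * dchar' l (Suc j) x))"
      unfolding rademacher_coeff_def sum_divide_distrib sum_distrib_right
      by (intro sum.cong refl) (simp add: scaleR_conv_of_real)
    also have "\<dots> = (\<Sum>y<?q. (rademacher j y / ?q) *\<^sub>R echar (int x - int y) ?q l)"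
      unfolding expi_add[symmetric]
      by (intro sum.cong refl arg_cong[where f = "scaleR _"] arg_cong[where f = expi]) (simp add: field_simps)
    finally show "rademacher_coeff j l * dchar' l (Suc j) x = \<dots>" .
  qed
  also have "\<dots> = (\<Sum>y<?q. \<Sum>l<?q. (rademacher j y / ?q) *\<^sub>R echar (int x - int y) ?q l)"
    by (rule sum.swap)
  also have "\<dots> = (\<Sum>y<?q. (rademacher j y / ?q) *\<^sub>R (if int ?q dvd int x - int y then of_nat ?q else 0))"
    unfolding scaleR_sum_right[symmetric]
    by (intro sum.cong refl arg_cong[where f = "scaleR _"] sum_expi_orthogonal) simp
  also have "\<dots> = (\<Sum>y<?q. if y = x mod ?q then of_real (rademacher j y) else 0)"
  proof (rule sum.cong[OF refl])
    fix y assume y: "y \<in> {..<?q}"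
    have "int ?q dvd int x - int y \<longleftrightarrow> int x mod int ?q = int y mod int ?q" by (simp only: mod_eq_dvd_iff)
    also have "\<dots> \<longleftrightarrow> x mod ?q = y" using y by (simp only: zmod_int[symmetric] of_nat_eq_iff) simp
    finally have "int ?q dvd int x - int y \<longleftrightarrow> y = x mod ?q" by auto
    then show "(rademacher j y / ?q) *\<^sub>R (if int ?q dvd int x - int y then of_nat ?q else 0) = (if y = x mod ?q then of_real (rademacher j y) else (0::complex))"
      by (simp only:) (simp add: scaleR_conv_of_real)
  qed
  also have "\<dots> = of_real (rademacher j (x mod ?q))" by simp
  finally show ?thesis by (simp only: rademacher_mod)
qed

lemma rademacher_mult_sum_le:
  fixes f :: "nat \<Rightarrow> complex"
  assumes "\<And>l. odd l \<Longrightarrow> norm (\<Sum>x\<in>X. f x * dchar' l (Suc j) x) \<le> K"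
  shows "norm (\<Sum>x\<in>X. f x * of_real (rademacher j x)) \<le> 4 * real (Suc j) * K"
proof -
  let ?L = "{l. l < 2 ^ Suc j \<and> odd l}"
  have K0: "K \<ge> 0" using norm_ge_zero assms[of 1] order_trans by (metis odd_one)
  have "(\<Sum>x\<in>X. f x * of_real (rademacher j x)) = (\<Sum>x\<in>X. \<Sum>l\<in>?L. rademacher_coeff j l * (f x * dchar' l (Suc j) x))"
    unfolding rademacher_expansion sum_distrib_left by (simp only: mult.left_commute)
  also have "\<dots> = (\<Sum>l\<in>?L. rademacher_coeff j l * (\<Sum>x\<in>X. f x * dchar' l (Suc j) x))"
    unfolding sum_distrib_left by (rule sum.swap)
  finally have "norm (\<Sum>x\<in>X. f x * of_real (rademacher j x)) = norm \<dots>" by simp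
  also have "\<dots> \<le> (\<Sum>l\<in>?L. norm (rademacher_coeff j l) * K)"
  proof (rule sum_norm_le)
    fix l :: nat assume "l \<in> ?L"
    then show "norm (rademacher_coeff j l * (\<Sum>x\<in>X. f x * dchar' l (Suc j) x)) \<le> norm (rademacher_coeff j l) * K"
      unfolding norm_mult by (intro mult_left_mono assms) auto
  qed
  also have "\<dots> \<le> 4 * real (Suc j) * K"
    unfolding sum_distrib_right[symmetric] by (rule mult_right_mono[OF sum_norm_rademacher_coeff_le K0])
  finally show ?thesis .
qed

text \<open>The sign of a digit \<open>j\<close> adds some \<open>l / 2^(j+1)\<close> to the
  frequency \<open>h / 2^m\<close>. As \<open>j + 1 < m\<close>, the numerator changes by an even
  amount and stays odd, so the exact denominator \<open>2^m\<close> persists and \<open>K\<close>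
  bounds every character that arises. Each digit costs its Fourier l1 norm, at most
  \<open>4 * n\<close>.\<close>

lemma walsh_twisted_le:
  fixes a :: "nat \<Rightarrow> real"
  assumes "finite A" "\<And>j. j \<in> A \<Longrightarrow> Suc j < m" "m \<le> n" 
    and K: "\<And>h. odd h \<Longrightarrow> norm (\<Sum>x\<in>X. a x *\<^sub>R dchar h m x) \<le> K"
    and "odd h"
  shows "norm (\<Sum>x\<in>X. (a x * walsh A x) *\<^sub>R dchar h m x) \<le> (4 * real n) ^ card A * K"
  using assms(1,2,5)
proof (induction A arbitrary: h)
  case empty
  then show ?case using K[of h] by simp
next
  case (insert j A)
  let ?f = "\<lambda>x. (a x * walsh A x) *\<^sub>R dchar h m x"
  have jm: "Suc j < m" using insert.prems by auto
  have K0: "0 \<le> (4 * real n) ^ card A * K"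
    using norm_ge_zero K[of 1] order_trans by (metis odd_one mult_nonneg_nonneg zero_le_power of_nat_0_le_iff zero_le_numeral)
  have "(\<Sum>x\<in>X. (a x * walsh (insert j A) x) *\<^sub>R dchar h m x)
      = (\<Sum>x\<in>X. ?f x * of_real (rademacher j x))"
    using insert.hyps by (simp add: scaleR_conv_of_real mult_ac)
  also have "norm \<dots> \<le> 4 * real (Suc j) * ((4 * real n) ^ card A * K)"
  proof (rule rademacher_mult_sum_le)
    fix l :: nat assume "odd l"
    define h' where "h' = h + int l * 2 ^ (m - Suc j)"
    have "odd h'" using insert.prems(2) jm by (simp add: h'_def)
    have "of_int h / 2 ^ m + of_nat l / 2 ^ Suc j = (of_int h' / 2 ^ m :: real)"
    proof -
      have "(2::real) ^ m = 2 ^ (m - Suc j) * 2 ^ Suc j" using jm by (simp only: power_add[symmetric]) simp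
      then show ?thesis by (simp add: h'_def add_divide_distrib)
    qed
    then have eq: "?f x * dchar' l (Suc j) x = (a x * walsh A x) *\<^sub>R dchar h' m x" for x
      by (metis distrib_right expi_add mult_scaleR_left)
    show "norm (\<Sum>x\<in>X. ?f x * dchar' l (Suc j) x) \<le> (4 * real n) ^ card A * K"
      unfolding eq by (rule insert.IH[OF _ \<open>odd h'\<close>]) (use insert.prems in simp)
  qed
  also have "\<dots> \<le> 4 * real n * ((4 * real n) ^ card A * K)"
    using jm assms(3) by (intro mult_right_mono K0) auto
  finally show ?case using insert.hyps by simp
qed

text \<open>Expanding the top digit creates an odd numerator over \<open>2^(Max A + 1)\<close>; the
  other digits are lower and cannot spoil it.\<close>

lemma walsh_sum_le:
  fixes a :: "nat \<Rightarrow> real"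
  assumes "finite A" "A \<noteq> {}" "Suc (Max A) \<le> n" 
    and K: "\<And>h. odd h \<Longrightarrow> norm (\<Sum>x\<in>X. a x *\<^sub>R dchar h (Suc (Max A)) x) \<le> K"
  shows "\<bar>\<Sum>x\<in>X. a x * walsh A x\<bar> \<le> (4 * real n) ^ card A * K"
proof -
  let ?J = "Max A"
  define A' where "A' = A - {?J}"
  have "?J \<in> A" using assms(1,2) by (rule Max_in)
  then have A: "A = insert ?J A'" "?J \<notin> A'" "finite A'" using assms(1) by (auto simp: A'_def)
  have lt: "Suc j < Suc ?J" if "j \<in> A'" for j
    using that assms Max_ge[of A j] by (auto simp: A'_def order.strict_iff_order)
  have K0: "0 \<le> (4 * real n) ^ card A' * K"
    using norm_ge_zero K[of 1] order_trans by (metis odd_one mult_nonneg_nonneg zero_le_power of_nat_0_le_iff zero_le_numeral)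
  have pr: "walsh A x = rademacher ?J x * walsh A' x" for x
    by (subst A(1)) (simp add: A(2,3))
  have "\<bar>\<Sum>x\<in>X. a x * walsh A x\<bar> = norm (of_real (\<Sum>x\<in>X. a x * walsh A x) :: complex)"
    by (simp only: norm_of_real)
  also have "of_real (\<Sum>x\<in>X. a x * walsh A x) = (\<Sum>x\<in>X. of_real (a x * walsh A' x) * (of_real (rademacher ?J x) :: complex))"
    unfolding pr by (simp add: mult_ac)
  also have "norm \<dots> \<le> 4 * real (Suc ?J) * ((4 * real n) ^ card A' * K)"
  proof (rule rademacher_mult_sum_le)
    fix l :: nat assume l: "odd l"
    then have "norm (\<Sum>x\<in>X. (a x * walsh A' x) *\<^sub>R dchar (int l) (Suc ?J) x) \<le> (4 * real n) ^ card A' * K"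
      using assms(3) by (intro walsh_twisted_le A lt K) auto
    then show "norm (\<Sum>x\<in>X. of_real (a x * walsh A' x) * dchar' l (Suc ?J) x) \<le> (4 * real n) ^ card A' * K"
      by (simp only: scaleR_conv_of_real of_int_of_nat_eq)
  qed
  also have "\<dots> \<le> 4 * real n * ((4 * real n) ^ card A' * K)"
    using assms(3) by (intro mult_right_mono K0) auto
  also have "\<dots> = (4 * real n) ^ card A * K" by (subst A(1)) (simp add: A(2,3))
  finally show ?thesis .
qed

section \<open>Comparison with independent signs\<close>

text \<open>Independence of the digits under uniform weights, by splitting the range at the top
  digit.\<close>

lemma sum_prod_bits:
  fixes g :: "nat \<Rightarrow> bool \<Rightarrow> 'a :: comm_ring_1"
  shows "(\<Sum>x<2 ^ n. \<Prod>j<n. g j (bit (x :: nat) j)) = (\<Prod>j<n. g j False + g j True)"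
proof (induction n)
  case (Suc n)
  have low: "\<not> bit x n" if "x < 2 ^ n" for x :: nat using that by (simp add: bit_iff_odd)
  have high: "bit (x + 2 ^ n) j = bit x j" if "j < n" for x :: nat and j
  proof -
    have "take_bit n (x + 2 ^ n) = take_bit n x" by (simp add: take_bit_eq_mod)
    then have "bit (take_bit n (x + 2 ^ n)) j = bit (take_bit n x) j" by simp
    with that show ?thesis by (simp add: bit_take_bit_iff)
  qed
  have top: "bit (x + 2 ^ n) n" if "x < 2 ^ n" for x :: nat using that by (simp add: bit_iff_odd)
  have "(\<Sum>x<2 ^ Suc n. \<Prod>j<Suc n. g j (bit (x::nat) j))
     = (\<Sum>x\<in>{0..<2 ^ n}. \<Prod>j<Suc n. g j (bit (x::nat) j)) + (\<Sum>x\<in>{2^n..<2 ^ Suc n}. \<Prod>j<Suc n. g j (bit (x::nat) j))"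
    unfolding lessThan_atLeast0[of "2 ^ Suc n"] by (rule sum.atLeastLessThan_concat[symmetric]) auto
  also have "(\<Sum>x\<in>{2^n..<2 ^ Suc n}. \<Prod>j<Suc n. g j (bit (x::nat) j)) = (\<Sum>x\<in>{0..<2 ^ n}. \<Prod>j<Suc n. g j (bit (x + 2 ^ n :: nat) j))"
    using sum.shift_bounds_nat_ivl[of "\<lambda>x. \<Prod>j<Suc n. g j (bit (x::nat) j)" 0 "2 ^ n" "2 ^ n"] by (simp add: mult_2)
  also have "\<dots> = (\<Sum>x\<in>{0..<2 ^ n}. (\<Prod>j<n. g j (bit (x::nat) j)) * g n True)"
    by (rule sum.cong) (auto simp: high top)
  also have "(\<Sum>x\<in>{0..<2 ^ n}. \<Prod>j<Suc n. g j (bit (x::nat) j)) = (\<Sum>x\<in>{0..<2 ^ n}. (\<Prod>j<n. g j (bit (x::nat) j)) * g n False)"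
    by (rule sum.cong) (auto simp: low)
  finally show ?case using Suc by (simp add: sum_distrib_right[symmetric] lessThan_atLeast0 distrib_left)
qed simp

lemma sum_prod_rademacher:
  fixes \<phi> :: "real \<Rightarrow> 'a :: real_normed_field"
  assumes "J \<subseteq> {..<n}"
  shows "(\<Sum>x<2 ^ n. \<Prod>j\<in>J. \<phi> (rademacher j x)) / 2 ^ n = ((\<phi> 1 + \<phi> (- 1)) / 2) ^ card J"
proof -
  define g where "g j b = (if j \<in> J then \<phi> (if b then - 1 else 1) else 1)" for j b
  have fin: "finite J" using assms finite_subset by blast
  have "(\<Prod>j\<in>J. \<phi> (rademacher j x)) = (\<Prod>j<n. g j (bit x j))" for x
    using assms by (intro prod.mono_neutral_cong_left) (auto simp: g_def rademacher_def)
  then have "(\<Sum>x<2 ^ n. \<Prod>j\<in>J. \<phi> (rademacher j x)) = (\<Prod>j<n. g j False + g j True)"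
    by (simp only: sum_prod_bits)
  also have "\<dots> = (\<Prod>j<n. 2 * (if j \<in> J then (\<phi> 1 + \<phi> (- 1)) / 2 else 1))"
    by (rule prod.cong) (auto simp: g_def)
  also have "\<dots> = 2 ^ n * (\<Prod>j<n. if j \<in> J then (\<phi> 1 + \<phi> (- 1)) / 2 else 1)"
    by (simp only: prod.distrib prod_constant card_lessThan)
  also have "(\<Prod>j<n. if j \<in> J then (\<phi> 1 + \<phi> (- 1)) / 2 else 1) = (\<Prod>j\<in>J. (\<phi> 1 + \<phi> (- 1)) / 2)"
    using assms by (intro prod.mono_neutral_cong_right) auto
  finally show ?thesis by simp
qed

definition rad_sum :: "nat set \<Rightarrow> nat \<Rightarrow> real" where
  "rad_sum J x = (\<Sum>j\<in>J. rademacher j x)"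

lemma uniform_walsh_eq_0:
  assumes "A \<subseteq> {..<n}" "A \<noteq> {}"
  shows "(\<Sum>x<2 ^ n. \<Prod>j\<in>A. rademacher j x) = 0"
proof -
  have "card A > 0" using assms finite_subset[of A "{..<n}"] by (simp add: card_gt_0_iff)
  then show ?thesis using sum_prod_rademacher[OF assms(1), of "\<lambda>x. x"] by (simp add: zero_power)
qed

lemma uniform_exp_rad_sum:
  fixes s :: "'a :: {real_normed_field, banach}"
  assumes "J \<subseteq> {..<n}"
  shows "(\<Sum>x<2 ^ n. exp (s * of_real (rad_sum J x))) / 2 ^ n = ((exp s + exp (- s)) / 2) ^ card J"
proof -
  have fin: "finite J" using assms finite_subset by blast
  have "exp (s * of_real (rad_sum J x)) = (\<Prod>j\<in>J. exp (s * of_real (rademacher j x)))" for x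
    by (simp add: rad_sum_def sum_distrib_left exp_sum fin)
  then show ?thesis using sum_prod_rademacher[OF assms, of "\<lambda>x. exp (s * of_real x)"] by simp
qed

lemma power_le_fact_exp:
  fixes y :: real
  assumes "even K"
  shows "y ^ K / fact K \<le> exp y + exp (- y)"
proof -
  have "y ^ K / fact K = \<bar>y\<bar> ^ K / fact K" using assms by (simp add: power_even_abs)
  also have "\<dots> \<le> (\<Sum>k. \<bar>y\<bar> ^ k /\<^sub>R fact k)"
    using sum_le_suminf[OF summable_exp_generic[of "\<bar>y\<bar>"], of "{K}"] by (simp add: divide_inverse mult.commute)
  also have "\<dots> = exp \<bar>y\<bar>" by (simp add: exp_def)
  also have "\<dots> \<le> exp y + exp (- y)" by (cases "y \<ge> 0") auto
  finally show ?thesis .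
qed

lemma two_power_fact_le: "2 ^ k * fact k \<le> (fact (2 * k) :: real)"
proof (induction k)
  case (Suc k)
  have "2 ^ Suc k * fact (Suc k) = (2 * real (Suc k)) * (2 ^ k * fact k)" by simp
  also have "\<dots> \<le> (2 * real (Suc k)) * ((2 * real k + 1) * fact (2 * k))"
  proof (rule mult_left_mono)
    have "1 * fact (2 * k) \<le> (2 * real k + 1) * fact (2 * k)" by (rule mult_right_mono) auto
    with Suc show "2 ^ k * fact k \<le> (2 * real k + 1) * fact (2 * k)" by linarith
  qed simp
  also have "\<dots> = fact (2 * Suc k)" by (simp add: algebra_simps)
  finally show ?case .
qed simp

text \<open>Coefficientwise comparison of the power series, since \<open>fact (2 * k)\<close> is at
  least \<open>2^k * fact k\<close>. This is the subgaussian bound for one random sign.\<close>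

lemma cosh_le_exp_square: "cosh s \<le> exp (s ^ 2 / 2)" for s :: real
proof -
  have "strict_mono (\<lambda>k::nat. 2 * k)" by (simp add: strict_mono_def)
  then have 1: "(\<lambda>k. if even (2 * k) then s ^ (2 * k) /\<^sub>R fact (2 * k) else 0) sums cosh s"
    using cosh_converges[of s] by (subst sums_mono_reindex) (auto elim!: evenE)
  have 2: "(\<lambda>k. (s ^ 2 / 2) ^ k /\<^sub>R fact k) sums exp (s ^ 2 / 2)" by (rule exp_converges)
  show ?thesis
  proof (rule sums_le[OF _ 1 2])
    fix k
    have "s ^ (2 * k) / fact (2 * k) \<le> s ^ (2 * k) / (2 ^ k * fact k)"
      by (intro divide_left_mono two_power_fact_le) auto
    moreover have "(s ^ 2 / 2) ^ k /\<^sub>R fact k = s ^ (2 * k) / (2 ^ k * fact k)"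
      unfolding power_mult power_divide real_scaleR_def by (simp add: divide_inverse)
    moreover have "(if even (2 * k) then s ^ (2 * k) /\<^sub>R fact (2 * k) else 0) = s ^ (2 * k) / fact (2 * k)"
      by (simp add: divide_inverse)
    ultimately show "(if even (2 * k) then s ^ (2 * k) /\<^sub>R fact (2 * k) else 0) \<le> (s ^ 2 / 2) ^ k /\<^sub>R fact k"
      by (simp only:)
  qed
qed

text \<open>The power is estimated at the doubled argument \<open>?s = 2 * u / sqrt n\<close>, which
  produces the factor \<open>1 / 2^K\<close>. The exponential moment at \<open>?s\<close> costs at
  most \<open>exp (?s^2 / 2)\<close> per digit, \<open>exp (2 * u^2)\<close> altogether, and the
  signs of \<open>?s\<close> give the 2.\<close>

lemma uniform_even_moment_le:
  assumes J: "J \<subseteq> {..<n}" and K: "even K" and n: "n > 0"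
  shows "(\<Sum>x<2 ^ n. (u / sqrt n * rad_sum J x) ^ K / fact K) / 2 ^ n \<le> 2 * exp (2 * u ^ 2) / 2 ^ K"
proof -
  let ?s = "2 * u / sqrt n"
  have cJ: "card J \<le> n" using card_mono[OF _ J] by simp
  have e: "(\<Sum>x<2 ^ n. exp (t * rad_sum J x)) / 2 ^ n = cosh t ^ card J" for t :: real
    using uniform_exp_rad_sum[OF J, of t] by (simp add: cosh_field_def)
  have "(u / sqrt n * rad_sum J x) ^ K / fact K \<le> (exp (?s * rad_sum J x) + exp (- ?s * rad_sum J x)) / 2 ^ K" for x
  proof -
    have "(u / sqrt n * rad_sum J x) ^ K / fact K = ((?s * rad_sum J x) ^ K / fact K) / 2 ^ K"
      by (simp add: power_mult_distrib power_divide)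
    also have "\<dots> \<le> (exp (?s * rad_sum J x) + exp (- (?s * rad_sum J x))) / 2 ^ K"
      by (intro divide_right_mono power_le_fact_exp K) simp
    finally show ?thesis by simp
  qed
  then have "(\<Sum>x<2 ^ n. (u / sqrt n * rad_sum J x) ^ K / fact K) / 2 ^ n
     \<le> (\<Sum>x<2 ^ n. (exp (?s * rad_sum J x) + exp (- ?s * rad_sum J x)) / 2 ^ K) / 2 ^ n"
    by (intro divide_right_mono sum_mono) auto
  also have "\<dots> = ((\<Sum>x<2 ^ n. exp (?s * rad_sum J x)) / 2 ^ n + (\<Sum>x<2 ^ n. exp (- ?s * rad_sum J x)) / 2 ^ n) / 2 ^ K"
    by (simp add: sum.distrib add_divide_distrib sum_divide_distrib mult.commute)
  also have "\<dots> = 2 * cosh ?s ^ card J / 2 ^ K" unfolding e by simp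
  also have "cosh ?s ^ card J \<le> exp (2 * u ^ 2)"
  proof -
    have "cosh ?s ^ card J \<le> exp (?s ^ 2 / 2) ^ card J"
      by (intro power_mono cosh_le_exp_square) (simp add: cosh_real_pos less_imp_le)
    also have "\<dots> \<le> exp (?s ^ 2 / 2) ^ n" by (intro power_increasing cJ) simp
    also have "\<dots> = exp (2 * u ^ 2)"
      using n by (simp add: exp_of_nat_mult[symmetric] power_divide power_mult_distrib)
    finally show ?thesis .
  qed
  finally show ?thesis by (simp add: divide_right_mono)
qed

text \<open>The square of a sign is 1, so multiplying a Walsh function by the sign of
  \<open>j\<close> toggles \<open>j\<close> in \<open>A\<close> and enlarges the set by at most one.
  Expanding one factor \<open>rad_sum\<close> trades \<open>k\<close> for the size of
  \<open>A\<close>; the Walsh factor is in the statement to carry this induction.\<close>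

lemma moment_compare:
  fixes p :: "nat \<Rightarrow> real"
  assumes p1: "(\<Sum>x<2 ^ n. p x) = 1" and J: "J \<subseteq> {..<n}" and \<delta>: "\<delta> \<ge> 0"
    and W: "\<And>A. A \<subseteq> J \<Longrightarrow> A \<noteq> {} \<Longrightarrow> card A \<le> K \<Longrightarrow> \<bar>\<Sum>x<2 ^ n. p x * walsh A x\<bar> \<le> \<delta>"
    and A: "A \<subseteq> J" "card A + k \<le> K"
  shows "\<bar>\<Sum>x<2 ^ n. (p x - 1 / 2 ^ n) * (walsh A x * rad_sum J x ^ k)\<bar> \<le> real (card J) ^ k * \<delta>"
  using A
proof (induction k arbitrary: A)
  case 0
  show ?case
  proof (cases "A = {}")
    case True
    have "(\<Sum>x<2 ^ n. p x - 1 / 2 ^ n) = 0" using p1 by (simp add: sum_subtractf)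
    then show ?thesis using True \<delta> by simp
  next
    case False
    have "(\<Sum>x<2 ^ n. (p x - 1 / 2 ^ n) * walsh A x) = (\<Sum>x<2 ^ n. p x * walsh A x)
        - (\<Sum>x<2 ^ n. walsh A x) / 2 ^ n"
      by (simp add: left_diff_distrib sum_subtractf sum_divide_distrib)
    then show ?thesis using False 0 J uniform_walsh_eq_0[of A n] W[of A] by simp
  qed
next
  case (Suc k)
  have fin: "finite J" using J finite_subset by blast
  define B where "B j = (if j \<in> A then A - {j} else insert j A)" for j
  have finA: "finite A" using Suc.prems fin finite_subset by blast
  have B: "rademacher j x * walsh A x = walsh (B j) x" for j x
  proof (cases "j \<in> A")
    case True
    have "walsh A x = rademacher j x * (\<Prod>i\<in>A - {j}. rademacher i x)"
      by (rule prod.remove[OF finA True])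
    then show ?thesis using True by (simp add: B_def mult.assoc[symmetric])
  qed (use finA in \<open>simp add: B_def\<close>)
  have BJ: "B j \<subseteq> J" "card (B j) + k \<le> K" if "j \<in> J" for j
  proof -
    show "B j \<subseteq> J" using that Suc.prems by (auto simp: B_def)
    have "card (B j) \<le> Suc (card A)" using finA by (auto simp: B_def card_insert_if card_Diff_subset)
    then show "card (B j) + k \<le> K" using Suc.prems by simp
  qed
  have "(\<Sum>x<2 ^ n. (p x - 1 / 2 ^ n) * (walsh A x * rad_sum J x ^ Suc k))
     = (\<Sum>x<2 ^ n. \<Sum>j\<in>J. (p x - 1 / 2 ^ n) * (walsh (B j) x * rad_sum J x ^ k))"
  proof (rule sum.cong[OF refl])
    fix x
    have "(p x - 1 / 2 ^ n) * (walsh A x * rad_sum J x ^ Suc k)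
      = (\<Sum>j\<in>J. rademacher j x) * ((p x - 1 / 2 ^ n) * (walsh A x * rad_sum J x ^ k))"
      by (simp add: rad_sum_def mult_ac)
    also have "\<dots> = (\<Sum>j\<in>J. (p x - 1 / 2 ^ n) * (walsh (B j) x * rad_sum J x ^ k))"
      unfolding sum_distrib_right B[symmetric] by (intro sum.cong refl) (simp only: mult_ac)
    finally show "(p x - 1 / 2 ^ n) * (walsh A x * rad_sum J x ^ Suc k) = \<dots>" .
  qed
  also have "\<dots> = (\<Sum>j\<in>J. \<Sum>x<2 ^ n. (p x - 1 / 2 ^ n) * (walsh (B j) x * rad_sum J x ^ k))"
    by (rule sum.swap)
  finally have "\<bar>\<Sum>x<2 ^ n. (p x - 1 / 2 ^ n) * (walsh A x * rad_sum J x ^ Suc k)\<bar>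
    \<le> (\<Sum>j\<in>J. \<bar>\<Sum>x<2 ^ n. (p x - 1 / 2 ^ n) * (walsh (B j) x * rad_sum J x ^ k)\<bar>)"
    by (simp only: sum_abs)
  also have "\<dots> \<le> (\<Sum>j\<in>J. real (card J) ^ k * \<delta>)"
    by (intro sum_mono Suc.IH BJ)
  finally show ?case by simp
qed

text \<open>Taylor expansion of \<open>iexp\<close> to the even order \<open>K\<close>. The terms
  below \<open>K\<close> are differences of moments. The remainder is at most
  \<open>\<theta>^K / K!\<close>, whose mean under \<open>p\<close> is the uniform mean plus one
  more difference of moments.\<close>

lemma char_compare:
  fixes p :: "nat \<Rightarrow> real"
  assumes p1: "(\<Sum>x<2 ^ n. p x) = 1" and p0: "\<And>x. p x \<ge> 0" and J: "J \<subseteq> {..<n}" and \<delta>: "\<delta> \<ge> 0" and n: "n > 0"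
    and K: "even K" "K > 0"
    and W: "\<And>A. A \<subseteq> J \<Longrightarrow> A \<noteq> {} \<Longrightarrow> card A \<le> K \<Longrightarrow> \<bar>\<Sum>x<2 ^ n. p x * walsh A x\<bar> \<le> \<delta>"
  shows "norm (\<Sum>x<2 ^ n. (p x - 1 / 2 ^ n) *\<^sub>R iexp (u / sqrt n * rad_sum J x)) \<le> exp \<bar>u\<bar> * real n ^ K * \<delta> + 4 * exp (2 * u ^ 2) / 2 ^ K"
proof -
  define \<theta> where "\<theta> x = u / sqrt n * rad_sum J x" for x
  define D where "D k = (\<Sum>x<2 ^ n. (p x - 1 / 2 ^ n) * \<theta> x ^ k)" for k
  have cJ: "card J \<le> n" using card_mono[OF _ J] by simp
  have D: "\<bar>D k\<bar> \<le> \<bar>u\<bar> ^ k * (real n ^ K * \<delta>)" if "k \<le> K" for k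
  proof -
    have "D k = (u / sqrt n) ^ k * (\<Sum>x<2 ^ n. (p x - 1 / 2 ^ n) * rad_sum J x ^ k)"
      unfolding D_def \<theta>_def power_mult_distrib sum_distrib_left by (simp only: mult_ac)
    then have "\<bar>D k\<bar> = (\<bar>u\<bar> / sqrt n) ^ k * \<bar>\<Sum>x<2 ^ n. (p x - 1 / 2 ^ n) * rad_sum J x ^ k\<bar>"
      by (simp add: abs_mult power_abs)
    also have "\<dots> \<le> \<bar>u\<bar> ^ k * (real n ^ K * \<delta>)"
    proof (rule mult_mono)
      have "\<bar>u\<bar> / sqrt n \<le> \<bar>u\<bar>" using n by (simp add: divide_le_eq mult_le_cancel_left1)
      then show "(\<bar>u\<bar> / sqrt n) ^ k \<le> \<bar>u\<bar> ^ k" by (intro power_mono) auto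
      have "\<bar>\<Sum>x<2 ^ n. (p x - 1 / 2 ^ n) * rad_sum J x ^ k\<bar> \<le> real (card J) ^ k * \<delta>"
        using moment_compare[OF p1 J \<delta> W, where A = "{}" and k = k] that by simp
      also have "real (card J) ^ k \<le> real n ^ k" using cJ by (intro power_mono) auto
      also have "real n ^ k \<le> real n ^ K" using n that by (intro power_increasing) auto
      finally show "\<bar>\<Sum>x<2 ^ n. (p x - 1 / 2 ^ n) * rad_sum J x ^ k\<bar> \<le> real n ^ K * \<delta>"
        using \<delta> by (simp add: mult_right_mono)
    qed auto
    finally show ?thesis .
  qed
  define R where "R x = iexp (\<theta> x) - (\<Sum>k<K. (\<i> * \<theta> x) ^ k / fact k)" for x
  have R: "norm (R x) \<le> \<theta> x ^ K / fact K" for x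
  proof -
    have "norm (R x) \<le> \<bar>\<theta> x\<bar> ^ K / fact K"
      using iexp_approx1[of "\<theta> x" "K - 1"] K(2) by (simp add: R_def lessThan_Suc_atMost[symmetric])
    then show ?thesis using K(1) by (simp add: power_even_abs)
  qed
  define M where "M = (\<Sum>x<2 ^ n. \<theta> x ^ K / fact K) / 2 ^ n"
  have M: "M \<le> 2 * exp (2 * u ^ 2) / 2 ^ K"
    unfolding M_def \<theta>_def by (rule uniform_even_moment_le[OF J K(1) n])
  \<comment> \<open>The weight \<open>p + 1 / 2^n\<close> is twice the uniform weight plus the
    difference \<open>p - 1 / 2^n\<close>; so only a uniform moment and \<open>D K\<close>
    occur.\<close>
  have sR: "(\<Sum>x<2 ^ n. (p x + 1 / 2 ^ n) * (\<theta> x ^ K / fact K)) = 2 * M + D K / fact K"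
    by (simp add: M_def D_def sum_distrib_left sum_divide_distrib sum.distrib[symmetric] field_simps)
  have "(\<Sum>x<2 ^ n. (p x - 1 / 2 ^ n) *\<^sub>R iexp (\<theta> x)) = (\<Sum>k<K. of_real (D k) * \<i> ^ k / fact k) + (\<Sum>x<2 ^ n. (p x - 1 / 2 ^ n) *\<^sub>R R x)"
  proof -
    have "(\<Sum>x<2 ^ n. (p x - 1 / 2 ^ n) *\<^sub>R iexp (\<theta> x)) = (\<Sum>x<2 ^ n. (\<Sum>k<K. (p x - 1 / 2 ^ n) *\<^sub>R ((\<i> * \<theta> x) ^ k / fact k)) + (p x - 1 / 2 ^ n) *\<^sub>R R x)"
      by (rule sum.cong) (simp_all add: R_def scaleR_sum_right[symmetric] scaleR_add_right[symmetric] del: scaleR_add_right)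
    also have "\<dots> = (\<Sum>k<K. \<Sum>x<2 ^ n. (p x - 1 / 2 ^ n) *\<^sub>R ((\<i> * \<theta> x) ^ k / fact k)) + (\<Sum>x<2 ^ n. (p x - 1 / 2 ^ n) *\<^sub>R R x)"
      unfolding sum.distrib by (subst sum.swap) (rule refl)
    also have "(\<Sum>k<K. \<Sum>x<2 ^ n. (p x - 1 / 2 ^ n) *\<^sub>R ((\<i> * \<theta> x) ^ k / fact k)) = (\<Sum>k<K. of_real (D k) * \<i> ^ k / fact k)"
      unfolding D_def of_real_sum sum_distrib_right sum_divide_distrib
      by (intro sum.cong refl) (simp add: scaleR_conv_of_real power_mult_distrib mult_ac)
    finally show ?thesis .
  qed
  also have "norm \<dots> \<le> (\<Sum>k<K. \<bar>u\<bar> ^ k * (real n ^ K * \<delta>) / fact k) + (\<Sum>x<2 ^ n. (p x + 1 / 2 ^ n) * (\<theta> x ^ K / fact K))"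
  proof (rule order_trans[OF norm_triangle_ineq add_mono])
    show "norm (\<Sum>k<K. of_real (D k) * \<i> ^ k / fact k) \<le> (\<Sum>k<K. \<bar>u\<bar> ^ k * (real n ^ K * \<delta>) / fact k)"
      by (rule sum_norm_le) (use D in \<open>auto simp: norm_divide norm_mult norm_power intro!: divide_right_mono\<close>)
    show "norm (\<Sum>x<2 ^ n. (p x - 1 / 2 ^ n) *\<^sub>R R x) \<le> (\<Sum>x<2 ^ n. (p x + 1 / 2 ^ n) * (\<theta> x ^ K / fact K))"
    proof (rule sum_norm_le)
      fix x
      have "\<bar>p x - 1 / 2 ^ n\<bar> \<le> p x + 1 / 2 ^ n" using p0[of x] by (simp add: abs_if)
      then show "norm ((p x - 1 / 2 ^ n) *\<^sub>R R x) \<le> (p x + 1 / 2 ^ n) * (\<theta> x ^ K / fact K)"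
        unfolding norm_scaleR by (intro mult_mono R) auto
    qed
  qed
  also have "\<dots> = (\<Sum>k<K. \<bar>u\<bar> ^ k / fact k) * (real n ^ K * \<delta>) + D K / fact K + 2 * M"
    unfolding sR by (simp add: sum_distrib_right)
  also have "\<dots> \<le> (\<Sum>k<K. \<bar>u\<bar> ^ k / fact k) * (real n ^ K * \<delta>) + (\<bar>u\<bar> ^ K / fact K) * (real n ^ K * \<delta>) + 2 * (2 * exp (2 * u ^ 2) / 2 ^ K)"
  proof (intro add_mono order_refl mult_left_mono M)
    show "D K / fact K \<le> (\<bar>u\<bar> ^ K / fact K) * (real n ^ K * \<delta>)"
      using D[of K] by (simp add: divide_right_mono)
  qed simp
  \<comment> \<open>The bound for \<open>D K\<close> is the next summand, \<open>k = K\<close>, of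
    the exponential series.\<close>
  also have "\<dots> = (\<Sum>k<Suc K. \<bar>u\<bar> ^ k / fact k) * (real n ^ K * \<delta>) + 4 * exp (2 * u ^ 2) / 2 ^ K"
    by (simp add: distrib_right)
  also have "(\<Sum>k<Suc K. \<bar>u\<bar> ^ k / fact k) \<le> exp \<bar>u\<bar>"
    using sum_le_suminf[OF summable_exp_generic[of "\<bar>u\<bar>"], of "{..<Suc K}"]
    by (simp add: exp_def divide_inverse mult.commute)
  finally show ?thesis using \<delta> unfolding \<theta>_def by (simp add: mult_right_mono mult.assoc)
qed

section \<open>The normal law and the limit theorem for the digit signs\<close>

lemma std_normal_measure_singleton: "measure std_normal_distribution {x :: real} = 0"
proof -
  have "{x} \<in> null_sets lborel" by (intro null_setsI) auto
  moreover have "absolutely_continuous lborel std_normal_distribution"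
    by (rule absolutely_continuousI_density) simp
  ultimately have "{x} \<in> null_sets std_normal_distribution"
    by (auto simp: absolutely_continuous_def)
  then show ?thesis by (simp add: null_sets_def measure_def)
qed

lemma std_normal_isCont_cdf: "isCont (cdf std_normal_distribution) x"
proof -
  interpret N: real_distribution std_normal_distribution by (rule real_dist_normal_dist)
  show ?thesis by (simp add: N.isCont_cdf std_normal_measure_singleton)
qed

text \<open>The characteristic function is even, and it determines the law.\<close>

lemma std_normal_uminus: "distr std_normal_distribution borel uminus = std_normal_distribution"
proof (rule Levy_uniqueness)
  interpret N: real_distribution std_normal_distribution by (rule real_dist_normal_dist)
  show "real_distribution (distr std_normal_distribution borel uminus)"
    by (rule N.real_distribution_distr) simp
  show "char (distr std_normal_distribution borel uminus) = char std_normal_distribution"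
  proof
    fix t
    have "char (distr std_normal_distribution borel uminus) t = char std_normal_distribution (- t)"
      unfolding char_def by (subst integral_distr) auto
    then show "char (distr std_normal_distribution borel uminus) t = char std_normal_distribution t"
      by (simp add: char_std_normal_distribution)
  qed
qed (rule real_dist_normal_dist)

lemma std_normal_cdf_0: "cdf std_normal_distribution 0 = 1 / 2"
proof -
  interpret N: real_distribution std_normal_distribution by (rule real_dist_normal_dist)
  have "measure std_normal_distribution {..0} = measure (distr std_normal_distribution borel uminus) {..0}"
    by (simp only: std_normal_uminus)
  also have "\<dots> = measure std_normal_distribution (uminus -` {..0} \<inter> space std_normal_distribution)"
    by (rule measure_distr) auto
  also have "uminus -` {..0} \<inter> space std_normal_distribution = {0::real..}" by auto
  finally have "measure std_normal_distribution {..0} = measure std_normal_distribution {0::real..}" .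
  moreover have "measure std_normal_distribution ({..0} \<union> {0<..}) = measure std_normal_distribution {..0::real} + measure std_normal_distribution {0<..}"
    by (rule N.finite_measure_Union) auto
  moreover have "measure std_normal_distribution ({0} \<union> {0<..}) = measure std_normal_distribution {0::real} + measure std_normal_distribution {0<..}"
    by (rule N.finite_measure_Union) auto
  moreover have "{..0} \<union> {0<..} = space std_normal_distribution" "{0} \<union> {0<..} = {0::real..}" by auto
  ultimately show ?thesis
    using N.prob_space std_normal_measure_singleton[of 0] by (simp add: cdf_def)
qed

text \<open>\<open>k n\<close> will be the number of digits kept, while the normalisation remains
  \<open>sqrt n\<close>.\<close>

lemma cos_power_tendsto_gaussian:
  fixes t :: real and k :: "nat \<Rightarrow> nat"
  assumes k: "(\<lambda>n. real (k n) / real n) \<longlonglongrightarrow> 1"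
  shows "(\<lambda>n. cos (t / sqrt (real n)) ^ k n) \<longlonglongrightarrow> exp (- (t ^ 2) / 2)"
proof -
  have lim: "(\<lambda>n. real n * ln (cos (t / sqrt (real n)))) \<longlonglongrightarrow> - (t * t / 2)"
    by real_asymp
  then have lim: "(\<lambda>n. real n * ln (cos (t / sqrt (real n)))) \<longlonglongrightarrow> - (t ^ 2) / 2"
    by (simp add: power2_eq_square)
  have "(\<lambda>n. real (k n) / real n * (real n * ln (cos (t / sqrt (real n))))) \<longlonglongrightarrow> 1 * (- (t ^ 2) / 2)"
    by (intro tendsto_mult k lim)
  then have "(\<lambda>n. exp (real (k n) / real n * (real n * ln (cos (t / sqrt (real n)))))) \<longlonglongrightarrow> exp (1 * (- (t ^ 2) / 2))"
    by (rule tendsto_exp)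
  moreover have "\<forall>\<^sub>F n in sequentially. exp (real (k n) / real n * (real n * ln (cos (t / sqrt (real n))))) = cos (t / sqrt (real n)) ^ k n"
  proof -
    have "(\<lambda>n. cos (t / sqrt (real n))) \<longlonglongrightarrow> 1" by real_asymp
    then have "\<forall>\<^sub>F n in sequentially. cos (t / sqrt (real n)) > 0"
      by (rule order_tendstoD) simp
    then show ?thesis using eventually_gt_at_top[of 0]
    proof eventually_elim
      case (elim n)
      then have "exp (real (k n) / real n * (real n * ln (cos (t / sqrt (real n))))) = exp (real (k n) * ln (cos (t / sqrt (real n))))"
        by simp
      also have "\<dots> = cos (t / sqrt (real n)) ^ k n"
        using elim by (simp add: exp_of_nat_mult)
      finally show ?case .
    qed
  qed
  ultimately show ?thesis by (auto intro: Lim_transform_eventually)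
qed

text \<open>Levy's continuity theorem gives the normal limit for the digits in \<open>J n\<close>.
  The other digits shift the sum by at most \<open>16 * w n\<close>, eventually less than
  \<open>\<epsilon> * sqrt n\<close>, so the event lies between the events for the kept digits at
  \<open>- \<epsilon>\<close> and at \<open>\<epsilon>\<close>; the normal distribution function is
  continuous with value 1/2 at 0.\<close>

lemma rad_sum_limit_half:
  fixes P :: "nat \<Rightarrow> nat pmf" and w :: "nat \<Rightarrow> nat" and \<delta> :: "nat \<Rightarrow> nat \<Rightarrow> real"
  assumes supp: "\<forall>\<^sub>F n in sequentially. set_pmf (P n) \<subseteq> {..<2 ^ n}"
    and walsh: "\<And>K. \<forall>\<^sub>F n in sequentially. \<forall>A. A \<subseteq> {8 * w n..<n - 8 * w n} \<longrightarrow> A \<noteq> {} \<longrightarrow> card A \<le> K \<longrightarrow>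
        \<bar>\<Sum>x<2 ^ n. pmf (P n) x * walsh A x\<bar> \<le> \<delta> K n"
    and \<delta>0: "\<And>K n. \<delta> K n \<ge> 0" and \<delta>: "\<And>K. (\<lambda>n. real n ^ K * \<delta> K n) \<longlonglongrightarrow> 0"
    and w: "(\<lambda>n. real (w n) / sqrt (real n)) \<longlonglongrightarrow> 0"
  shows "(\<lambda>n. measure (P n) {x. rad_sum {..<n} x < 0}) \<longlonglongrightarrow> 1 / 2"
proof -
  define J where "J n = {8 * w n..<n - 8 * w n}" for n
  define M where "M n = distr (measure_pmf (P n)) borel (\<lambda>x. rad_sum (J n) x / sqrt (real n))" for n
  have J: "J n \<subseteq> {..<n}" for n by (auto simp: J_def)
  have small: "\<forall>\<^sub>F n in sequentially. 16 * real (w n) < \<epsilon> * sqrt (real n)" if "\<epsilon> > 0" for \<epsilon>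
  proof -
    have "\<forall>\<^sub>F n in sequentially. real (w n) / sqrt (real n) < \<epsilon> / 16"
      using that by (intro order_tendstoD[OF w]) simp
    then show ?thesis using eventually_gt_at_top[of 0]
      by eventually_elim (simp add: field_simps)
  qed
  have w16: "\<forall>\<^sub>F n in sequentially. 16 * w n \<le> n"
    using small[of 1, OF zero_less_one] eventually_gt_at_top[of 0]
  proof eventually_elim
    case (elim n)
    have "sqrt (real n) * 1 \<le> sqrt (real n) * sqrt (real n)" using elim by (intro mult_left_mono) auto
    then have "sqrt (real n) \<le> real n" by simp
    with elim have "16 * real (w n) \<le> real n" by simp
    then show ?case by linarith
  qed
  have cardJ: "(\<lambda>n. real (card (J n)) / real n) \<longlonglongrightarrow> 1"
  proof -
    have "(\<lambda>n. 1 - 16 * (real (w n) / sqrt (real n)) * (1 / sqrt (real n))) \<longlonglongrightarrow> 1 - 16 * 0 * 0"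
      by (intro tendsto_intros w) real_asymp
    moreover have "\<forall>\<^sub>F n in sequentially. 1 - 16 * (real (w n) / sqrt (real n)) * (1 / sqrt (real n)) = real (card (J n)) / real n"
      using w16 eventually_gt_at_top[of 0]
    proof eventually_elim
      case (elim n)
      then have "real (card (J n)) = real n - 16 * real (w n)" by (simp add: J_def)
      moreover have "1 - 16 * (real (w n) / sqrt (real n)) * (1 / sqrt (real n)) = 1 - 16 * real (w n) / (sqrt (real n) * sqrt (real n))"
        by simp
      ultimately show ?case using elim by (simp add: field_simps)
    qed
    ultimately show ?thesis by (auto intro: Lim_transform_eventually)
  qed
  have rd: "real_distribution (M n)" for n
    unfolding M_def by (rule prob_space.real_distribution_distr[OF prob_space_measure_pmf]) simp
  have char_lim: "(\<lambda>n. char (M n) t) \<longlonglongrightarrow> char std_normal_distribution t" for t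
  proof -
    let ?g = "\<lambda>n. of_real (cos (t / sqrt (real n)) ^ card (J n)) :: complex"
    have "(\<lambda>n. char (M n) t - ?g n) \<longlonglongrightarrow> 0"
    proof (rule tendstoI)
      fix \<epsilon> :: real assume \<epsilon>: "\<epsilon> > 0"
      have "(\<lambda>K. 4 * exp (2 * t ^ 2) / 2 ^ (2 * K)) \<longlonglongrightarrow> 0" by real_asymp
      then have "\<forall>\<^sub>F K in sequentially. 4 * exp (2 * t ^ 2) / 2 ^ (2 * K) < \<epsilon> / 2"
        using \<epsilon> by (intro order_tendstoD) auto
      then obtain K0 where K0: "\<And>K. K \<ge> K0 \<Longrightarrow> 4 * exp (2 * t ^ 2) / 2 ^ (2 * K) < \<epsilon> / 2"
        unfolding eventually_sequentially by blast
      \<comment> \<open>Even and positive, as the Taylor remainder demands, and so large that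
        truncation costs less than \<open>\<epsilon> / 2\<close>. Only then does \<open>n\<close>
        grow, which is why \<open>\<delta>\<close> may depend on \<open>K\<close>.\<close>
      define K where "K = 2 * Suc K0"
      have K: "even K" "K > 0" "4 * exp (2 * t ^ 2) / 2 ^ K < \<epsilon> / 2"
        using K0[of "Suc K0"] by (auto simp: K_def)
      have "(\<lambda>n. exp \<bar>t\<bar> * (real n ^ K * \<delta> K n)) \<longlonglongrightarrow> exp \<bar>t\<bar> * 0"
        by (intro tendsto_intros \<delta>)
      then have ev: "\<forall>\<^sub>F n in sequentially. exp \<bar>t\<bar> * (real n ^ K * \<delta> K n) < \<epsilon> / 2"
        using \<epsilon> by (intro order_tendstoD(2)[where y = "exp \<bar>t\<bar> * 0"]) auto
      show "\<forall>\<^sub>F n in sequentially. dist (char (M n) t - ?g n) 0 < \<epsilon>"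
        using ev walsh[of K] supp eventually_gt_at_top[of 0]
      proof eventually_elim
        case (elim n)
        let ?e = "\<lambda>x. iexp (t / sqrt n * rad_sum (J n) x)"
        have "char (M n) t = (LINT x|P n. iexp (t * (rad_sum (J n) x / sqrt n)))"
          unfolding char_def M_def by (subst integral_distr) auto
        also have "\<dots> = (\<Sum>x<2 ^ n. pmf (P n) x *\<^sub>R ?e x)"
          using elim(3) by (subst integral_measure_pmf[of "{..<2 ^ n}"]) auto
        finally have c: "char (M n) t = (\<Sum>x<2 ^ n. pmf (P n) x *\<^sub>R ?e x)" .
        have "(\<Sum>x<2 ^ n. ?e x) / 2 ^ n = ((exp (\<i> * (t / sqrt n)) + exp (- (\<i> * (t / sqrt n)))) / 2) ^ card (J n)"
          using uniform_exp_rad_sum[OF J, of "\<i> * of_real (t / sqrt n)" n] by (simp add: mult_ac)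
        also have "(exp (\<i> * (t / sqrt n)) + exp (- (\<i> * (t / sqrt n)))) / 2 = cos (of_real (t / sqrt n))"
          by (simp add: cos_exp_eq)
        also have "\<dots> = of_real (cos (t / sqrt n))" by (simp only: cos_of_real)
        finally have g: "(\<Sum>x<2 ^ n. ?e x) / 2 ^ n = ?g n" by simp
        have "char (M n) t - ?g n = (\<Sum>x<2 ^ n. (pmf (P n) x - 1 / 2 ^ n) *\<^sub>R ?e x)"
          unfolding c g[symmetric] sum_divide_distrib sum_subtractf[symmetric]
          by (intro sum.cong refl) (simp add: scaleR_conv_of_real left_diff_distrib)
        also have "norm \<dots> \<le> exp \<bar>t\<bar> * real n ^ K * \<delta> K n + 4 * exp (2 * t ^ 2) / 2 ^ K"
        proof (rule char_compare)
          show "(\<Sum>x<2 ^ n. pmf (P n) x) = 1" by (rule sum_pmf_eq_1) (use elim(3) in auto)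
        qed (use elim J \<delta>0 K in \<open>auto simp: J_def\<close>)
        also have "\<dots> < \<epsilon>" using elim(1) K(3) by (simp only: mult.assoc)
        finally show ?case by simp
      qed
    qed
    moreover have "?g \<longlonglongrightarrow> of_real (exp (- (t ^ 2) / 2))"
      by (intro tendsto_of_real cos_power_tendsto_gaussian cardJ)
    ultimately have "(\<lambda>n. (char (M n) t - ?g n) + ?g n) \<longlonglongrightarrow> 0 + of_real (exp (- (t ^ 2) / 2))"
      by (rule tendsto_add)
    then show ?thesis by (simp add: char_std_normal_distribution)
  qed
  have wc: "weak_conv_m M std_normal_distribution"
    by (rule levy_continuity[OF rd real_dist_normal_dist char_lim])
  let ?\<Phi> = "cdf std_normal_distribution"
  have cdf_lim: "(\<lambda>n. cdf (M n) y) \<longlonglongrightarrow> ?\<Phi> y" for y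
    using wc std_normal_isCont_cdf by (auto simp: weak_conv_m_def weak_conv_def)
  have cdfM: "cdf (M n) y = measure (P n) {x. rad_sum (J n) x / sqrt (real n) \<le> y}" for n y
    unfolding cdf_def M_def by (subst measure_distr) (auto simp: vimage_def)
  show ?thesis
  proof (rule tendstoI)
    fix \<eta> :: real assume \<eta>: "\<eta> > 0"
    have "\<exists>s>0. \<forall>y. dist y 0 < s \<longrightarrow> dist (?\<Phi> y) (?\<Phi> 0) < \<eta> / 2"
      using std_normal_isCont_cdf[of 0] \<eta> unfolding continuous_at_eps_delta by (metis half_gt_zero)
    then obtain s where s: "s > 0" "\<And>y. \<bar>y\<bar> < s \<Longrightarrow> \<bar>?\<Phi> y - 1 / 2\<bar> < \<eta> / 2"
      by (auto simp: std_normal_cdf_0 dist_real_def)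
    define \<epsilon> where "\<epsilon> = s / 2"
    have \<epsilon>: "\<epsilon> > 0" "\<bar>?\<Phi> \<epsilon> - 1 / 2\<bar> < \<eta> / 2" "\<bar>?\<Phi> (- \<epsilon>) - 1 / 2\<bar> < \<eta> / 2"
      using s by (auto simp: \<epsilon>_def)
    have e1: "\<forall>\<^sub>F n in sequentially. \<bar>cdf (M n) y - ?\<Phi> y\<bar> < \<eta> / 2" for y
      using tendstoD[OF cdf_lim[of y], of "\<eta> / 2"] \<eta> by (simp add: dist_real_def)
    show "\<forall>\<^sub>F n in sequentially. dist (measure (P n) {x. rad_sum {..<n} x < 0}) (1 / 2) < \<eta>"
      using e1[of \<epsilon>] e1[of "- \<epsilon>"] small[OF \<epsilon>(1)] w16 eventually_gt_at_top[of 0]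
    proof eventually_elim
      case (elim n)
      have close: "\<bar>rad_sum {..<n} x - rad_sum (J n) x\<bar> \<le> 16 * real (w n)" for x
      proof -
        have "rad_sum {..<n} x - rad_sum (J n) x = (\<Sum>j\<in>{..<n} - J n. rademacher j x)"
          unfolding rad_sum_def using J[of n] by (simp add: sum_diff)
        also have "\<bar>\<dots>\<bar> \<le> (\<Sum>j\<in>{..<n} - J n. 1)"
          by (rule order_trans[OF sum_abs]) (rule sum_mono, simp)
        also have "\<dots> = real (n - card (J n))" using J[of n] by (simp add: card_Diff_subset finite_subset[OF J])
        also have "\<dots> = 16 * real (w n)" using elim(4) by (simp add: J_def)
        finally show ?thesis .
      qed
      have sq: "sqrt (real n) > 0" using elim by simp
      have "measure (P n) {x. rad_sum (J n) x / sqrt (real n) \<le> - \<epsilon>} \<le> measure (P n) {x. rad_sum {..<n} x < 0}"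
      proof (rule measure_pmf.finite_measure_mono)
        show "{x. rad_sum (J n) x / sqrt (real n) \<le> - \<epsilon>} \<subseteq> {x. rad_sum {..<n} x < 0}"
        proof safe
          fix x assume "rad_sum (J n) x / sqrt (real n) \<le> - \<epsilon>"
          then have "rad_sum (J n) x \<le> - \<epsilon> * sqrt (real n)" using sq by (simp only: pos_divide_le_eq)
          then show "rad_sum {..<n} x < 0" using close[of x] elim(3) by simp
        qed
      qed simp
      moreover have "measure (P n) {x. rad_sum {..<n} x < 0} \<le> measure (P n) {x. rad_sum (J n) x / sqrt (real n) \<le> \<epsilon>}"
      proof (rule measure_pmf.finite_measure_mono)
        show "{x. rad_sum {..<n} x < 0} \<subseteq> {x. rad_sum (J n) x / sqrt (real n) \<le> \<epsilon>}"
        proof safe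
          fix x assume "rad_sum {..<n} x < 0"
          then have "rad_sum (J n) x \<le> \<epsilon> * sqrt (real n)" using close[of x] elim(3) by simp
          then show "rad_sum (J n) x / sqrt (real n) \<le> \<epsilon>" using sq by (simp only: pos_divide_le_eq)
        qed
      qed simp
      ultimately show ?case using elim(1,2) \<epsilon> unfolding cdfM dist_real_def by linarith
    qed
  qed
qed

section \<open>Chebyshev bound and a Tauberian theorem\<close>

definition psi :: "nat \<Rightarrow> real" where "psi n = (\<Sum>k\<in>{1..<Suc n}. mangoldt k)"

lemma psi_Suc: "psi (Suc n) = psi n + mangoldt (Suc n)"
  by (simp add: psi_def)

lemma psi_0 [simp]: "psi 0 = 0"
  by (simp add: psi_def)

lemma psi_mono: "m \<le> n \<Longrightarrow> psi m \<le> psi n"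
  by (induction n rule: dec_induct) (auto simp: psi_Suc intro: order_trans add_increasing2 mangoldt_nonneg)

lemma psi_nonneg: "psi n \<ge> 0"
  by (simp add: psi_def sum_nonneg mangoldt_nonneg)

lemma ln_fact_mangoldt: "ln (fact n) = (\<Sum>d\<in>{1..<Suc n}. mangoldt d * real (n div d))"
proof -
  have "ln (fact n) = (\<Sum>k\<in>{1..<Suc n}. ln (real k))"
  proof (induction n)
    case (Suc n)
    have "ln (fact (Suc n)) = ln (real (Suc n)) + ln (fact n)"
      unfolding fact_Suc by (subst ln_mult) auto
    then show ?case using Suc by simp
  qed simp
  also have "\<dots> = (\<Sum>k\<in>{1..<Suc n}. \<Sum>d | d dvd k. mangoldt d)"
    by (rule sum.cong) (auto simp: mangoldt_sum)
  also have "\<dots> = (\<Sum>d\<in>{1..<Suc n}. \<Sum>k | 0 < k \<and> d * k < Suc n. mangoldt d)"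
    by (rule sum_divisors_swap)
  also have "\<dots> = (\<Sum>d\<in>{1..<Suc n}. mangoldt d * real (n div d))"
  proof (rule sum.cong[OF refl])
    fix d assume d: "d \<in> {1..<Suc n}"
    have "{k. 0 < k \<and> d * k < Suc n} = {1..n div d}"
      using d by (auto simp: Suc_le_eq less_eq_div_iff_mult_less_eq mult.commute less_Suc_eq_le)
    then show "(\<Sum>k | 0 < k \<and> d * k < Suc n. mangoldt d) = mangoldt d * real (n div d)" by simp
  qed
  finally show ?thesis .
qed

text \<open>Chebyshev's argument: in the logarithm of the central binomial coefficient, which is at
  most \<open>2^(2 * n)\<close>, every \<open>d\<close> between \<open>n + 1\<close> and
  \<open>2 * n\<close> has weight at least 1 and no weight is negative.\<close>

lemma psi_double_le: "psi (2 * n) \<le> psi n + 2 * real n"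
proof (cases "n = 0")
  case False
  have ext: "(\<Sum>d\<in>{1..<Suc n}. mangoldt d * real (n div d)) = (\<Sum>d\<in>{1..<Suc (2*n)}. mangoldt d * real (n div d))"
    by (rule sum.mono_neutral_left) auto
  have "psi (2 * n) - psi n = (\<Sum>d\<in>{Suc n..<Suc (2 * n)}. mangoldt d)"
    unfolding psi_def using sum.atLeastLessThan_concat[of 1 "Suc n" "Suc (2*n)" "mangoldt :: nat \<Rightarrow> real"] by simp
  also have "\<dots> \<le> (\<Sum>d\<in>{Suc n..<Suc (2 * n)}. mangoldt d * (real (2 * n div d) - 2 * real (n div d)))"
  proof (rule sum_mono)
    fix d assume d: "d \<in> {Suc n..<Suc (2 * n)}"
    then have "n div d = 0" "2 * n div d \<ge> 1" by (auto simp: div_greater_zero_iff Suc_le_eq)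
    then have "mangoldt d * 1 \<le> mangoldt d * (real (2 * n div d) - 2 * real (n div d))"
      by (intro mult_left_mono mangoldt_nonneg) auto
    then show "mangoldt d \<le> mangoldt d * (real (2 * n div d) - 2 * real (n div d))" by simp
  qed
  also have "\<dots> \<le> (\<Sum>d\<in>{1..<Suc (2 * n)}. mangoldt d * (real (2 * n div d) - 2 * real (n div d)))"
  proof (rule sum_mono2)
    fix d
    have "2 * (n div d) \<le> 2 * n div d" 
      by (cases "d = 0") (auto simp: less_eq_div_iff_mult_less_eq)
    then have "2 * real (n div d) \<le> real (2 * n div d)" by linarith
    then show "0 \<le> mangoldt d * (real (2 * n div d) - 2 * real (n div d))"
      by (intro mult_nonneg_nonneg mangoldt_nonneg) auto
  qed auto
  also have "\<dots> = ln (fact (2 * n)) - 2 * ln (fact n)"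
    unfolding ln_fact_mangoldt ext by (simp add: right_diff_distrib sum_subtractf sum_distrib_left mult_ac)
  also have "\<dots> = ln (real ((2 * n) choose n))"
  proof -
    have "fact (2 * n) = fact n * fact n * real ((2 * n) choose n)"
      using binomial_fact_lemma[of n "2 * n"] by (metis add_diff_cancel_left' le_add1 mult_2 of_nat_fact of_nat_mult)
    then have "ln (fact (2 * n)) = ln (fact n) + ln (fact n) + ln (real ((2 * n) choose n))"
      by (simp add: ln_mult)
    then show ?thesis by simp
  qed
  also have "\<dots> \<le> ln (2 ^ (2 * n))"
  proof -
    have "real ((2 * n) choose n) \<le> real (2 ^ (2 * n))" using binomial_le_pow2[of "2 * n" n] by (simp only: of_nat_le_iff)
    then show ?thesis by (subst ln_le_cancel_iff) auto
  qed
  also have "\<dots> \<le> 2 * real n * 1"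
    using ln_le_minus_one[of "2 :: real"] by (simp add: ln_realpow mult_left_le)
  finally show ?thesis by simp
qed simp

lemma psi_le: "psi n \<le> 4 * real n"
proof (cases "n = 0")
  case False
  have pow: "psi (2 ^ k) \<le> 2 * 2 ^ k" for k
  proof (induction k)
    case 0
    show ?case by (simp add: psi_def)
  next
    case (Suc k)
    then show ?case using psi_double_le[of "2 ^ k"] by simp
  qed
  have "\<exists>k. 2 ^ k \<le> n \<and> n < 2 ^ Suc k"
    using ex_power_ivl1[of 2 n] False by simp
  then obtain k where k: "2 ^ k \<le> n" "n < 2 ^ Suc k" by blast
  have "psi n \<le> psi (2 ^ Suc k)" using k by (intro psi_mono) simp
  also have "\<dots> \<le> 2 * 2 ^ Suc k" by (rule pow)
  also have "\<dots> \<le> 4 * real n" using k(1) by (simp add: of_nat_le_iff[symmetric] del: of_nat_le_iff)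
  finally show ?thesis .
qed simp

definition psi_err :: "nat \<Rightarrow> real" where "psi_err n = psi n - real n"

lemma abs_psi_err_le: "\<bar>psi_err n\<bar> \<le> 4 * real n"
  using psi_le[of n] psi_nonneg[of n] by (simp add: psi_err_def abs_le_iff)

text \<open>The weight is the integral of \<open>1 / t^2\<close> over [k, k+1], so the partial sums
  are truncations of Newman's integral of \<open>psi_err t / t^2\<close>, with \<open>t\<close>
  rounded down in \<open>psi_err\<close>.\<close>

abbreviation psi_step :: "nat \<Rightarrow> real" where
  "psi_step k \<equiv> psi_err k * (1 / real k - 1 / real (Suc k))"

text \<open>If \<open>psi n\<close> is at least \<open>(1 + \<epsilon>) * n\<close>, monotonicity
  keeps \<open>psi_err\<close> above \<open>\<epsilon> / 2 * n\<close> as far as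
  \<open>(1 + \<epsilon> / 2) * n\<close>, and this stretch alone contributes
  \<open>\<epsilon>^2 / 8\<close> to the series, against the Cauchy criterion. A deficit is treated
  in the same way on a stretch to the left of \<open>n\<close>.\<close>

lemma tauberian_psi:
  assumes "convergent (\<lambda>n. \<Sum>k\<in>{1..<n}. psi_step k)"
  shows "(\<lambda>n. psi n / real n) \<longlonglongrightarrow> 1"
proof (rule tendstoI)
  fix \<epsilon>' :: real assume "\<epsilon>' > 0"
  define \<epsilon> where "\<epsilon> = min \<epsilon>' 1"
  have \<epsilon>: "\<epsilon> > 0" "\<epsilon> \<le> 1" "\<epsilon> \<le> \<epsilon>'" using \<open>\<epsilon>' > 0\<close> by (auto simp: \<epsilon>_def)
  let ?S = "\<lambda>n. \<Sum>k\<in>{1..<n}. psi_step k"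
  \<comment> \<open>\<open>\<epsilon> / 2\<close> for the height of the error times
    \<open>\<epsilon> / 4\<close> for the total weight of the stretch, both relative to
    \<open>n\<close>.\<close>
  define \<eta> where "\<eta> = \<epsilon> ^ 2 / 8"
  have \<eta>: "\<eta> > 0" using \<epsilon> by (simp add: \<eta>_def)
  have "Cauchy ?S" using assms by (rule convergent_Cauchy)
  from metric_CauchyD[OF this \<eta>]
  obtain N where N: "\<And>a b. a \<ge> N \<Longrightarrow> b \<ge> N \<Longrightarrow> dist (?S a) (?S b) < \<eta>" by blast
  have diff: "\<bar>\<Sum>k\<in>{a..<b}. psi_step k\<bar> < \<eta>" if "max 1 N \<le> a" "a \<le> b" for a b
  proof -
    have "?S a + (\<Sum>k\<in>{a..<b}. psi_step k) = ?S b"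
      by (rule sum.atLeastLessThan_concat) (use that in auto)
    then show ?thesis using N[of b a] that by (simp add: dist_real_def)
  qed
  have tele: "(\<Sum>k\<in>{a..<b}. 1 / real k - 1 / real (Suc k)) = 1 / real a - 1 / real b" if "a \<le> b" for a b
    using that by (induction b rule: dec_induct) auto
  have pos: "1 / real k - 1 / real (Suc k) \<ge> 0" if "k \<ge> 1" for k
    using that by (simp add: field_simps)
  \<comment> \<open>The first summand keeps the left stretch, which starts no lower than
    \<open>n / 2\<close>, beyond \<open>N\<close>. The second gives
    \<open>\<epsilon> * n >= 4\<close>, which absorbs the rounding of its left end.\<close>
  define n0 where "n0 = 2 * max 1 N + nat \<lceil>4 / \<epsilon>\<rceil>"
  have "dist (psi n / real n) 1 < \<epsilon>" if n: "n \<ge> n0" for n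
  proof -
    have n1: "n > 0" "n \<ge> 2 * max 1 N" using n by (auto simp: n0_def)
    have n2: "real n \<ge> 4 / \<epsilon>" using n by (simp add: n0_def) linarith
    have n3: "\<epsilon> * real n \<ge> 4" using n2 \<epsilon> by (simp add: field_simps)
    have up: "psi n < (1 + \<epsilon>) * real n"
    proof (rule ccontr)
      assume c: "\<not> psi n < (1 + \<epsilon>) * real n"
      define b where "b = Suc (nat \<lfloor>(1 + \<epsilon> / 2) * real n\<rfloor>)"
      have b: "real b \<ge> (1 + \<epsilon> / 2) * real n" "real b - 1 \<le> (1 + \<epsilon> / 2) * real n"
        using \<epsilon> n1 by (auto simp: b_def) linarith+
      have nb: "n \<le> b"
      proof -
        have "real n \<le> (1 + \<epsilon> / 2) * real n" using \<epsilon> by (simp add: algebra_simps)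
        with b show ?thesis by linarith
      qed
      have "\<epsilon> / 2 * real n * (1 / real n - 1 / real b) = (\<Sum>k\<in>{n..<b}. \<epsilon> / 2 * real n * (1 / real k - 1 / real (Suc k)))"
        by (simp only: sum_distrib_left[symmetric] tele[OF nb])
      also have "\<dots> \<le> (\<Sum>k\<in>{n..<b}. psi_step k)"
      proof (intro sum_mono mult_right_mono pos)
        fix k assume k: "k \<in> {n..<b}"
        have "real k \<le> (1 + \<epsilon> / 2) * real n" using k b by simp
        moreover have "psi k \<ge> (1 + \<epsilon>) * real n" using c psi_mono[of n k] k by simp
        ultimately show "\<epsilon> / 2 * real n \<le> psi_err k" by (simp add: psi_err_def algebra_simps)
      qed (use n1 in auto)
      also have "\<dots> < \<eta>"
      proof -
        have "max 1 N \<le> n" using n1(2) by linarith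
        from diff[OF this nb] show ?thesis by (rule abs_less_iff[THEN iffD1, THEN conjunct1])
      qed
      finally have 1: "\<epsilon> / 2 * real n * (1 / real n - 1 / real b) < \<eta>" .
      have "\<epsilon> / 4 \<le> real n * (1 / real n - 1 / real b)"
      proof -
        have "real n / real b \<le> real n / ((1 + \<epsilon> / 2) * real n)"
          using b nb n1 \<epsilon> by (intro divide_left_mono mult_pos_pos) auto
        also have "\<dots> = 1 / (1 + \<epsilon> / 2)" using n1 by simp
        also have "\<dots> \<le> 1 - \<epsilon> / 4" using \<epsilon> by (simp add: field_simps)
        finally have "real n / real b \<le> 1 - \<epsilon> / 4" .
        then show ?thesis using n1 by (simp add: right_diff_distrib)
      qed
      then have "\<epsilon> / 2 * (\<epsilon> / 4) \<le> \<epsilon> / 2 * (real n * (1 / real n - 1 / real b))"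
        using \<epsilon> by (intro mult_left_mono) auto
      then show False using 1 by (simp only: \<eta>_def power2_eq_square mult.assoc)
    qed
    have lo: "psi n > (1 - \<epsilon>) * real n"
    proof (rule ccontr)
      assume c: "\<not> psi n > (1 - \<epsilon>) * real n"
      define a where "a = nat \<lceil>(1 - \<epsilon> / 2) * real n\<rceil>"
      have "(1 - \<epsilon> / 2) * real n \<ge> 0" using \<epsilon> by simp
      then have a: "real a \<ge> (1 - \<epsilon> / 2) * real n" "real a \<le> (1 - \<epsilon> / 2) * real n + 1"
        unfolding a_def by linarith+
      have "1 / 2 * real n \<le> (1 - \<epsilon> / 2) * real n" using \<epsilon> by (intro mult_right_mono) auto
      then have aN: "max 1 N \<le> a" using a n1 by linarith
      have a4: "real a \<le> (1 - \<epsilon> / 4) * real n" using a n3 by (simp add: algebra_simps)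
      have "(1 - \<epsilon> / 4) * real n \<le> 1 * real n" using \<epsilon> by (intro mult_right_mono) auto
      then have an: "a \<le> n" using a4 by simp
      have "\<epsilon> / 2 * real n * (1 / real a - 1 / real n) = (\<Sum>k\<in>{a..<n}. \<epsilon> / 2 * real n * (1 / real k - 1 / real (Suc k)))"
        by (simp only: sum_distrib_left[symmetric] tele[OF an])
      also have "\<dots> \<le> (\<Sum>k\<in>{a..<n}. - (psi_step k))"
        unfolding mult_minus_left[symmetric]
      proof (intro sum_mono mult_right_mono pos)
        fix k assume k: "k \<in> {a..<n}"
        have "real k \<ge> (1 - \<epsilon> / 2) * real n" using k a by simp
        moreover have "psi k \<le> (1 - \<epsilon>) * real n" using c psi_mono[of k n] k by simp
        ultimately show "\<epsilon> / 2 * real n \<le> - psi_err k" by (simp add: psi_err_def algebra_simps)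
      qed (use aN in auto)
      also have "\<dots> < \<eta>" using diff[OF aN an] by (simp add: sum_negf)
      finally have 1: "\<epsilon> / 2 * real n * (1 / real a - 1 / real n) < \<eta>" .
      have a0: "real a > 0" using aN by simp
      have "1 + \<epsilon> / 4 \<le> real n / real a"
      proof -
        have "(1 + \<epsilon> / 4) * real a \<le> (1 + \<epsilon> / 4) * ((1 - \<epsilon> / 4) * real n)"
          using a4 \<epsilon> by (intro mult_left_mono) auto
        also have "\<dots> \<le> real n" using \<epsilon> by (simp add: algebra_simps)
        finally show ?thesis using a0 by (simp add: field_simps)
      qed
      moreover have "real n * (1 / real a - 1 / real n) = real n / real a - 1"
        using n1 by (simp add: right_diff_distrib)
      ultimately have "\<epsilon> / 4 \<le> real n * (1 / real a - 1 / real n)" by linarith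
      then have "\<epsilon> / 2 * (\<epsilon> / 4) \<le> \<epsilon> / 2 * (real n * (1 / real a - 1 / real n))"
        using \<epsilon> by (intro mult_left_mono) auto
      then show False using 1 by (simp only: \<eta>_def power2_eq_square mult.assoc)
    qed
    have "psi n / real n < 1 + \<epsilon>" using up n1 by (simp add: pos_divide_less_eq)
    moreover have "psi n / real n > 1 - \<epsilon>" using lo n1 by (simp add: pos_less_divide_eq)
    ultimately show ?thesis by (simp add: dist_real_def abs_if)
  qed
  then show "\<forall>\<^sub>F n in sequentially. dist (psi n / real n) 1 < \<epsilon>'"
    using \<epsilon>(3) unfolding eventually_sequentially by (meson less_le_trans)
qed

section \<open>The zeta function\<close>

text \<open>\<open>x\<close> to the power \<open>- s\<close> for \<open>x > 0\<close>, through the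
  real logarithm: no branch is involved, and it is entire in \<open>s\<close>.\<close>

definition dpow :: "real \<Rightarrow> complex \<Rightarrow> complex" where
  "dpow x s = exp (- s * of_real (ln x))"

lemma dpow_1 [simp]: "dpow 1 s = 1"
  by (simp add: dpow_def)

lemma dpow_0_right [simp]: "dpow x 0 = 1"
  by (simp add: dpow_def)

lemma dpow_add: "dpow x (s + t) = dpow x s * dpow x t"
  by (simp add: dpow_def exp_add[symmetric] algebra_simps)

lemma dpow_mult: "x > 0 \<Longrightarrow> y > 0 \<Longrightarrow> dpow (x * y) s = dpow x s * dpow y s"
  by (simp add: dpow_def exp_add[symmetric] ln_mult algebra_simps)

lemma norm_dpow: "x > 0 \<Longrightarrow> norm (dpow x s) = x powr (- Re s)"
  by (simp add: dpow_def powr_def)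

lemma dpow_of_real: "x > 0 \<Longrightarrow> dpow x (of_real y) = of_real (x powr (- y))"
  by (simp add: dpow_def powr_def exp_of_real[symmetric])

lemma has_field_derivative_dpow [derivative_intros]:
  "(dpow x has_field_derivative (- of_real (ln x) * dpow x s)) (at s within A)"
  unfolding dpow_def by (auto intro!: derivative_eq_intros)

lemma holomorphic_dpow [holomorphic_intros]:
  assumes "f holomorphic_on A"
  shows "(\<lambda>z. dpow x (f z)) holomorphic_on A"
  unfolding dpow_def by (intro holomorphic_intros assms)

lemma dpow_has_vector_derivative:
  assumes "x > 0"
  shows "((\<lambda>x. dpow x s) has_vector_derivative (- s * dpow x (s + 1))) (at x within A)"
proof -
  have 1: "((\<lambda>x. - s * of_real (ln x)) has_vector_derivative (- s * of_real (1 / x))) (at x within A)"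
    using assms by (intro has_vector_derivative_mult_right has_vector_derivative_of_real)
      (auto intro!: derivative_eq_intros simp: has_real_derivative_iff_has_vector_derivative[symmetric])
  have "((exp \<circ> (\<lambda>x. - s * of_real (ln x))) has_vector_derivative (- s * of_real (1 / x)) * exp (- s * of_real (ln x))) (at x within A)"
    by (rule field_vector_diff_chain_within[OF 1]) (auto intro!: derivative_eq_intros)
  moreover have "dpow x (s + 1) = dpow x s * of_real (1 / x)"
    using assms dpow_of_real[of x 1] by (simp add: dpow_add powr_minus_divide)
  ultimately show ?thesis by (simp add: dpow_def o_def mult_ac)
qed

text \<open>A form of the mean value inequality for complex values; the increment of the majorant
  \<open>\<phi>\<close> yields bounds in closed form that can telescope.\<close>

lemma norm_diff_le_by_derivative:
  fixes f :: "real \<Rightarrow> complex" and \<phi> :: "real \<Rightarrow> real"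
  assumes "a \<le> b"
    and f: "\<And>t. t \<in> {a..b} \<Longrightarrow> (f has_vector_derivative f' t) (at t within {a..b})"
    and \<phi>: "\<And>t. t \<in> {a..b} \<Longrightarrow> (\<phi> has_vector_derivative \<phi>' t) (at t within {a..b})"
    and le: "\<And>t. t \<in> {a..b} \<Longrightarrow> norm (f' t) \<le> \<phi>' t"
  shows "norm (f b - f a) \<le> \<phi> b - \<phi> a"
proof -
  have 1: "(f' has_integral (f b - f a)) {a..b}" by (rule fundamental_theorem_of_calculus[OF assms(1) f])
  have 2: "(\<phi>' has_integral (\<phi> b - \<phi> a)) {a..b}" by (rule fundamental_theorem_of_calculus[OF assms(1) \<phi>])
  have "norm (integral {a..b} f') \<le> integral {a..b} \<phi>'"
    by (rule integral_norm_bound_integral) (use 1 2 le in auto)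
  then show ?thesis using 1 2 by (simp add: integral_unique)
qed

lemma norm_dpow_diff_le:
  assumes "0 < a" "a \<le> x" "Re s \<ge> - 1"
  shows "norm (dpow x s - dpow a s) \<le> norm s * a powr (- Re s - 1) * (x - a)"
proof -
  let ?B = "norm s * a powr (- Re s - 1)"
  have "norm (dpow x s - dpow a s) \<le> ?B * x - ?B * a"
  proof (rule norm_diff_le_by_derivative[OF assms(2)])
    fix t assume t: "t \<in> {a..x}"
    show "((\<lambda>x. dpow x s) has_vector_derivative (- s * dpow t (s + 1))) (at t within {a..x})"
      by (rule dpow_has_vector_derivative) (use t assms in auto)
    show "((\<lambda>x. ?B * x) has_vector_derivative ?B) (at t within {a..x})"
      by (auto intro!: derivative_eq_intros simp: has_real_derivative_iff_has_vector_derivative[symmetric])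
    have "t powr (- Re s - 1) \<le> a powr (- Re s - 1)"
      by (rule powr_mono2') (use t assms in auto)
    then show "norm (- s * dpow t (s + 1)) \<le> ?B"
      using t assms by (simp add: norm_mult norm_dpow mult_left_mono)
  qed
  then show ?thesis by (simp add: right_diff_distrib)
qed

text \<open>The \<open>n\<close>-th term of \<open>(s - 1) \<zeta>(s) - 1\<close>, after subtracting the telescoping series of \<open>n\<^bsup>1-s\<^esup> - (n+1)\<^bsup>1-s\<^esup>\<close>.\<close>

definition zeta_term :: "nat \<Rightarrow> complex \<Rightarrow> complex" where
  "zeta_term n s = (s - 1) * dpow n s - dpow n (s - 1) + dpow (n + 1) (s - 1)"

text \<open>The term is the increment over [n, n+1] of a function whose derivative is, up to sign,
  \<open>s - 1\<close> times \<open>dpow t s - dpow n s\<close>. Estimating this difference once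
  more gains a power of \<open>n\<close>, so that the series converges as far as
  \<open>Re s > 0\<close>.\<close>

lemma norm_zeta_term_le:
  assumes "n > 0" "Re s \<ge> 0"
  shows "norm (zeta_term n s) \<le> norm (s - 1) * norm s * real n powr (- Re s - 1)"
proof -
  let ?B = "norm (s - 1) * norm s * real n powr (- Re s - 1)"
  define f where "f x = dpow x (s - 1) + of_real (x - n) * ((s - 1) * dpow n s)" for x
  have "norm (f (real n + 1) - f (real n)) \<le> ?B * (real n + 1) - ?B * real n"
  proof (rule norm_diff_le_by_derivative)
    fix t assume t: "t \<in> {real n..real n + 1}"
    show "(f has_vector_derivative (- (s - 1) * dpow t (s - 1 + 1) + ((s - 1) * dpow n s))) (at t within {real n..real n + 1})"
      unfolding f_def
    proof (intro has_vector_derivative_add dpow_has_vector_derivative)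
      show "((\<lambda>x. of_real (x - n) * ((s - 1) * dpow n s)) has_vector_derivative (s - 1) * dpow n s) (at t within {real n..real n + 1})"
        using has_vector_derivative_mult_left[OF has_vector_derivative_of_real, of "\<lambda>x. x - n" 1 "at t within {real n..real n + 1}" "(s - 1) * dpow n s"]
        by (auto intro!: derivative_eq_intros)
    qed (use t assms in auto)
    show "((\<lambda>x. ?B * x) has_vector_derivative ?B) (at t within {real n..real n + 1})"
      by (auto intro!: derivative_eq_intros simp: has_real_derivative_iff_has_vector_derivative[symmetric])
    have "norm (dpow t s - dpow n s) \<le> norm s * real n powr (- Re s - 1) * (t - n)"
      by (rule norm_dpow_diff_le) (use t assms in auto)
    also have "\<dots> \<le> norm s * real n powr (- Re s - 1) * 1"
      by (rule mult_left_mono) (use t in auto)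
    finally have "norm (s - 1) * norm (dpow t s - dpow n s) \<le> norm (s - 1) * (norm s * real n powr (- Re s - 1))"
      by (intro mult_left_mono) auto
    moreover have "- (s - 1) * dpow t (s - 1 + 1) + (s - 1) * dpow n s = - ((s - 1) * (dpow t s - dpow n s))"
      by (simp add: algebra_simps)
    ultimately show "norm (- (s - 1) * dpow t (s - 1 + 1) + (s - 1) * dpow n s) \<le> ?B"
      by (simp only: norm_minus_cancel norm_mult mult.assoc)
  qed simp
  moreover have "f (real n + 1) - f (real n) = zeta_term n s" by (simp add: f_def zeta_term_def add.commute)
  ultimately show ?thesis by (simp add: algebra_simps)
qed

lemma summable_Suc_powr: "a < -1 \<Longrightarrow> summable (\<lambda>n. real (Suc n) powr a)"
  using summable_Suc_iff[of "\<lambda>n. real n powr a"] by (simp add: summable_real_powr_iff)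

lemma zeta_terms_holomorphic:
  "\<exists>g. \<forall>s\<in>{s. Re s > 0}. (\<lambda>n. zeta_term (Suc n) s) sums g s \<and> g field_differentiable (at s)"
proof -
  have op: "open {s. Re s > 0}" by (rule open_halfspace_Re_gt)
  have "\<exists>g g'. \<forall>s\<in>{s. Re s > 0}. (\<lambda>n. zeta_term (Suc n) s) sums g s \<and> (\<lambda>n. deriv (zeta_term (Suc n)) s) sums g' s \<and> (g has_field_derivative g' s) (at s)"
  proof (rule series_and_derivative_comparison_local[OF op])
    fix n s
    have "zeta_term (Suc n) holomorphic_on UNIV"
      unfolding zeta_term_def by (intro holomorphic_intros)
    then show "(zeta_term (Suc n) has_field_derivative deriv (zeta_term (Suc n)) s) (at s)"
      by (simp add: holomorphic_derivI)
  next
    fix s assume s: "s \<in> {s. Re s > 0}"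
    define \<epsilon> where "\<epsilon> = Re s / 2"
    define M where "M = norm s + \<epsilon>"
    have \<epsilon>: "\<epsilon> > 0" using s by (simp add: \<epsilon>_def)
    have "norm (zeta_term (Suc n) y) \<le> (M + 1) * M * real (Suc n) powr (- \<epsilon> - 1)" if y: "y \<in> ball s \<epsilon> \<inter> {s. Re s > 0}" for n y
    proof -
      have "norm (y - s) < \<epsilon>" using y by (simp add: dist_norm norm_minus_commute)
      moreover have "\<bar>Re (y - s)\<bar> \<le> norm (y - s)" by (rule abs_Re_le_cmod)
      ultimately have 1: "Re y \<ge> \<epsilon>" by (simp add: \<epsilon>_def abs_le_iff)
      have 2: "norm y \<le> M"
        using norm_triangle_ineq[of s "y - s"] \<open>norm (y - s) < \<epsilon>\<close> by (simp add: M_def)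
      have 3: "norm (y - 1) \<le> M + 1" using norm_triangle_ineq4[of y 1] 2 by simp
      have "norm (zeta_term (Suc n) y) \<le> norm (y - 1) * norm y * real (Suc n) powr (- Re y - 1)"
        by (rule norm_zeta_term_le) (use 1 \<epsilon> in auto)
      also have "\<dots> \<le> (M + 1) * M * real (Suc n) powr (- \<epsilon> - 1)"
        using 1 2 3 norm_ge_zero[of y] by (intro mult_mono powr_mono mult_nonneg_nonneg) (auto simp del: norm_ge_zero)
      finally show ?thesis .
    qed
    moreover have "summable (\<lambda>n. (M + 1) * M * real (Suc n) powr (- \<epsilon> - 1))"
      by (intro summable_mult summable_Suc_powr) (use \<epsilon> in auto)
    ultimately show "\<exists>d h. 0 < d \<and> summable h \<and> (\<forall>\<^sub>F n in sequentially. \<forall>y\<in>ball s d \<inter> {s. Re s > 0}. norm (zeta_term (Suc n) y) \<le> h n)"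
      using \<epsilon> by (intro exI[of _ \<epsilon>] exI[of _ "\<lambda>n. (M + 1) * M * real (Suc n) powr (- \<epsilon> - 1)"]) auto
  qed
  then show ?thesis unfolding field_differentiable_def by blast
qed

text \<open>The 1 is the sum of the telescoping series that was subtracted. Multiplying zeta by
  \<open>s - 1\<close> makes \<open>s = 1\<close> a regular point, with value 1.\<close>

definition zeta_reg :: "complex \<Rightarrow> complex" where
  "zeta_reg s = 1 + (\<Sum>n. zeta_term (Suc n) s)"

lemma zeta_reg_sums: "Re s > 0 \<Longrightarrow> (\<lambda>n. zeta_term (Suc n) s) sums (zeta_reg s - 1)"
  using zeta_terms_holomorphic by (auto simp: zeta_reg_def sums_iff)

lemma zeta_reg_holomorphic: "zeta_reg holomorphic_on {s. Re s > 0}"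
proof -
  obtain g where g: "\<And>s. Re s > 0 \<Longrightarrow> (\<lambda>n. zeta_term (Suc n) s) sums g s" "\<And>s. Re s > 0 \<Longrightarrow> g field_differentiable (at s)"
    using zeta_terms_holomorphic by auto
  have "(\<lambda>s. 1 + g s) holomorphic_on {s. Re s > 0}"
  proof -
    have "g holomorphic_on {s. Re s > 0}"
      unfolding holomorphic_on_def by (auto intro: field_differentiable_at_within g(2))
    then show ?thesis by (intro holomorphic_intros)
  qed
  then show ?thesis
    by (rule holomorphic_transform) (use g(1) in \<open>auto simp: zeta_reg_def sums_iff\<close>)
qed

lemma zeta_reg_1: "zeta_reg 1 = 1"
proof -
  have "zeta_term (Suc n) 1 = 0" for n by (simp add: zeta_term_def)
  then show ?thesis by (simp add: zeta_reg_def)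
qed

section \<open>Dirichlet series\<close>

text \<open>The coefficient at \<open>0\<close> is discarded: \<open>ln 0 = 0\<close> would make \<open>dpow 0 s = 1\<close>.\<close>

definition dterm :: "(nat \<Rightarrow> real) \<Rightarrow> complex \<Rightarrow> nat \<Rightarrow> complex" where
  "dterm a s n = (if n = 0 then 0 else of_real (a n) * dpow n s)"

lemma norm_dterm: "n > 0 \<Longrightarrow> norm (dterm a s n) = \<bar>a n\<bar> * real n powr (- Re s)"
  by (simp add: dterm_def norm_mult norm_dpow)

lemma summable_norm_dterm:
  assumes a: "\<And>n. n > 0 \<Longrightarrow> \<bar>a n\<bar> \<le> ln (real n) + 1" and s: "Re s > 1"
  shows "summable (\<lambda>n. norm (dterm a s n))"
proof -
  define \<epsilon> where "\<epsilon> = (Re s - 1) / 2"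
  have \<epsilon>: "\<epsilon> > 0" using s by (simp add: \<epsilon>_def)
  have "summable (\<lambda>n. (1 / \<epsilon> + 1) * real n powr (- 1 - \<epsilon>))"
    by (intro summable_mult) (use \<epsilon> in \<open>simp add: summable_real_powr_iff\<close>)
  then show ?thesis
  proof (rule summable_comparison_test_ev[rotated])
    show "\<forall>\<^sub>F n in sequentially. norm (norm (dterm a s n)) \<le> (1 / \<epsilon> + 1) * real n powr (- 1 - \<epsilon>)"
      using eventually_gt_at_top[of 0]
    proof eventually_elim
      case (elim n)
      have "ln (real n) \<le> real n powr \<epsilon> / \<epsilon>" by (rule ln_powr_bound) (use elim \<epsilon> in auto)
      moreover have "1 \<le> real n powr \<epsilon>" using elim \<epsilon> by (intro ge_one_powr_ge_zero) auto
      ultimately have "\<bar>a n\<bar> \<le> (1 / \<epsilon> + 1) * real n powr \<epsilon>" using a[OF elim] by (simp add: algebra_simps)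
      then have "\<bar>a n\<bar> * real n powr (- Re s) \<le> (1 / \<epsilon> + 1) * real n powr \<epsilon> * real n powr (- Re s)"
        by (rule mult_right_mono) simp
      also have "\<dots> = (1 / \<epsilon> + 1) * real n powr (- 1 - \<epsilon>)"
        using elim by (simp add: mult.assoc powr_add[symmetric]) (simp add: \<epsilon>_def field_simps)
      finally show ?case using elim by (simp add: norm_dterm)
    qed
  qed
qed

text \<open>Absolute convergence over pairs of positive indices allows regrouping by their product.
  Index 0 stays outside because every number divides 0.\<close>

lemma dirichlet_product_sums:
  fixes F G :: "nat \<Rightarrow> complex"
  assumes F: "summable (\<lambda>n. norm (F n))" "F 0 = 0" and G: "summable (\<lambda>n. norm (G n))" "G 0 = 0"
  shows "(\<lambda>n. \<Sum>d | d dvd n. F d * G (n div d)) sums (suminf F * suminf G)"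
proof -
  let ?A = "{0<..} :: nat set"
  have hs: "(H has_sum suminf H) ?A" and as: "(\<lambda>n. norm (H n)) summable_on ?A"
    if H: "summable (\<lambda>n. norm (H n))" "H 0 = 0" for H :: "nat \<Rightarrow> complex"
  proof -
    have "(H has_sum suminf H) UNIV"
      by (rule norm_summable_imp_has_sum[OF H(1) summable_sums[OF summable_norm_cancel[OF H(1)]]])
    then show "(H has_sum suminf H) ?A"
      by (rule has_sum_cong_neutral[THEN iffD1, rotated -1]) (use H(2) in \<open>auto intro: Nat.gr0I\<close>)
    have "(\<lambda>n. norm (H n)) summable_on UNIV"
      by (rule norm_summable_imp_summable_on) (use H(1) in simp)
    then show "(\<lambda>n. norm (H n)) summable_on ?A" by (rule summable_on_subset_banach) simp
  qed
  have "((\<lambda>(a, b). F a * G b) has_sum (suminf F * suminf G)) (Sigma ?A (\<lambda>_. ?A))"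
  proof (rule has_sum_SigmaI)
    show "((\<lambda>b. case (a, b) of (a, b) \<Rightarrow> F a * G b) has_sum (F a * suminf G)) ?A" for a
      using has_sum_cmult_right[OF hs[OF G]] by simp
    show "((\<lambda>a. F a * suminf G) has_sum (suminf F * suminf G)) ?A"
      by (rule has_sum_cmult_left[OF hs[OF F]])
    have "(\<lambda>x. norm (case x of (a, b) \<Rightarrow> F a * G b)) summable_on (Sigma ?A (\<lambda>_. ?A))"
      unfolding Infinite_Sum.abs_summable_on_Sigma_iff
    proof (intro conjI ballI)
      show "(\<lambda>y. norm (case (x, y) of (a, b) \<Rightarrow> F a * G b)) summable_on ?A" for x
        using summable_on_cmult_right[OF as[OF G]] by (simp add: norm_mult)
      have "(\<lambda>x. norm (norm (F x) * infsum (\<lambda>y. norm (G y)) ?A)) summable_on ?A"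
        using summable_on_cmult_left[OF as[OF F]] by (simp add: norm_mult infsum_nonneg)
      then show "(\<lambda>x. norm (infsum (\<lambda>y. norm (case (x, y) of (a, b) \<Rightarrow> F a * G b)) ?A)) summable_on ?A"
        by (simp add: norm_mult infsum_cmult_right')
    qed
    then show "(\<lambda>(a, b). F a * G b) summable_on (Sigma ?A (\<lambda>_. ?A))" by (rule Infinite_Sum.abs_summable_summable)
  qed
  also have "?this \<longleftrightarrow> ((\<lambda>(n, d). F d * G (n div d)) has_sum (suminf F * suminf G)) (Sigma ?A (\<lambda>n. {d. d dvd n}))"
    by (rule has_sum_reindex_bij_witness[of _ "\<lambda>(n, d). (d, n div d)" "\<lambda>(a, b). (a * b, a)"])
       (auto intro: Nat.gr0I dvd_pos_nat div_pos_of_dvd)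
  finally have "((\<lambda>n. \<Sum>d | d dvd n. F d * G (n div d)) has_sum (suminf F * suminf G)) ?A"
    by (rule has_sum_SigmaD) (auto intro!: has_sum_finiteI)
  \<comment> \<open>At \<open>n = 0\<close> the inner sum ranges over an infinite set and is
    therefore 0.\<close>
  then have "((\<lambda>n. \<Sum>d | d dvd n. F d * G (n div d)) has_sum (suminf F * suminf G)) UNIV"
    by (rule has_sum_cong_neutral[THEN iffD1, rotated -1]) auto
  then show ?thesis by (rule has_sum_imp_sums)
qed

lemma dterm_convolution:
  assumes "n > 0"
  shows "(\<Sum>d | d dvd n. dterm a s d * dterm b s (n div d)) = dterm (\<lambda>n. \<Sum>d | d dvd n. a d * b (n div d)) s n"
proof -
  have "dterm a s d * dterm b s (n div d) = of_real (a d * b (n div d)) * dpow n s" if "d dvd n" for d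
  proof -
    have d: "d > 0" "n div d > 0" using that assms div_pos_of_dvd[OF that] dvd_pos_nat[of n d] by auto
    have "dpow n s = dpow (real d * real (n div d)) s" using that by (metis dvd_mult_div_cancel of_nat_mult)
    also have "\<dots> = dpow d s * dpow (n div d) s" using d by (intro dpow_mult) auto
    finally show ?thesis using d by (simp add: dterm_def)
  qed
  then have "(\<Sum>d | d dvd n. dterm a s d * dterm b s (n div d)) = (\<Sum>d | d dvd n. of_real (a d * b (n div d)) * dpow n s)"
    by (intro sum.cong) auto
  also have "\<dots> = dterm (\<lambda>n. \<Sum>d | d dvd n. a d * b (n div d)) s n"
    using assms by (simp add: dterm_def sum_distrib_right)
  finally show ?thesis .
qed

definition zeta :: "complex \<Rightarrow> complex" where "zeta s = suminf (dterm (\<lambda>_. 1) s)"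

definition mangoldt_series :: "complex \<Rightarrow> complex" where "mangoldt_series s = suminf (dterm mangoldt s)"

lemma summable_norm_dterm_1: "Re s > 1 \<Longrightarrow> summable (\<lambda>n. norm (dterm (\<lambda>_. 1) s n))"
  by (rule summable_norm_dterm) auto

lemma summable_norm_dterm_mangoldt: "Re s > 1 \<Longrightarrow> summable (\<lambda>n. norm (dterm mangoldt s n))"
  by (rule summable_norm_dterm) (use mangoldt_le_ln mangoldt_nonneg in \<open>auto simp: add_increasing2\<close>)

lemma dterm_sums: "summable (\<lambda>n. norm (dterm a s n)) \<Longrightarrow> dterm a s sums suminf (dterm a s)"
  by (rule summable_sums[OF summable_norm_cancel])

lemma zeta_sums: "Re s > 1 \<Longrightarrow> dterm (\<lambda>_. 1) s sums zeta s"
  unfolding zeta_def by (intro dterm_sums summable_norm_dterm_1)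

lemma mangoldt_series_sums: "Re s > 1 \<Longrightarrow> dterm mangoldt s sums mangoldt_series s"
  unfolding mangoldt_series_def by (intro dterm_sums summable_norm_dterm_mangoldt)

lemma dpow_tendsto_0:
  assumes "Re s > 0"
  shows "(\<lambda>n. dpow (real (Suc n)) s) \<longlonglongrightarrow> 0"
proof -
  have "((\<lambda>x. x powr (- Re s)) \<longlongrightarrow> 0) at_top"
    using assms by (intro tendsto_neg_powr filterlim_ident) auto
  then have "(\<lambda>n. real (Suc n) powr (- Re s)) \<longlonglongrightarrow> 0"
    by (rule filterlim_compose) (intro filterlim_compose[OF filterlim_real_sequentially filterlim_Suc])
  then have "(\<lambda>n. norm (dpow (real (Suc n)) s)) \<longlonglongrightarrow> 0"
    by (simp add: norm_dpow)
  then show ?thesis by (rule tendsto_norm_zero_cancel)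
qed

lemma zeta_reg_eq:
  assumes "Re s > 1"
  shows "zeta_reg s = (s - 1) * zeta s"
proof -
  have "(\<lambda>n. dterm (\<lambda>_. 1) s (Suc n)) sums zeta s"
    using zeta_sums[OF assms] by (subst sums_Suc_iff) (simp add: dterm_def)
  then have 1: "(\<lambda>n. (s - 1) * dpow (real (Suc n)) s) sums ((s - 1) * zeta s)"
    by (intro sums_mult) (simp add: dterm_def)
  have "(\<lambda>n. dpow (real (Suc (Suc n))) (s - 1) - dpow (real (Suc n)) (s - 1)) sums (0 - dpow (real (Suc 0)) (s - 1))"
    by (rule telescope_sums) (use assms in \<open>intro dpow_tendsto_0, simp\<close>)
  from sums_add[OF 1 this]
  have "(\<lambda>n. zeta_term (Suc n) s) sums ((s - 1) * zeta s - 1)"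
    by (simp add: zeta_term_def algebra_simps)
  then have "zeta_reg s - 1 = (s - 1) * zeta s - 1"
    using zeta_reg_sums[of s] assms by (intro sums_unique2) auto
  then show ?thesis by simp
qed

lemma zeta_deriv:
  assumes "Re s > 1"
  shows "(zeta has_field_derivative - suminf (dterm (\<lambda>n. ln (real n)) s)) (at s)"
proof -
  let ?S = "{s. Re s > 1}"
  have op: "open ?S" by (rule open_halfspace_Re_gt)
  have "\<exists>g g'. \<forall>s\<in>?S. (\<lambda>n. dterm (\<lambda>_. 1) s n) sums g s \<and> (\<lambda>n. - dterm (\<lambda>n. ln (real n)) s n) sums g' s \<and> (g has_field_derivative g' s) (at s)"
  proof (rule series_and_derivative_comparison_local[OF op])
    fix n s
    show "((\<lambda>s. dterm (\<lambda>_. 1) s n) has_field_derivative - dterm (\<lambda>n. ln (real n)) s n) (at s)"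
      by (cases "n = 0") (auto simp: dterm_def intro!: derivative_eq_intros)
  next
    fix s assume s: "s \<in> ?S"
    define \<epsilon> where "\<epsilon> = (Re s - 1) / 2"
    have \<epsilon>: "\<epsilon> > 0" using s by (simp add: \<epsilon>_def)
    have "norm (dterm (\<lambda>_. 1) y n) \<le> norm (dterm (\<lambda>_. 1) (of_real (1 + \<epsilon>)) n)" if y: "y \<in> ball s \<epsilon> \<inter> ?S" for n y
    proof (cases "n = 0")
      case False
      have "norm (y - s) < \<epsilon>" using y by (simp add: dist_norm norm_minus_commute)
      moreover have "\<bar>Re (y - s)\<bar> \<le> norm (y - s)" by (rule abs_Re_le_cmod)
      ultimately have 1: "Re y \<ge> 1 + \<epsilon>" unfolding \<epsilon>_def by (simp add: abs_le_iff field_simps)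
      then show ?thesis using False by (simp add: norm_dterm powr_mono)
    qed (simp add: dterm_def)
    moreover have "summable (\<lambda>n. norm (dterm (\<lambda>_. 1) (of_real (1 + \<epsilon>)) n))"
      by (rule summable_norm_dterm_1) (use \<epsilon> in simp)
    ultimately show "\<exists>d h. 0 < d \<and> summable h \<and> (\<forall>\<^sub>F n in sequentially. \<forall>y\<in>ball s d \<inter> ?S. norm (dterm (\<lambda>_. 1) y n) \<le> h n)"
      using \<epsilon> by (intro exI[of _ \<epsilon>] exI[of _ "\<lambda>n. norm (dterm (\<lambda>_. 1) (of_real (1 + \<epsilon>)) n)"]) auto
  qed
  then obtain g g' where g: "\<And>s. Re s > 1 \<Longrightarrow> dterm (\<lambda>_. 1) s sums g s"
    "\<And>s. Re s > 1 \<Longrightarrow> (\<lambda>n. - dterm (\<lambda>n. ln (real n)) s n) sums g' s" "\<And>s. Re s > 1 \<Longrightarrow> (g has_field_derivative g' s) (at s)"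
    by auto
  have "g z = zeta z" if "Re z > 1" for z using g(1)[OF that] zeta_sums[OF that] by (rule sums_unique2)
  moreover have "(\<lambda>n. - (- dterm (\<lambda>n. ln (real n)) s n)) sums - g' s"
    by (rule sums_minus[OF g(2)[OF assms]])
  then have "g' s = - suminf (dterm (\<lambda>n. ln (real n)) s)" by (simp add: sums_iff)
  ultimately show ?thesis
    using has_field_derivative_transform_within_open[OF g(3)[OF assms] op, of zeta] assms by simp
qed

lemma dterm_product:
  assumes "summable (\<lambda>n. norm (dterm a s n))" "summable (\<lambda>n. norm (dterm b s n))"
  shows "dterm (\<lambda>n. \<Sum>d | d dvd n. a d * b (n div d)) s sums (suminf (dterm a s) * suminf (dterm b s))"
proof -
  have "(\<lambda>n. \<Sum>d | d dvd n. dterm a s d * dterm b s (n div d)) sums (suminf (dterm a s) * suminf (dterm b s))"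
    by (rule dirichlet_product_sums) (use assms in \<open>auto simp: dterm_def\<close>)
  also have "(\<lambda>n. \<Sum>d | d dvd n. dterm a s d * dterm b s (n div d)) = dterm (\<lambda>n. \<Sum>d | d dvd n. a d * b (n div d)) s"
  proof
    fix n show "(\<Sum>d | d dvd n. dterm a s d * dterm b s (n div d)) = dterm (\<lambda>n. \<Sum>d | d dvd n. a d * b (n div d)) s n"
      by (cases "n = 0") (auto simp: dterm_convolution dterm_def[of _ _ 0])
  qed
  finally show ?thesis .
qed

lemma dterm_cong: "(\<And>n. n > 0 \<Longrightarrow> a n = b n) \<Longrightarrow> dterm a s = dterm b s"
  by (auto simp: dterm_def fun_eq_iff)

lemma zeta_mangoldt_series:
  assumes "Re s > 1"
  shows "mangoldt_series s * zeta s = suminf (dterm (\<lambda>n. ln (real n)) s)"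
proof -
  have "dterm (\<lambda>n. \<Sum>d | d dvd n. mangoldt d * 1) s sums (mangoldt_series s * zeta s)"
    unfolding mangoldt_series_def zeta_def
    by (rule dterm_product) (use assms in \<open>auto intro: summable_norm_dterm_1 summable_norm_dterm_mangoldt\<close>)
  also have "dterm (\<lambda>n. \<Sum>d | d dvd n. mangoldt d * 1) s = dterm (\<lambda>n. ln (real n)) s"
    by (rule dterm_cong) (simp add: mangoldt_sum)
  finally show ?thesis by (simp add: sums_iff)
qed

text \<open>The Dirichlet series of \<open>mobius\<close> is a multiplicative inverse.\<close>

lemma zeta_nonzero:
  assumes "Re s > 1"
  shows "zeta s \<noteq> 0"
proof -
  have "summable (\<lambda>n. norm (dterm mobius s n))"
    by (rule summable_norm_dterm) (use assms in \<open>auto intro: order_trans[OF abs_mobius_le]\<close>)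
  then have "dterm (\<lambda>n. \<Sum>d | d dvd n. mobius d * 1) s sums (suminf (dterm mobius s) * zeta s)"
    unfolding zeta_def by (rule dterm_product) (use assms in \<open>auto intro: summable_norm_dterm_1\<close>)
  also have "dterm (\<lambda>n. \<Sum>d | d dvd n. mobius d * 1) s = (\<lambda>n. if n = 1 then 1 else 0)"
  proof
    fix n show "dterm (\<lambda>n. \<Sum>d | d dvd n. mobius d * 1) s n = (if n = 1 then 1 else 0)"
      by (cases "n = 0") (auto simp: dterm_def sum_mobius_divisors)
  qed
  finally have "suminf (dterm mobius s) * zeta s = 1"
    using sums_single[of 1 "\<lambda>_. 1 :: complex"] by (metis (no_types, lifting) sums_unique2)
  then show ?thesis by auto
qed

lemma zeta_reg_nonzero_gt:
  assumes "Re s > 1"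
  shows "zeta_reg s \<noteq> 0"
  using zeta_nonzero[OF assms] zeta_reg_eq[OF assms] assms by auto

text \<open>Logarithmic derivative of \<open>(s - 1) * zeta s\<close>. The pole at 1 is isolated
  with residue 1; any other singularity of the right-hand side is a zero of
  \<open>zeta_reg\<close>.\<close>

lemma mangoldt_series_eq:
  assumes "Re s > 1"
  shows "mangoldt_series s = 1 / (s - 1) - deriv zeta_reg s / zeta_reg s"
proof -
  have s1: "s - 1 \<noteq> 0" using assms by auto
  have "((\<lambda>s. (s - 1) * zeta s) has_field_derivative (zeta s + (s - 1) * (- (mangoldt_series s * zeta s)))) (at s)"
    unfolding zeta_mangoldt_series[OF assms]
    by (rule derivative_eq_intros zeta_deriv[OF assms] refl)+ simp
  then have "(zeta_reg has_field_derivative (zeta s + (s - 1) * (- (mangoldt_series s * zeta s)))) (at s)"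
    by (rule has_field_derivative_transform_within_open[where S = "{s. Re s > 1}"])
       (use assms zeta_reg_eq in \<open>auto intro: open_halfspace_Re_gt\<close>)
  then have "deriv zeta_reg s = zeta s + (s - 1) * (- (mangoldt_series s * zeta s))" by (rule DERIV_imp_deriv)
  moreover have "(zeta s + (s - 1) * (- (mangoldt_series s * zeta s))) / ((s - 1) * zeta s) = 1 / (s - 1) - mangoldt_series s"
    unfolding add_divide_distrib using s1 zeta_nonzero[OF assms] by simp
  ultimately show ?thesis unfolding zeta_reg_eq[OF assms] by simp
qed

section \<open>Nonvanishing on the line of real part 1\<close>

text \<open>\<open>m\<close> is the order of vanishing at \<open>s0\<close>: if
  \<open>zeta_reg w = (w - s0)^m * g w\<close>, the quotient is \<open>m / \<delta>\<close> plus a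
  bounded term. The approach is from the right, where for \<open>Re s0 = 1\<close> the Dirichlet
  series is available.\<close>

lemma log_deriv_order:
  assumes "Re s0 > 0"
  shows "\<exists>m::nat. (m > 0 \<longleftrightarrow> zeta_reg s0 = 0) \<and>
    ((\<lambda>\<delta>::real. of_real \<delta> * (deriv zeta_reg (s0 + of_real \<delta>) / zeta_reg (s0 + of_real \<delta>))) \<longlongrightarrow> of_nat m) (at_right 0)"
proof -
  let ?G = "\<lambda>(g :: complex \<Rightarrow> complex) (\<delta> :: real). deriv g (s0 + of_real \<delta>) / g (s0 + of_real \<delta>)"
  let ?D = "?G zeta_reg"
  let ?S = "{s. Re s > 0}"
  have op: "open ?S" by (rule open_halfspace_Re_gt)
  have con: "connected ?S" by (intro convex_connected convex_halfspace_Re_gt)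
  have lim0: "((\<lambda>\<delta>::real. s0 + of_real \<delta>) \<longlongrightarrow> s0) (at_right 0)"
    by (rule tendsto_eq_intros refl | simp)+
  have d0: "((\<lambda>\<delta>::real. of_real \<delta> :: complex) \<longlongrightarrow> 0) (at_right 0)"
    by (rule tendsto_eq_intros refl | simp)+
  show ?thesis
  proof (cases "zeta_reg s0 = 0")
    case False
    have "(\<lambda>s. deriv zeta_reg s) holomorphic_on ?S"
      by (intro holomorphic_deriv zeta_reg_holomorphic op)
    then have c1: "isCont (deriv zeta_reg) s0"
      using assms op by (metis holomorphic_on_imp_continuous_on continuous_on_eq_continuous_at mem_Collect_eq)
    have c2: "isCont zeta_reg s0"
      using assms op zeta_reg_holomorphic by (metis holomorphic_on_imp_continuous_on continuous_on_eq_continuous_at mem_Collect_eq)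
    have "((\<lambda>\<delta>::real. of_real \<delta> * ?D \<delta>) \<longlongrightarrow> 0 * (deriv zeta_reg s0 / zeta_reg s0)) (at_right 0)"
      by (intro tendsto_mult d0 tendsto_divide isCont_tendsto_compose[OF c1] isCont_tendsto_compose[OF c2] lim0 False)
    then show ?thesis using False by (intro exI[of _ 0]) simp
  next
    case True
    \<comment> \<open>The order is finite because \<open>zeta_reg\<close> vanishes at
      \<open>s0\<close> but equals 1 at 1.\<close>
    have nc: "\<not> zeta_reg constant_on ?S"
    proof
      assume "zeta_reg constant_on ?S"
      then obtain c where "\<And>s. Re s > 0 \<Longrightarrow> zeta_reg s = c" by (auto simp: constant_on_def)
      from this[of 1] this[of s0] assms True zeta_reg_1 show False by simp
    qed
    have "s0 \<in> ?S" using assms by simp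
    from holomorphic_factor_zero_nonconstant[OF zeta_reg_holomorphic op con this True nc]
    obtain g r m where m: "0 < m" "0 < r" "ball s0 r \<subseteq> ?S" "g holomorphic_on ball s0 r"
      "\<And>w. w \<in> ball s0 r \<Longrightarrow> zeta_reg w = (w - s0) ^ m * g w" "\<And>w. w \<in> ball s0 r \<Longrightarrow> g w \<noteq> 0" by metis
    have s0: "s0 \<in> ball s0 r" using m by simp
    have "(\<lambda>s. deriv g s) holomorphic_on ball s0 r" by (intro holomorphic_deriv m) simp
    then have c1: "isCont (deriv g) s0"
      using s0 by (metis holomorphic_on_imp_continuous_on continuous_on_eq_continuous_at open_ball)
    have c2: "isCont g s0"
      using s0 m(4) by (metis holomorphic_on_imp_continuous_on continuous_on_eq_continuous_at open_ball)
    have lim: "((\<lambda>\<delta>::real. of_nat m + of_real \<delta> * ?G g \<delta>) \<longlongrightarrow> of_nat m + 0 * (deriv g s0 / g s0)) (at_right 0)"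
      by (intro tendsto_intros tendsto_mult d0 tendsto_divide isCont_tendsto_compose[OF c1] isCont_tendsto_compose[OF c2] lim0 m(6) s0)
    have ev: "\<forall>\<^sub>F \<delta> in at_right (0::real). of_nat m + of_real \<delta> * ?G g \<delta>
      = of_real \<delta> * ?D \<delta>"
      unfolding eventually_at_right_field
    proof (intro exI[of _ r] conjI allI impI)
      fix \<delta> :: real assume d: "0 < \<delta>" "\<delta> < r"
      let ?w = "s0 + of_real \<delta>"
      have w: "?w \<in> ball s0 r" using d by (simp add: dist_norm)
      have "(g has_field_derivative deriv g ?w) (at ?w)"
        using m(4) w by (intro holomorphic_derivI[of g "ball s0 r"]) auto
      then have "((\<lambda>w. (w - s0) ^ m * g w) has_field_derivative (of_nat m * (?w - s0) ^ (m - 1) * g ?w + (?w - s0) ^ m * deriv g ?w)) (at ?w)"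
        by (auto intro!: derivative_eq_intros)
      then have "(zeta_reg has_field_derivative (of_nat m * (?w - s0) ^ (m - 1) * g ?w + (?w - s0) ^ m * deriv g ?w)) (at ?w)"
        by (rule has_field_derivative_transform_within_open[where S = "ball s0 r"]) (use w m(5) in auto)
      then have "deriv zeta_reg ?w = of_nat m * of_real \<delta> ^ (m - 1) * g ?w + of_real \<delta> ^ m * deriv g ?w"
        using DERIV_imp_deriv by fastforce
      moreover have "of_real \<delta> ^ m = (of_real \<delta> * of_real \<delta> ^ (m - 1) :: complex)"
        using m(1) by (simp add: power_eq_if)
      moreover have "zeta_reg ?w = of_real \<delta> ^ m * g ?w" using m(5)[OF w] by simp
      ultimately show "of_nat m + of_real \<delta> * (deriv g ?w / g ?w) = of_real \<delta> * (deriv zeta_reg ?w / zeta_reg ?w)"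
        using m(6)[OF w] d by (simp add: divide_simps) (simp add: algebra_simps)
    qed (use m in auto)
    show ?thesis
      by (rule exI[of _ m]) (use Lim_transform_eventually[OF lim ev] m(1) True in simp)
  qed
qed

lemma Re_dterm_mangoldt:
  "Re (dterm mangoldt (Complex \<sigma> t) n) = (if n = 0 then 0 else mangoldt n * real n powr (- \<sigma>) * cos (t * ln (real n)))"
proof (cases "n = 0")
  case False
  have "dpow (real n) (Complex \<sigma> t) = of_real (real n powr (- \<sigma>)) * cis (- (t * ln (real n)))"
    using False by (simp add: dpow_def exp_eq_polar powr_def mult.commute)
  then show ?thesis using False by (simp add: dterm_def del: of_real_mangoldt)
qed (simp add: dterm_def)

lemma three_four_one: "3 + 4 * cos \<theta> + cos (2 * \<theta>) \<ge> (0::real)"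
proof -
  have "3 + 4 * cos \<theta> + cos (2 * \<theta>) = 2 * (1 + cos \<theta>) ^ 2"
    unfolding cos_double_cos by (simp add: power2_eq_square algebra_simps)
  then show ?thesis by simp
qed

lemma mangoldt_series_341:
  assumes "\<sigma> > 1"
  shows "3 * Re (mangoldt_series (Complex \<sigma> 0)) + 4 * Re (mangoldt_series (Complex \<sigma> t)) + Re (mangoldt_series (Complex \<sigma> (2 * t))) \<ge> 0"
proof -
  have s: "(\<lambda>n. Re (dterm mangoldt (Complex \<sigma> y) n)) sums Re (mangoldt_series (Complex \<sigma> y))" for y
    by (intro sums_Re mangoldt_series_sums) (use assms in simp)
  have "(\<lambda>n. 3 * Re (dterm mangoldt (Complex \<sigma> 0) n) + 4 * Re (dterm mangoldt (Complex \<sigma> t) n) + Re (dterm mangoldt (Complex \<sigma> (2 * t)) n))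
    sums (3 * Re (mangoldt_series (Complex \<sigma> 0)) + 4 * Re (mangoldt_series (Complex \<sigma> t)) + Re (mangoldt_series (Complex \<sigma> (2 * t))))"
    by (intro sums_add sums_mult s)
  then show ?thesis
  proof (rule sums_le[OF _ sums_zero, rotated])
    fix n
    have "0 \<le> mangoldt n * real n powr (- \<sigma>) * (3 + 4 * cos (t * ln (real n)) + cos (2 * (t * ln (real n))))"
      by (intro mult_nonneg_nonneg mangoldt_nonneg three_four_one) simp
    then show "0 \<le> 3 * Re (dterm mangoldt (Complex \<sigma> 0) n) + 4 * Re (dterm mangoldt (Complex \<sigma> t) n) + Re (dterm mangoldt (Complex \<sigma> (2 * t)) n)"
      unfolding Re_dterm_mangoldt by (simp add: algebra_simps)
  qed
qed

text \<open>The 3-4-1 inequality, multiplied by \<open>\<delta>\<close> and taken to the limit,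
  reads \<open>3 - 4 * m t - m (2 * t) >= 0\<close>, with the 3 coming from the pole at 1. So
  \<open>4 * m t <= 3\<close>, and the order \<open>m t\<close> is 0.\<close>

lemma zeta_reg_nonzero:
  assumes "Re s \<ge> 1"
  shows "zeta_reg s \<noteq> 0"
proof (cases "Re s > 1 \<or> s = 1")
  case True
  then show ?thesis using zeta_reg_nonzero_gt zeta_reg_1 by auto
next
  case False
  define t where "t = Im s"
  have s: "s = Complex 1 t" and t: "t \<noteq> 0" using False assms by (auto simp: t_def complex_eq_iff)
  \<comment> \<open>The share of the pole: \<open>\<delta> / (s - 1)\<close> at
    \<open>s = 1 + \<delta> + i y\<close> tends to 1 for \<open>y = 0\<close> and to 0
    otherwise.\<close>
  let ?c = "\<lambda>y::real. if y = 0 then 1 else 0 :: complex"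
  have "\<exists>m::nat. (m > 0 \<longleftrightarrow> zeta_reg (Complex 1 y) = 0) \<and>
    ((\<lambda>\<delta>::real. of_real \<delta> * mangoldt_series (Complex (1 + \<delta>) y)) \<longlongrightarrow> ?c y - of_nat m) (at_right 0)" for y
  proof -
    obtain m :: nat where m: "m > 0 \<longleftrightarrow> zeta_reg (Complex 1 y) = 0"
      "((\<lambda>\<delta>::real. of_real \<delta> * (deriv zeta_reg (Complex 1 y + of_real \<delta>) / zeta_reg (Complex 1 y + of_real \<delta>))) \<longlongrightarrow> of_nat m) (at_right 0)"
      using log_deriv_order[of "Complex 1 y"] by auto
    have c: "((\<lambda>\<delta>::real. of_real \<delta> / (of_real \<delta> + \<i> * of_real y)) \<longlongrightarrow> ?c y) (at_right 0)"
    proof (cases "y = 0")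
      case True
      have "\<forall>\<^sub>F \<delta> in at_right (0::real). 1 = (of_real \<delta> / (of_real \<delta> + \<i> * of_real y) :: complex)"
        unfolding eventually_at_right_field using True by (intro exI[of _ 1]) auto
      then show ?thesis using True by (auto intro: Lim_transform_eventually[OF tendsto_const])
    next
      case False
      have "((\<lambda>\<delta>::real. of_real \<delta> / (of_real \<delta> + \<i> * of_real y) :: complex) \<longlongrightarrow> of_real 0 / (of_real 0 + \<i> * of_real y)) (at_right 0)"
        using False by (intro tendsto_intros) auto
      then show ?thesis using False by simp
    qed
    have ev: "\<forall>\<^sub>F \<delta> in at_right (0::real). of_real \<delta> / (of_real \<delta> + \<i> * of_real y) -
        of_real \<delta> * (deriv zeta_reg (Complex 1 y + of_real \<delta>) / zeta_reg (Complex 1 y + of_real \<delta>)) = of_real \<delta> * mangoldt_series (Complex (1 + \<delta>) y)"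
      unfolding eventually_at_right_field
    proof (intro exI[of _ 1] conjI allI impI)
      fix \<delta> :: real assume d: "0 < \<delta>" "\<delta> < 1"
      have "Complex (1 + \<delta>) y = Complex 1 y + of_real \<delta>" by (simp add: complex_eq_iff)
      moreover have "Complex 1 y + of_real \<delta> - 1 = of_real \<delta> + \<i> * of_real y" by (simp add: complex_eq_iff)
      ultimately show "of_real \<delta> / (of_real \<delta> + \<i> * of_real y) -
        of_real \<delta> * (deriv zeta_reg (Complex 1 y + of_real \<delta>) / zeta_reg (Complex 1 y + of_real \<delta>)) = of_real \<delta> * mangoldt_series (Complex (1 + \<delta>) y)"
        using mangoldt_series_eq[of "Complex (1 + \<delta>) y"] d by (simp add: right_diff_distrib)
    qed auto
    show ?thesis
      using m(1) Lim_transform_eventually[OF tendsto_diff[OF c m(2)] ev] by blast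
  qed
  then obtain m :: "real \<Rightarrow> nat" where m: "\<And>y. m y > 0 \<longleftrightarrow> zeta_reg (Complex 1 y) = 0"
    "\<And>y. ((\<lambda>\<delta>::real. of_real \<delta> * mangoldt_series (Complex (1 + \<delta>) y)) \<longlongrightarrow> ?c y - of_nat (m y)) (at_right 0)"
    by metis
  have m0: "m 0 = 0" using m(1)[of 0] zeta_reg_1 by (simp add: complex_eq_iff one_complex.code[symmetric])
  have R: "((\<lambda>\<delta>::real. \<delta> * Re (mangoldt_series (Complex (1 + \<delta>) y))) \<longlongrightarrow> Re (?c y - of_nat (m y))) (at_right 0)" for y
    using tendsto_Re[OF m(2)[of y]] by simp
  have "((\<lambda>\<delta>::real. 3 * (\<delta> * Re (mangoldt_series (Complex (1 + \<delta>) 0))) + 4 * (\<delta> * Re (mangoldt_series (Complex (1 + \<delta>) t)))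
     + \<delta> * Re (mangoldt_series (Complex (1 + \<delta>) (2 * t)))) \<longlongrightarrow>
     3 * Re (?c 0 - of_nat (m 0)) + 4 * Re (?c t - of_nat (m t)) + Re (?c (2 * t) - of_nat (m (2 * t)))) (at_right 0)"
    by (intro tendsto_add tendsto_mult tendsto_const R)
  then have "0 \<le> 3 * Re (?c 0 - of_nat (m 0)) + 4 * Re (?c t - of_nat (m t)) + Re (?c (2 * t) - of_nat (m (2 * t)))"
  proof (rule tendsto_lowerbound)
    show "\<forall>\<^sub>F \<delta> in at_right (0::real). 0 \<le> 3 * (\<delta> * Re (mangoldt_series (Complex (1 + \<delta>) 0))) + 4 * (\<delta> * Re (mangoldt_series (Complex (1 + \<delta>) t)))
     + \<delta> * Re (mangoldt_series (Complex (1 + \<delta>) (2 * t)))"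
      unfolding eventually_at_right_field
    proof (intro exI[of _ 1] conjI allI impI)
      fix \<delta> :: real assume d: "0 < \<delta>" "\<delta> < 1"
      have "0 \<le> \<delta> * (3 * Re (mangoldt_series (Complex (1 + \<delta>) 0)) + 4 * Re (mangoldt_series (Complex (1 + \<delta>) t)) + Re (mangoldt_series (Complex (1 + \<delta>) (2 * t))))"
        using d by (intro mult_nonneg_nonneg mangoldt_series_341) auto
      then show "0 \<le> 3 * (\<delta> * Re (mangoldt_series (Complex (1 + \<delta>) 0))) + 4 * (\<delta> * Re (mangoldt_series (Complex (1 + \<delta>) t)))
     + \<delta> * Re (mangoldt_series (Complex (1 + \<delta>) (2 * t)))" by (simp add: algebra_simps)
    qed auto
  qed simp
  then have "4 * real (m t) \<le> 3" using m0 t by simp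
  then have "m t = 0" by linarith
  then show ?thesis using m(1)[of t] s by simp
qed

section \<open>Newman's analytic theorem\<close>

text \<open>Cauchy's formula at 0 for a closed curve cut at its two points on the imaginary axis, as
  the pieces are estimated separately. After subtraction of \<open>\<phi> 0 / z\<close> the
  integrand is holomorphic and its two integrals cancel. The rest, \<open>1 / z\<close>, has the
  primitive \<open>Ln z\<close> on \<open>g1\<close> and \<open>Ln (- z)\<close> on
  \<open>g2\<close>, and contributes \<open>pi * \<i>\<close> on each.\<close>

lemma contour_integral_split_pole:
  assumes D: "open D" "convex D" and \<phi>: "\<phi> holomorphic_on D" and R: "R > 0"
    and g1: "valid_path g1" "path_image g1 \<subseteq> D" "pathstart g1 = - (of_real R * \<i>)" "pathfinish g1 = of_real R * \<i>"
    and g1': "\<And>z. z \<in> path_image g1 \<Longrightarrow> z \<notin> \<real>\<^sub>\<le>\<^sub>0"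
    and g2: "valid_path g2" "path_image g2 \<subseteq> D" "pathstart g2 = of_real R * \<i>" "pathfinish g2 = - (of_real R * \<i>)"
    and g2': "\<And>z. z \<in> path_image g2 \<Longrightarrow> - z \<notin> \<real>\<^sub>\<le>\<^sub>0"
  shows "\<exists>I J. ((\<lambda>z. \<phi> z / z) has_contour_integral I) g1 \<and> ((\<lambda>z. \<phi> z / z) has_contour_integral J) g2 \<and> I + J = 2 * pi * \<i> * \<phi> 0"
proof -
  define F where "F z = (if z = 0 then deriv \<phi> 0 else (\<phi> z - \<phi> 0) / (z - 0))" for z
  have F: "F holomorphic_on D" unfolding F_def by (rule pole_lemma_open[OF \<phi> D(1)])
  have LnR: "Ln (of_real R * \<i>) = of_real (ln R) + \<i> * of_real (pi / 2)" "Ln (- (of_real R * \<i>)) = of_real (ln R) - \<i> * of_real (pi / 2)"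
    using Ln_times_of_real[OF R, of \<i>] Ln_times_of_real[OF R, of "- \<i>"] R by (auto simp: Ln_of_real)
  have "((\<lambda>z. inverse z) has_contour_integral (Ln (pathfinish g1) - Ln (pathstart g1))) g1"
  proof (rule contour_integral_primitive[where S = "path_image g1"])
    show "(Ln has_field_derivative inverse z) (at z within path_image g1)" if "z \<in> path_image g1" for z
      by (rule has_field_derivative_at_within[OF has_field_derivative_Ln[OF g1'[OF that]]])
  qed (use g1 in auto)
  then have i1: "((\<lambda>z. inverse z) has_contour_integral (pi * \<i>)) g1"
    unfolding g1 LnR by (simp add: algebra_simps)
  have "((\<lambda>z. inverse z) has_contour_integral (Ln (- pathfinish g2) - Ln (- pathstart g2))) g2"
  proof (rule contour_integral_primitive[where S = "path_image g2"])
    fix z assume z: "z \<in> path_image g2"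
    have "((\<lambda>z. Ln (- z)) has_field_derivative (inverse (- z) * (- 1))) (at z)"
      by (rule DERIV_chain2[where f = Ln and g = uminus], rule has_field_derivative_Ln[OF g2'[OF z]])
         (rule DERIV_minus[OF DERIV_ident])
    then show "((\<lambda>z. Ln (- z)) has_field_derivative inverse z) (at z within path_image g2)"
      by (simp add: has_field_derivative_at_within)
  qed (use g2 in auto)
  then have i2: "((\<lambda>z. inverse z) has_contour_integral (pi * \<i>)) g2"
    unfolding g2 minus_minus LnR by (simp add: algebra_simps)
  have v: "valid_path (g1 +++ g2)" using g1 g2 by (intro valid_path_join) auto
  have "(F has_contour_integral 0) (g1 +++ g2)"
    by (rule Cauchy_theorem_convex_simple[OF F D(2) v]) (use g1 g2 in \<open>auto simp: path_image_join\<close>)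
  moreover from this have "F contour_integrable_on g1" "F contour_integrable_on g2"
    using g1 g2 contour_integrable_joinD1 contour_integrable_joinD2 contour_integrable_on_def by blast+
  then obtain a b where ab: "(F has_contour_integral a) g1" "(F has_contour_integral b) g2"
    by (auto simp: contour_integrable_on_def)
  ultimately have ab0: "a + b = 0"
    using has_contour_integral_join[OF ab g1(1) g2(1)] contour_integral_unique by metis
  have z1: "z \<noteq> 0" if "z \<in> path_image g1" for z using g1'[OF that] by auto
  have z2: "z \<noteq> 0" if "z \<in> path_image g2" for z using g2'[OF that] by auto
  have sp: "F z + \<phi> 0 * inverse z = \<phi> z / z" if "z \<noteq> 0" for z
    using that by (simp add: F_def divide_inverse algebra_simps)
  have "((\<lambda>z. F z + \<phi> 0 * inverse z) has_contour_integral (a + \<phi> 0 * (pi * \<i>))) g1"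
    by (intro has_contour_integral_add has_contour_integral_lmul ab i1)
  then have 1: "((\<lambda>z. \<phi> z / z) has_contour_integral (a + \<phi> 0 * (pi * \<i>))) g1"
    by (rule has_contour_integral_eq) (rule sp[OF z1])
  have "((\<lambda>z. F z + \<phi> 0 * inverse z) has_contour_integral (b + \<phi> 0 * (pi * \<i>))) g2"
    by (intro has_contour_integral_add has_contour_integral_lmul ab i2)
  then have 2: "((\<lambda>z. \<phi> z / z) has_contour_integral (b + \<phi> 0 * (pi * \<i>))) g2"
    by (rule has_contour_integral_eq) (rule sp[OF z2])
  have "(a + \<phi> 0 * (pi * \<i>)) + (b + \<phi> 0 * (pi * \<i>)) = (a + b) + 2 * pi * \<i> * \<phi> 0"
    by (simp add: algebra_simps)
  then have "(a + \<phi> 0 * (pi * \<i>)) + (b + \<phi> 0 * (pi * \<i>)) = 2 * pi * \<i> * \<phi> 0" unfolding ab0 by simp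
  with 1 2 show ?thesis by blast
qed

text \<open>\<open>Re z\<close> falls linearly from 0 to \<open>- a\<close> along the segment, so
  the exponential integrates to at most \<open>1 / (a * L)\<close>. With \<open>L = ln N\<close>
  this is an explicit rate of decay.\<close>

lemma linepath_decay_bound:
  assumes f: "(f has_contour_integral I) (linepath b (- of_real a))" and b: "Re b = 0" and a: "a > 0" and L: "L > 0"
    and M: "\<And>z. z \<in> closed_segment b (- of_real a) \<Longrightarrow> norm (f z) \<le> M * exp (Re z * L)" 
  shows "norm I \<le> M * norm (- of_real a - b) / (a * L)"
proof -
  let ?p = "- of_real a :: complex" and ?d = "norm (- of_real a - b)"
  have M0: "M \<ge> 0"
    using order_trans[OF norm_ge_zero M[of b]] by (simp add: zero_le_mult_iff)
  have 1: "((\<lambda>x. f (linepath b ?p x) * (?p - b)) has_integral I) {0..1}"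
    using f by (simp add: has_contour_integral_linepath)
  have "((\<lambda>x. M * ?d * exp (- (a * L) * x)) has_integral
     (M * ?d * (- exp (- (a * L) * 1) / (a * L)) - M * ?d * (- exp (- (a * L) * 0) / (a * L)))) {0..1}"
  proof (rule fundamental_theorem_of_calculus)
    fix x :: real
    have "((\<lambda>x. M * ?d * (- exp (- (a * L) * x) / (a * L))) has_real_derivative (M * ?d * exp (- (a * L) * x))) (at x within {0..1})"
      using a L by (auto intro!: derivative_eq_intros)
    then show "((\<lambda>x. M * ?d * (- exp (- (a * L) * x) / (a * L))) has_vector_derivative (M * ?d * exp (- (a * L) * x))) (at x within {0..1})"
      by (simp only: has_real_derivative_iff_has_vector_derivative)
  qed simp
  then have 2: "((\<lambda>x. M * ?d * exp (- (a * L) * x)) has_integral (M * ?d * (1 - exp (- (a * L))) / (a * L))) {0..1}"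
    by (simp add: algebra_simps diff_divide_distrib)
  have "norm (integral {0..1} (\<lambda>x. f (linepath b ?p x) * (?p - b))) \<le> integral {0..1} (\<lambda>x. M * ?d * exp (- (a * L) * x))"
  proof (rule integral_norm_bound_integral)
    fix x :: real assume x: "x \<in> {0..1}"
    have "linepath b ?p x \<in> closed_segment b ?p" using x by (auto simp: linepath_in_path)
    moreover have "Re (linepath b ?p x) * L = - (a * L) * x" using b by (simp add: linepath_def)
    ultimately have "norm (f (linepath b ?p x)) \<le> M * exp (- (a * L) * x)" using M by metis
    then have "norm (f (linepath b ?p x)) * ?d \<le> M * exp (- (a * L) * x) * ?d" by (rule mult_right_mono) simp
    then show "norm (f (linepath b ?p x) * (?p - b)) \<le> M * ?d * exp (- (a * L) * x)"
      by (simp add: norm_mult mult_ac)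
  qed (use 1 2 in \<open>auto simp: integrable_on_def\<close>)
  then have "norm I \<le> M * ?d * (1 - exp (- (a * L))) / (a * L)"
    by (simp only: integral_unique[OF 1] integral_unique[OF 2])
  also have "\<dots> \<le> M * ?d * 1 / (a * L)"
    by (intro divide_right_mono mult_left_mono mult_nonneg_nonneg M0) (use a L in auto)
  finally show ?thesis by simp
qed

text \<open>On the circle \<open>cnj z = R^2 / z\<close>, so the kernel equals the real number
  \<open>2 * Re z / R^2\<close>. Its zeros on the imaginary axis cancel the factor
  \<open>1 / Re z\<close> in the bounds for \<open>U - S N\<close> and \<open>S N\<close>.\<close>

lemma newman_kernel_norm:
  assumes "norm z = R" "R > 0"
  shows "norm ((1 + z ^ 2 / of_real (R ^ 2)) / z) = 2 * \<bar>Re z\<bar> / R ^ 2"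
proof -
  have z: "z \<noteq> 0" using assms by auto
  have zz: "z * cnj z = of_real (R ^ 2)" using assms by (simp add: complex_norm_square[symmetric])
  have "1 + z ^ 2 / of_real (R ^ 2) = z * (cnj z + z) / of_real (R ^ 2)"
    using assms zz by (simp add: field_simps power2_eq_square)
  then have "(1 + z ^ 2 / of_real (R ^ 2)) / z = of_real (2 * Re z / R ^ 2)"
    using z complex_add_cnj[of z] by (simp add: add.commute)
  then show ?thesis by (simp only: norm_of_real) (simp add: abs_mult)
qed

text \<open>The bound on \<open>u n\<close> is \<open>C\<close> times the integral of
  \<open>t^(- Re z - 1)\<close> over [n, n+1]; it telescopes for tails when \<open>Re z > 0\<close>
  and for partial sums when \<open>Re z < 0\<close>. At -1 the terms to which this is applied have a
  removable singularity.\<close>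

context
  fixes u :: "nat \<Rightarrow> complex \<Rightarrow> complex" and U :: "complex \<Rightarrow> complex" and C :: real
  assumes u_hol: "\<And>n. u n holomorphic_on UNIV"
    and u_bound: "\<And>n z. n \<ge> 1 \<Longrightarrow> Re z \<noteq> 0 \<Longrightarrow> z \<noteq> - 1 \<Longrightarrow>
        norm (u n z) \<le> C * ((real n powr (- Re z) - real (Suc n) powr (- Re z)) / Re z)"
    and u_sums: "\<And>z. Re z > 0 \<Longrightarrow> (\<lambda>n. u (Suc n) z) sums U z"
begin

lemma newman_C_nonneg: "C \<ge> 0"
proof -
  have "0 \<le> C * (1 - 2 powr (- 1))" using order_trans[OF norm_ge_zero u_bound[of 1 1]] by simp
  then show ?thesis by (simp add: powr_minus zero_le_mult_iff)
qed

lemma newman_tail: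
  assumes "Re z > 0" "N \<ge> 1"
  shows "norm (U z - (\<Sum>n\<in>{1..<N}. u n z)) \<le> C * (real N powr (- Re z) / Re z)"
proof -
  let ?x = "Re z"
  let ?g = "\<lambda>n. C * ((real (n + N) powr (- ?x) - real (Suc (n + N)) powr (- ?x)) / ?x)"
  have "(\<lambda>n. u (Suc (n + (N - 1))) z) sums (U z - (\<Sum>n<N - 1. u (Suc n) z))"
    by (rule sums_split_initial_segment[OF u_sums[OF assms(1)]])
  moreover have "(\<Sum>n<N - 1. u (Suc n) z) = (\<Sum>n\<in>{1..<N}. u n z)"
    by (rule sum.reindex_bij_witness[of _ "\<lambda>n. n - 1" Suc]) (use assms in auto)
  moreover have "Suc (n + (N - 1)) = n + N" for n using assms by simp
  ultimately have 1: "(\<lambda>n. u (n + N) z) sums (U z - (\<Sum>n\<in>{1..<N}. u n z))" by (simp only:)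
  have "((\<lambda>x. x powr (- ?x)) \<longlongrightarrow> 0) at_top"
    using assms by (intro tendsto_neg_powr filterlim_ident) auto
  then have "(\<lambda>n. real (n + N) powr (- ?x)) \<longlonglongrightarrow> 0"
    by (rule filterlim_compose) (intro filterlim_compose[OF filterlim_real_sequentially] filterlim_add_const_nat_at_top)
  from telescope_sums'[OF this]
  have "(\<lambda>n. real (n + N) powr (- ?x) - real (Suc n + N) powr (- ?x)) sums (real (0 + N) powr (- ?x) - 0)" .
  then have "(\<lambda>n. real (n + N) powr (- ?x) - real (Suc (n + N)) powr (- ?x)) sums real N powr (- ?x)" by simp
  then have 2: "?g sums (C * (real N powr (- ?x) / ?x))" by (intro sums_mult sums_divide)
  have "norm (u (n + N) z) \<le> ?g n" for n
  proof -
    have "z \<noteq> -1" using assms(1) by auto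
    then show ?thesis using assms by (intro u_bound) auto
  qed
  then have "norm (\<Sum>n. u (n + N) z) \<le> suminf ?g"
    using 2 by (intro norm_suminf_le) (auto simp: sums_iff)
  then show ?thesis using 1 2 by (simp add: sums_iff)
qed

lemma newman_head:
  assumes "Re z < 0" "z \<noteq> - 1" "N \<ge> 1"
  shows "norm (\<Sum>n\<in>{1..<N}. u n z) \<le> C * (real N powr (- Re z) / (- Re z))"
proof -
  let ?x = "Re z"
  have "norm (\<Sum>n\<in>{1..<N}. u n z) \<le> (\<Sum>n\<in>{1..<N}. C * ((real n powr (- ?x) - real (Suc n) powr (- ?x)) / ?x))"
  proof (rule sum_norm_le)
    fix n assume "n \<in> {1..<N}"
    then show "norm (u n z) \<le> C * ((real n powr (- ?x) - real (Suc n) powr (- ?x)) / ?x)"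
      using assms by (intro u_bound) auto
  qed
  also have "\<dots> = C * ((\<Sum>n\<in>{1..<N}. real (Suc n) powr (- ?x) - real n powr (- ?x)) / (- ?x))"
    unfolding sum_divide_distrib sum_distrib_left using assms(1)
    by (intro sum.cong refl) (simp add: field_simps)
  also have "(\<Sum>n\<in>{1..<N}. real (Suc n) powr (- ?x) - real n powr (- ?x)) = real N powr (- ?x) - 1"
    using assms(3) by (subst sum_Suc_diff') auto
  also have "C * ((real N powr (- ?x) - 1) / (- ?x)) \<le> C * (real N powr (- ?x) / (- ?x))"
    by (intro mult_left_mono divide_right_mono newman_C_nonneg) (use assms in auto)
  finally show ?thesis .
qed

text \<open>\<open>U 0\<close> and the partial sum \<open>S N 0\<close> are Cauchy integrals with
  kernel \<open>1 / z + z / R^2\<close> and an extra factor \<open>N^z\<close>. On the right half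
  circle only \<open>U - S N\<close> is integrated. On the left, \<open>S N\<close> is entire and
  keeps the half circle, whereas \<open>U\<close> is integrated over two segments through
  \<open>- a\<close> inside its domain. Each arc gives at most \<open>2 * pi * C / R\<close>, the
  segments \<open>O (1 / ln N)\<close>.\<close>

theorem newman_analytic_theorem:
  assumes \<Omega>: "open \<Omega>" "{z. Re z \<ge> 0} \<subseteq> \<Omega>" and U: "U holomorphic_on \<Omega>"
  shows "(\<lambda>N. \<Sum>n\<in>{1..<N}. u n 0) \<longlonglongrightarrow> U 0"
proof (rule LIMSEQ_I)
  fix \<epsilon> :: real assume \<epsilon>: "\<epsilon> > 0"
  define S where "S N z = (\<Sum>n\<in>{1..<N}. u n z)" for N z
  \<comment> \<open>The first summand makes \<open>2 * C / R\<close> smaller than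
    \<open>\<epsilon>\<close>; the 2 keeps -1 off the circle.\<close>
  define R where "R = 4 * C / \<epsilon> + 2"
  have R: "R \<ge> 2" "2 * C / R < \<epsilon>"
  proof -
    show "R \<ge> 2" using newman_C_nonneg \<epsilon> by (simp add: R_def)
    have "2 * C < \<epsilon> * R" using newman_C_nonneg \<epsilon> by (simp add: R_def distrib_left)
    then show "2 * C / R < \<epsilon>" using \<open>R \<ge> 2\<close> by (simp add: pos_divide_less_eq)
  qed
  have R0: "R > 0" using R by simp
  have "compact (cball 0 (R + 1) \<inter> {z. Re z \<ge> 0})"
    by (intro compact_Int_closed compact_cball closed_halfspace_Re_ge)
  moreover have "cball 0 (R + 1) \<inter> {z. Re z \<ge> 0} \<subseteq> \<Omega>" using \<Omega>(2) by auto
  moreover have "cball 0 (R + 1) \<inter> {z. Re z \<ge> 0} \<noteq> {}"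
  proof -
    have "0 \<in> cball 0 (R + 1) \<inter> {z::complex. Re z \<ge> 0}" using R by simp
    then show ?thesis by blast
  qed
  ultimately obtain \<delta> where \<delta>: "\<delta> > 0" "(\<Union>x\<in>cball 0 (R + 1) \<inter> {z. Re z \<ge> 0}. ball x \<delta>) \<subseteq> \<Omega>"
    using compact_subset_open_imp_ball_epsilon_subset[OF _ \<Omega>(1)] by metis
  \<comment> \<open>A convex neighbourhood of the closed right half disc inside
    \<open>\<Omega>\<close>, with the margin \<open>\<delta>\<close> from compactness. Convexity
    puts the segments into it and lets Cauchy's theorem apply.\<close>
  define D where "D = ball 0 (R + 1) \<inter> {z. Re z > - \<delta>}"
  have D: "open D" "convex D"
    unfolding D_def by (auto intro!: open_Int convex_Int open_halfspace_Re_gt convex_halfspace_Re_gt)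
  have D\<Omega>: "D \<subseteq> \<Omega>"
  proof
    fix z assume z: "z \<in> D"
    show "z \<in> \<Omega>"
    proof (cases "Re z \<ge> 0")
      case False
      define y where "y = \<i> * of_real (Im z)"
      have "norm y \<le> norm z" using abs_Im_le_cmod[of z] by (simp add: y_def norm_mult)
      then have y: "y \<in> cball 0 (R + 1) \<inter> {z. Re z \<ge> 0}" using z by (auto simp: D_def y_def)
      have "y - z = of_real (- Re z)" by (simp add: y_def complex_eq_iff)
      then have "dist y z = \<bar>Re z\<bar>" unfolding dist_norm by (simp only: norm_of_real)
      then have "z \<in> ball y \<delta>" using z False by (simp add: D_def)
      then show ?thesis using \<delta>(2) y by blast
    qed (use \<Omega>(2) in auto)
  qed
  define a where "a = min (\<delta> / 2) 1"
  have a: "a > 0" "a < \<delta>" "a \<le> 1" using \<delta> by (auto simp: a_def)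
  let ?p = "- of_real a :: complex" and ?b = "of_real R * \<i>"
  define g1 where "g1 = part_circlepath 0 R (- (pi / 2)) (pi / 2)"
  define gL where "gL = part_circlepath 0 R (pi / 2) (3 * pi / 2)"
  define g2 where "g2 = linepath ?b ?p +++ linepath ?p (- ?b)"
  have cis1: "exp (\<i> * of_real (- (pi / 2))) = - \<i>" "exp (\<i> * of_real (pi / 2)) = \<i>" "exp (\<i> * of_real (3 * pi / 2)) = - \<i>"
  proof -
    show "exp (\<i> * of_real (pi / 2)) = \<i>" by (simp only: cis_conv_exp[symmetric] cis_pi_half)
    show "exp (\<i> * of_real (- (pi / 2))) = - \<i>" by (simp only: cis_conv_exp[symmetric]) (simp add: complex_eq_iff)
    have "cos (3 * pi / 2) = 0" "sin (3 * pi / 2) = - 1" using cos_3over2_pi sin_3over2_pi by (simp_all add: field_simps)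
    then show "exp (\<i> * of_real (3 * pi / 2)) = - \<i>" by (simp only: cis_conv_exp[symmetric]) (simp add: complex_eq_iff)
  qed
  have ends: "pathstart g1 = - ?b" "pathfinish g1 = ?b" "pathstart gL = ?b" "pathfinish gL = - ?b"
    "pathstart g2 = ?b" "pathfinish g2 = - ?b"
    unfolding g1_def gL_def g2_def pathstart_part_circlepath pathfinish_part_circlepath cis1 by auto
  have v: "valid_path g1" "valid_path gL" "valid_path g2"
    unfolding g1_def gL_def g2_def by (auto intro!: valid_path_join)
  have im1: "norm z = R \<and> Re z \<ge> 0" if z: "z \<in> path_image g1" for z
  proof -
    obtain x where x: "z = of_real R * exp (\<i> * of_real x)" "- (pi / 2) \<le> x" "x \<le> pi / 2"
      using z path_image_part_circlepath[of "- (pi / 2)" "pi / 2" 0 R] unfolding g1_def by auto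
    have "Re z = R * cos x" by (simp add: x cis_conv_exp[symmetric])
    moreover have "cos x \<ge> 0" using x by (intro cos_ge_zero) auto
    ultimately show ?thesis using R0 by (simp add: x norm_mult)
  qed
  have imL: "norm z = R \<and> Re z \<le> 0" if z: "z \<in> path_image gL" for z
  proof -
    obtain x where x: "z = of_real R * exp (\<i> * of_real x)" "pi / 2 \<le> x" "x \<le> 3 * pi / 2"
      using z path_image_part_circlepath[of "pi / 2" "3 * pi / 2" 0 R] unfolding gL_def by auto
    have "Re z = R * cos x" by (simp add: x cis_conv_exp[symmetric])
    moreover have "cos (x - pi) \<ge> 0" using x by (intro cos_ge_zero) auto
    then have "cos x \<le> 0" by simp
    ultimately show ?thesis using R0 by (simp add: x norm_mult mult_le_0_iff)
  qed
  have axis: "z = ?b \<or> z = - ?b" if "norm z = R" "Re z = 0" for z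
  proof -
    have "\<bar>Im z\<bar> = R" using that by (simp add: cmod_def)
    then show ?thesis using that(2) by (auto simp: complex_eq_iff abs_if split: if_splits)
  qed
  have seg: "\<exists>s. 0 \<le> s \<and> s \<le> 1 \<and> z = of_real (1 - s) * c + of_real s * ?p" if "z \<in> closed_segment c ?p" for z c
    using that by (auto simp: closed_segment_def scaleR_conv_of_real)
  have im2: "path_image g2 = closed_segment ?b ?p \<union> closed_segment (- ?b) ?p"
    unfolding g2_def by (subst path_image_join) (auto simp: closed_segment_commute)
  have im2D: "path_image g2 \<subseteq> D"
  proof -
    have "?b \<in> D" "- ?b \<in> D" "?p \<in> D" using R a \<delta> by (auto simp: D_def norm_mult)
    then show ?thesis unfolding im2 by (intro Un_least closed_segment_subset D(2))
  qed
  have im2': "- z \<notin> \<real>\<^sub>\<le>\<^sub>0" if "z \<in> path_image g2" for z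
  proof -
    from that obtain s c where s: "0 \<le> s" "s \<le> 1" "z = of_real (1 - s) * c + of_real s * ?p" "c = ?b \<or> c = - ?b"
      unfolding im2 using seg by blast
    have "Re z = - (s * a)" using s by auto
    moreover have "Im z = (1 - s) * R \<or> Im z = - ((1 - s) * R)" using s by auto
    ultimately show ?thesis using a R0 s(1,2) by (auto simp: complex_nonpos_Reals_iff mult_le_0_iff)
  qed
  have npos: "z \<notin> \<real>\<^sub>\<le>\<^sub>0" if "norm z = R" "Re z \<ge> 0" for z
    using that R0 by (auto simp: complex_nonpos_Reals_iff cmod_def)
  have nneg: "- z \<notin> \<real>\<^sub>\<le>\<^sub>0" if "norm z = R" "Re z \<le> 0" for z
    using that R0 by (auto simp: complex_nonpos_Reals_iff cmod_def)
  have im1D: "path_image g1 \<subseteq> D"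
    using im1 \<delta>(1) by (force simp: D_def)
  define k where "k z = 1 + z ^ 2 / of_real (R ^ 2)" for z :: complex
  have U_D: "U holomorphic_on D" using U D\<Omega> holomorphic_on_subset by blast
  have "compact (path_image g2)" by (intro compact_valid_path_image v)
  moreover have "continuous_on (path_image g2) (\<lambda>z. U z * k z / z)"
  proof (intro continuous_intros)
    show "continuous_on (path_image g2) U"
      using U_D im2D holomorphic_on_imp_continuous_on continuous_on_subset by blast
    show "continuous_on (path_image g2) k" unfolding k_def by (intro continuous_intros) (use R0 in auto)
    show "\<forall>z\<in>path_image g2. z \<noteq> 0" using im2' by force
  qed
  ultimately have "bounded ((\<lambda>z. U z * k z / z) ` path_image g2)"
    by (intro compact_imp_bounded compact_continuous_image)
  then obtain M where M: "\<And>z. z \<in> path_image g2 \<Longrightarrow> norm (U z * k z / z) \<le> M"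
    unfolding bounded_iff by auto
  \<comment> \<open>\<open>M\<close> bounds the integrand without the factor \<open>N^z\<close>, so
    \<open>B\<close> does not depend on \<open>N\<close>.\<close>
  define B where "B = M * norm (?p - ?b) / a + M * norm (?p - (- ?b)) / a"
  have main: "2 * pi * norm (S N 0 - U 0) \<le> 4 * pi * C / R + B / ln (real N)" if N: "N \<ge> 2" for N
  proof -
    have lnN: "ln (real N) > 0" using N by simp
    let ?N = "\<lambda>z. dpow (real N) (- z)"
    have normN: "norm (?N z) = real N powr Re z" for z using N by (simp add: norm_dpow)
    have S_hol: "S N holomorphic_on A" for A
    proof -
      have "S N holomorphic_on UNIV" unfolding S_def by (intro holomorphic_intros u_hol)
      then show ?thesis by (rule holomorphic_on_subset) simp
    qed
    have k_hol: "k holomorphic_on A" for A unfolding k_def by (intro holomorphic_intros) (use R0 in auto)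
    let ?\<phi> = "\<lambda>z. U z * ?N z * k z" and ?\<psi> = "\<lambda>z. S N z * ?N z * k z"
    have \<phi>: "?\<phi> holomorphic_on D" by (intro holomorphic_intros U_D k_hol)
    have \<psi>: "?\<psi> holomorphic_on UNIV" by (intro holomorphic_intros S_hol k_hol)
    obtain I1 J1 where IJ1: "((\<lambda>z. ?\<phi> z / z) has_contour_integral I1) g1" "((\<lambda>z. ?\<phi> z / z) has_contour_integral J1) g2"
       "I1 + J1 = 2 * pi * \<i> * ?\<phi> 0"
      using contour_integral_split_pole[OF D \<phi> R0 v(1) im1D ends(1,2) npos v(3) im2D ends(5,6) im2'] im1 by blast
    obtain I2 J2 where IJ2: "((\<lambda>z. ?\<psi> z / z) has_contour_integral I2) g1" "((\<lambda>z. ?\<psi> z / z) has_contour_integral J2) gL"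
       "I2 + J2 = 2 * pi * \<i> * ?\<psi> 0"
      using contour_integral_split_pole[OF open_UNIV convex_UNIV \<psi> R0 v(1) subset_UNIV ends(1,2) npos v(2) subset_UNIV ends(3,4) nneg] im1 imL by blast
    \<comment> \<open>At 0 both \<open>N^z\<close> and \<open>k z\<close> equal 1, so the difference
      of the two formulas isolates \<open>U 0 - S N 0\<close>.\<close>
    have id: "2 * pi * \<i> * (U 0 - S N 0) = (I1 - I2) + J1 - J2"
      using IJ1(3) IJ2(3) by (simp add: k_def algebra_simps)
    \<comment> \<open>The estimates on the arcs divide by \<open>Re z\<close>; the two points of the
      circle where it vanishes are left out as a finite set.\<close>
    have fin: "finite {?b, - ?b}" by simp
    have bd: "2 * C / R ^ 2 * R * pi = 2 * pi * C / R" using R0 by (simp add: power2_eq_square)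
    have "((\<lambda>z. ?\<phi> z / z - ?\<psi> z / z) has_contour_integral (I1 - I2)) g1"
      by (rule has_contour_integral_diff[OF IJ1(1) IJ2(1)])
    then have "norm (I1 - I2) \<le> 2 * C / R ^ 2 * R * (pi / 2 - (- (pi / 2)))"
      unfolding g1_def
    proof (rule has_contour_integral_bound_part_circlepath_strong[OF _ fin])
      fix z assume z: "z \<in> path_image (part_circlepath 0 R (- (pi / 2)) (pi / 2)) - {?b, - ?b}"
      then have zR: "norm z = R" "Re z > 0"
        using im1[of z] axis[of z] by (auto simp: g1_def order.order_iff_strict)
      have "?\<phi> z / z - ?\<psi> z / z = (U z - S N z) * ?N z * (k z / z)" by (simp add: algebra_simps diff_divide_distrib)
      then have "norm (?\<phi> z / z - ?\<psi> z / z) = norm (U z - S N z) * real N powr Re z * (2 * \<bar>Re z\<bar> / R ^ 2)"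
        unfolding k_def by (simp only: norm_mult normN newman_kernel_norm[OF zR(1) R0])
      also have "\<dots> \<le> (C * (real N powr (- Re z) / Re z)) * real N powr Re z * (2 * \<bar>Re z\<bar> / R ^ 2)"
        by (intro mult_right_mono newman_tail[of z N, folded S_def]) (use zR N in auto)
      also have "\<dots> = 2 * C / R ^ 2" using zR N by (simp add: powr_minus field_simps)
      finally show "norm (?\<phi> z / z - ?\<psi> z / z) \<le> 2 * C / R ^ 2" .
    qed (use R0 newman_C_nonneg in auto)
    then have b1: "norm (I1 - I2) \<le> 2 * pi * C / R" using bd by simp
    have "norm J2 \<le> 2 * C / R ^ 2 * R * (3 * pi / 2 - pi / 2)"
      using IJ2(2) unfolding gL_def
    proof (rule has_contour_integral_bound_part_circlepath_strong[OF _ fin])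
      fix z assume z: "z \<in> path_image (part_circlepath 0 R (pi / 2) (3 * pi / 2)) - {?b, - ?b}"
      then have zR: "norm z = R" "Re z < 0"
        using imL[of z] axis[of z] by (auto simp: gL_def order.order_iff_strict)
      have z1: "z \<noteq> - 1" using zR R by auto
      have "?\<psi> z / z = S N z * ?N z * (k z / z)" by simp
      then have "norm (?\<psi> z / z) = norm (S N z) * real N powr Re z * (2 * \<bar>Re z\<bar> / R ^ 2)"
        unfolding k_def by (simp only: norm_mult normN newman_kernel_norm[OF zR(1) R0])
      also have "\<dots> \<le> (C * (real N powr (- Re z) / (- Re z))) * real N powr Re z * (2 * \<bar>Re z\<bar> / R ^ 2)"
        by (intro mult_right_mono newman_head[of z N, folded S_def]) (use zR N z1 in \<open>auto simp: divide_le_0_iff\<close>)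
      also have "\<dots> = 2 * C / R ^ 2" using zR N by (simp add: powr_minus field_simps)
      finally show "norm (?\<psi> z / z) \<le> 2 * C / R ^ 2" .
    qed (use R0 newman_C_nonneg in auto)
    then have b2: "norm J2 \<le> 2 * pi * C / R" using bd by simp
    have bnd: "norm (?\<phi> z / z) \<le> M * exp (Re z * ln (real N))" if "z \<in> path_image g2" for z
    proof -
      have "norm (?\<phi> z / z) = norm (U z * k z / z) * real N powr Re z" by (simp add: norm_mult norm_divide normN mult_ac)
      also have "\<dots> \<le> M * real N powr Re z" by (intro mult_right_mono M that) simp
      finally show ?thesis using N by (simp add: powr_def)
    qed
    have "(\<lambda>z. ?\<phi> z / z) contour_integrable_on g2" using IJ1(2) by (auto simp: contour_integrable_on_def)
    then have ci: "(\<lambda>z. ?\<phi> z / z) contour_integrable_on linepath ?b ?p" "(\<lambda>z. ?\<phi> z / z) contour_integrable_on linepath ?p (- ?b)"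
      unfolding g2_def using contour_integrable_joinD1 contour_integrable_joinD2 valid_path_linepath by blast+
    then obtain K1 K2 where K: "((\<lambda>z. ?\<phi> z / z) has_contour_integral K1) (linepath ?b ?p)" "((\<lambda>z. ?\<phi> z / z) has_contour_integral K2) (linepath ?p (- ?b))"
      by (auto simp: contour_integrable_on_def)
    have "((\<lambda>z. ?\<phi> z / z) has_contour_integral (K1 + K2)) g2"
      unfolding g2_def by (intro has_contour_integral_join K valid_path_linepath) 
    then have J1: "J1 = K1 + K2" using IJ1(2) contour_integral_unique by metis
    have "((\<lambda>z. ?\<phi> z / z) has_contour_integral (- K2)) (reversepath (linepath ?p (- ?b)))"
      by (intro has_contour_integral_reversepath K valid_path_linepath)
    then have K2: "((\<lambda>z. ?\<phi> z / z) has_contour_integral (- K2)) (linepath (- ?b) ?p)" by simp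
    have "norm K1 \<le> M * norm (?p - ?b) / (a * ln (real N))"
      by (rule linepath_decay_bound[OF K(1) _ a(1) lnN bnd]) (auto simp: im2)
    moreover have "norm (- K2) \<le> M * norm (?p - (- ?b)) / (a * ln (real N))"
      by (rule linepath_decay_bound[OF K2 _ a(1) lnN bnd]) (auto simp: im2)
    ultimately have "norm K1 + norm K2 \<le> B / ln (real N)" by (simp add: B_def add_divide_distrib)
    then have b3: "norm J1 \<le> B / ln (real N)" unfolding J1 using norm_triangle_ineq[of K1 K2] by linarith
    have "2 * pi * norm (S N 0 - U 0) = norm (2 * pi * \<i> * (U 0 - S N 0))"
      by (simp add: norm_mult norm_minus_commute)
    also have "\<dots> \<le> norm (I1 - I2) + norm J1 + norm J2"
      unfolding id by (rule order_trans[OF norm_triangle_ineq4]) (intro add_mono norm_triangle_ineq order_refl)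
    also have "\<dots> \<le> 2 * pi * C / R + B / ln (real N) + 2 * pi * C / R"
      by (intro add_mono b1 b2 b3)
    also have "\<dots> = 4 * pi * C / R + B / ln (real N)" by simp
    finally show ?thesis .
  qed
  have "(\<lambda>N. 4 * pi * C / R + B / ln (real N)) \<longlonglongrightarrow> 4 * pi * C / R + 0"
  proof (intro tendsto_add tendsto_const)
    show "(\<lambda>N. B / ln (real N)) \<longlonglongrightarrow> 0" by real_asymp
  qed
  moreover have "4 * pi * C / R + 0 < 2 * pi * \<epsilon>"
    using mult_strict_left_mono[OF R(2), of "2 * pi"] by simp
  ultimately have "\<forall>\<^sub>F N in sequentially. 4 * pi * C / R + B / ln (real N) < 2 * pi * \<epsilon>"
    by (rule order_tendstoD)
  then have "\<forall>\<^sub>F N in sequentially. norm (S N 0 - U 0) < \<epsilon>"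
    using eventually_ge_at_top[of 2]
  proof eventually_elim
    case (elim N)
    then have "2 * pi * norm (S N 0 - U 0) < 2 * pi * \<epsilon>" using main[of N] by linarith
    then show ?case by simp
  qed
  then show "\<exists>no. \<forall>n\<ge>no. norm ((\<Sum>n\<in>{1..<n}. u n 0) - U 0) < \<epsilon>"
    by (simp add: S_def eventually_sequentially)
qed

end

section \<open>The prime number theorem\<close>

text \<open>The value at \<open>z = -1\<close> fills a removable singularity, which lies inside the large circles of the contour.\<close>

definition newman_term :: "nat \<Rightarrow> complex \<Rightarrow> complex" where
  "newman_term n z = of_real (psi_err n) *
     (if 1 + z = 0 then deriv (\<lambda>w. dpow n w - dpow (n + 1) w) 0
      else (dpow n (1 + z) - dpow (n + 1) (1 + z)) / (1 + z))"

lemma newman_term_holomorphic: "newman_term n holomorphic_on UNIV"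
proof -
  let ?F = "\<lambda>w. dpow n w - dpow (n + 1) w"
  have "(\<lambda>w. if w = 0 then deriv ?F 0 else (?F w - ?F 0) / (w - 0)) holomorphic_on UNIV"
    by (rule pole_lemma_open) (auto intro!: holomorphic_intros)
  then have 1: "(\<lambda>w. if w = 0 then deriv ?F 0 else ?F w / w) holomorphic_on UNIV"
    by (simp only: dpow_0_right diff_self diff_0_right)
  have "(\<lambda>z. (\<lambda>w. if w = 0 then deriv ?F 0 else ?F w / w) (1 + z)) holomorphic_on UNIV"
    by (rule holomorphic_on_compose_gen[OF _ 1, unfolded o_def]) (auto intro!: holomorphic_intros)
  then show ?thesis unfolding newman_term_def by (intro holomorphic_intros)
qed

text \<open>Off -1 the term is \<open>psi_err n\<close> times the integral of
  \<open>t^(- z - 2)\<close> over [n, n+1]. Chebyshev's bound \<open>4 * n <= 4 * t\<close> raises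
  the exponent by one and supplies the constant 4.\<close>

lemma newman_term_bound:
  assumes n: "n \<ge> 1" and z: "Re z \<noteq> 0" "z \<noteq> - 1"
  shows "norm (newman_term n z) \<le> 4 * ((real n powr (- Re z) - real (Suc n) powr (- Re z)) / Re z)"
proof -
  have z1: "1 + z \<noteq> 0" using z(2) by (metis add_eq_0_iff)
  define f where "f t = - (of_real n / (1 + z)) * dpow t (1 + z)" for t
  have "norm (f (real n + 1) - f (real n)) \<le> (- ((real n + 1) powr (- Re z)) / Re z) - (- (real n powr (- Re z)) / Re z)"
  proof (rule norm_diff_le_by_derivative)
    fix t assume t: "t \<in> {real n..real n + 1}"
    have t0: "t > 0" using t n by auto
    show "(f has_vector_derivative (- (of_real n / (1 + z)) * (- (1 + z) * dpow t (1 + z + 1)))) (at t within {real n..real n + 1})"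
      unfolding f_def by (intro has_vector_derivative_mult_right dpow_has_vector_derivative t0)
    have "((\<lambda>t. - (t powr (- Re z)) / Re z) has_real_derivative (t powr (- Re z - 1))) (at t within {real n..real n + 1})"
      using t0 z(1) by (auto intro!: derivative_eq_intros)
    then show "((\<lambda>t. - (t powr (- Re z)) / Re z) has_vector_derivative (t powr (- Re z - 1))) (at t within {real n..real n + 1})"
      by (simp only: has_real_derivative_iff_has_vector_derivative)
    have "- (of_real n / (1 + z)) * (- (1 + z) * dpow t (1 + z + 1)) = of_real n * dpow t (1 + z + 1)"
    proof -
      have "- (a / c) * (- c * d) = a * d" if "c \<noteq> 0" for a c d :: complex using that by simp
      then show ?thesis using z1 .
    qed
    then have "norm (- (of_real n / (1 + z)) * (- (1 + z) * dpow t (1 + z + 1))) = real n * t powr (- Re z - 2)"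
      using t0 by (simp only: norm_mult norm_of_nat norm_dpow) (simp add: algebra_simps)
    also have "\<dots> \<le> t * t powr (- Re z - 2)" using t by (intro mult_right_mono) auto
    also have "\<dots> = t powr (- Re z - 1)"
    proof -
      have e: "1 + (- Re z - 2) = - Re z - 1" by simp
      show ?thesis using powr_add[of t 1 "- Re z - 2"] t0 unfolding e by simp
    qed
    finally show "norm (- (of_real n / (1 + z)) * (- (1 + z) * dpow t (1 + z + 1))) \<le> t powr (- Re z - 1)" .
  qed simp
  also have "\<dots> = (real n powr (- Re z) - real (Suc n) powr (- Re z)) / Re z"
    by (simp add: diff_divide_distrib add.commute)
  finally have le: "norm (f (real n + 1) - f (real n)) \<le> (real n powr (- Re z) - real (Suc n) powr (- Re z)) / Re z" .
  have "newman_term n z = of_real (psi_err n / real n) * (f (real n + 1) - f (real n))"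
  proof -
    have gen: "e * ((a - b) / c) = e / k * (- (k / c) * b - - (k / c) * a)" if "k \<noteq> 0" for a b c e k :: complex
    proof -
      have "e / k * (- (k / c) * b - - (k / c) * a) = (e / k * k) * ((a - b) / c)"
        by (simp add: divide_inverse algebra_simps)
      then show ?thesis using that by simp
    qed
    have "of_nat n \<noteq> (0 :: complex)" using n by simp
    from gen[OF this] show ?thesis
      using z1 unfolding newman_term_def f_def by (simp only: if_False of_real_divide of_real_of_nat_eq of_nat_add of_nat_1)
  qed
  then have "norm (newman_term n z) = \<bar>psi_err n / real n\<bar> * norm (f (real n + 1) - f (real n))"
    by (simp only: norm_mult norm_of_real)
  also have "\<dots> \<le> 4 * ((real n powr (- Re z) - real (Suc n) powr (- Re z)) / Re z)"
  proof (intro mult_mono le)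
    show "\<bar>psi_err n / real n\<bar> \<le> 4" using abs_psi_err_le[of n] n by (simp add: pos_divide_le_eq)
  qed auto
  finally show ?thesis .
qed

text \<open>Partial summation: \<open>psi_err\<close> has the increments
  \<open>mangoldt - 1\<close>, the coefficients of the two Dirichlet series, and by Chebyshev's
  bound the boundary term is \<open>O (M^(- Re z))\<close>.\<close>

lemma newman_term_sums:
  assumes "Re z > 0"
  shows "(\<lambda>n. newman_term (Suc n) z) sums ((mangoldt_series (1 + z) - zeta (1 + z)) / (1 + z))"
proof -
  let ?w = "1 + z"
  have w: "Re ?w > 1" "?w \<noteq> 0" using assms by (auto simp: complex_eq_iff)
  have part: "(\<Sum>k<M. of_real (psi_err (Suc k)) * (dpow (real (Suc k)) ?w - dpow (real (Suc (Suc k))) ?w))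
    = (\<Sum>k<M. dterm mangoldt ?w (Suc k) - dterm (\<lambda>_. 1) ?w (Suc k)) - of_real (psi_err M) * dpow (real (Suc M)) ?w" for M
  proof (induction M)
    case 0
    show ?case by (simp add: psi_err_def)
  next
    case (Suc M)
    have "psi_err (Suc M) - psi_err M = mangoldt (Suc M) - 1" by (simp add: psi_err_def psi_Suc)
    then have star: "dterm mangoldt ?w (Suc M) - dterm (\<lambda>_. 1) ?w (Suc M) = of_real (psi_err (Suc M) - psi_err M) * dpow (real (Suc M)) ?w"
      by (simp only:) (simp add: dterm_def left_diff_distrib)
    show ?case unfolding sum.lessThan_Suc Suc.IH star by (simp add: algebra_simps)
  qed
  have "(\<lambda>k. dterm mangoldt ?w (Suc k)) sums mangoldt_series ?w" "(\<lambda>k. dterm (\<lambda>_. 1) ?w (Suc k)) sums zeta ?w"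
    using mangoldt_series_sums[OF w(1)] zeta_sums[OF w(1)] by (subst sums_Suc_iff, simp add: dterm_def)+
  then have 1: "(\<lambda>M. \<Sum>k<M. dterm mangoldt ?w (Suc k) - dterm (\<lambda>_. 1) ?w (Suc k)) \<longlonglongrightarrow> mangoldt_series ?w - zeta ?w"
    using sums_diff unfolding sums_def by blast
  have "(\<lambda>M. 4 * norm (dpow (real (Suc M)) z)) \<longlonglongrightarrow> 4 * 0"
    by (intro tendsto_mult tendsto_const tendsto_norm_zero dpow_tendsto_0 assms)
  then have lim4: "(\<lambda>M. 4 * norm (dpow (real (Suc M)) z)) \<longlonglongrightarrow> 0" by simp
  have 2: "(\<lambda>M. of_real (psi_err M) * dpow (real (Suc M)) ?w) \<longlonglongrightarrow> 0"
  proof (rule Lim_null_comparison[OF _ lim4], intro always_eventually allI)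
    fix M
    have "norm (of_real (psi_err M) * dpow (real (Suc M)) ?w) = \<bar>psi_err M\<bar> * norm (dpow (real (Suc M)) ?w)"
      by (simp add: norm_mult)
    also have "\<dots> \<le> (4 * real (Suc M)) * norm (dpow (real (Suc M)) ?w)"
      using abs_psi_err_le[of M] by (intro mult_right_mono) auto
    also have "\<dots> = 4 * norm (dpow (real (Suc M)) z)"
    proof -
      have n1: "norm (dpow (real (Suc M)) 1) = 1 / real (Suc M)"
        using norm_dpow[of "real (Suc M)" 1] by (simp add: powr_minus_divide)
      show ?thesis unfolding dpow_add norm_mult n1 by (simp del: of_nat_Suc)
    qed
    finally show "norm (of_real (psi_err M) * dpow (real (Suc M)) ?w) \<le> 4 * norm (dpow (real (Suc M)) z)" .
  qed
  have "(\<lambda>k. of_real (psi_err (Suc k)) * (dpow (real (Suc k)) ?w - dpow (real (Suc (Suc k))) ?w)) sums (mangoldt_series ?w - zeta ?w)"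
    unfolding sums_def part using tendsto_diff[OF 1 2] by simp
  then have "(\<lambda>k. of_real (psi_err (Suc k)) * (dpow (real (Suc k)) ?w - dpow (real (Suc (Suc k))) ?w) / ?w) sums ((mangoldt_series ?w - zeta ?w) / ?w)"
    by (rule sums_divide)
  also have "(\<lambda>k. of_real (psi_err (Suc k)) * (dpow (real (Suc k)) ?w - dpow (real (Suc (Suc k))) ?w) / ?w) = (\<lambda>k. newman_term (Suc k) z)"
    using w(2) by (auto simp: newman_term_def fun_eq_iff add.commute)
  finally show ?thesis .
qed

text \<open>Both series have a simple pole with residue 1 at \<open>s = 1\<close>, and the poles
  cancel: with \<open>q\<close> the difference quotient of \<open>zeta_reg\<close> at 1,
  \<open>zeta s = q s + 1 / (s - 1)\<close>. The set \<open>T\<close> avoids the zeros of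
  \<open>zeta_reg\<close>, none of which has \<open>Re s >= 1\<close>.\<close>

lemma mangoldt_minus_zeta_extends:
  "\<exists>\<Omega> U. open \<Omega> \<and> {z. Re z \<ge> 0} \<subseteq> \<Omega> \<and> U holomorphic_on \<Omega> \<and>
     (\<forall>z. Re z > 0 \<longrightarrow> U z = (mangoldt_series (1 + z) - zeta (1 + z)) / (1 + z))"
proof -
  let ?S = "{s. Re s > 0}"
  define q where "q s = (if s = 1 then deriv zeta_reg 1 else (zeta_reg s - zeta_reg 1) / (s - 1))" for s
  define T where "T = ?S \<inter> zeta_reg -` (- {0})"
  define A where "A s = (- deriv zeta_reg s / zeta_reg s - q s) / s" for s
  have op: "open ?S" by (rule open_halfspace_Re_gt)
  have T: "open T" unfolding T_def
    by (rule continuous_open_preimage[OF holomorphic_on_imp_continuous_on[OF zeta_reg_holomorphic] op]) auto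
  have TS: "T \<subseteq> ?S" by (auto simp: T_def)
  have "q holomorphic_on ?S" unfolding q_def by (rule pole_lemma_open[OF zeta_reg_holomorphic op])
  moreover have "deriv zeta_reg holomorphic_on ?S" by (rule holomorphic_deriv[OF zeta_reg_holomorphic op])
  ultimately have "A holomorphic_on T"
    unfolding A_def using zeta_reg_holomorphic TS T[unfolded T_def]
    by (intro holomorphic_intros) (auto intro: holomorphic_on_subset simp: T_def)
  then have "(\<lambda>z. A (1 + z)) holomorphic_on ((\<lambda>z. 1 + z) -` T)"
    by (rule holomorphic_on_compose_gen[of "\<lambda>z. 1 + z", unfolded o_def, rotated]) (auto intro!: holomorphic_intros)
  moreover have "open ((\<lambda>z. 1 + z) -` T)"
    by (rule open_vimage[OF T]) (intro continuous_intros)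
  moreover have "{z. Re z \<ge> 0} \<subseteq> (\<lambda>z. 1 + z) -` T"
    using zeta_reg_nonzero by (auto simp: T_def)
  moreover have "A (1 + z) = (mangoldt_series (1 + z) - zeta (1 + z)) / (1 + z)" if "Re z > 0" for z
  proof -
    let ?s = "1 + z"
    have s: "Re ?s > 1" "?s \<noteq> 1" using that by auto
    then have "q ?s = zeta ?s - 1 / (?s - 1)"
      unfolding q_def zeta_reg_1 zeta_reg_eq[OF s(1)] by (simp add: diff_divide_distrib)
    then show ?thesis unfolding A_def mangoldt_series_eq[OF s(1)] by simp
  qed
  ultimately show ?thesis by blast
qed

theorem prime_number_theorem: "(\<lambda>n. psi n / real n) \<longlonglongrightarrow> 1"
proof (rule tauberian_psi)
  obtain \<Omega> U where U: "open \<Omega>" "{z. Re z \<ge> 0} \<subseteq> \<Omega>" "U holomorphic_on \<Omega>"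
    "\<And>z. Re z > 0 \<Longrightarrow> U z = (mangoldt_series (1 + z) - zeta (1 + z)) / (1 + z)"
    using mangoldt_minus_zeta_extends by blast
  have "(\<lambda>N. \<Sum>n\<in>{1..<N}. newman_term n 0) \<longlonglongrightarrow> U 0"
  proof (rule newman_analytic_theorem[OF newman_term_holomorphic newman_term_bound _ U(1-3)])
    show "(\<lambda>n. newman_term (Suc n) z) sums U z" if "Re z > 0" for z
      unfolding U(4)[OF that] by (rule newman_term_sums[OF that])
  qed
  then have "(\<lambda>N. Re (\<Sum>n\<in>{1..<N}. newman_term n 0)) \<longlonglongrightarrow> Re (U 0)" by (rule tendsto_Re)
  moreover have "Re (\<Sum>n\<in>{1..<N}. newman_term n 0) = (\<Sum>k\<in>{1..<N}. psi_step k)" for N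
  proof -
    have "newman_term k 0 = of_real (psi_step k)" if "k \<ge> 1" for k
      using dpow_of_real[of "real k" 1] dpow_of_real[of "real (Suc k)" 1] that
      by (simp add: newman_term_def powr_minus_divide add.commute)
    then have "(\<Sum>n\<in>{1..<N}. newman_term n 0) = (\<Sum>n\<in>{1..<N}. of_real (psi_err n * (1 / real n - 1 / real (Suc n))))"
      by (intro sum.cong) auto
    then show ?thesis by (simp only: Re_sum Re_complex_of_real)
  qed
  ultimately show "convergent (\<lambda>n. \<Sum>k\<in>{1..<n}. psi_step k)"
    by (auto simp: convergent_def)
qed

section \<open>The majority of the digits\<close>

lemma exists_weighted_pmf:
  fixes f :: "nat \<Rightarrow> real"
  assumes "finite X" "\<And>x. f x \<ge> 0" "sum f X = 1"
  shows "\<exists>P. \<forall>x. pmf P x = (if x \<in> X then f x else 0)"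
proof -
  let ?f = "\<lambda>x. if x \<in> X then f x else 0"
  have "(\<integral>\<^sup>+x. ennreal (?f x) \<partial>count_space UNIV) = (\<Sum>x\<in>X. ennreal (?f x))"
    using assms(1) by (intro nn_integral_count_space') auto
  also have "\<dots> = ennreal (\<Sum>x\<in>X. ?f x)" using assms(2) by (intro sum_ennreal) auto
  also have "\<dots> = 1" using assms(3) by simp
  finally have "pmf (embed_pmf ?f) x = ?f x" for x
    using assms(2) by (intro pmf_embed_pmf) auto
  then show ?thesis by blast
qed

lemma rad_sum_digit: "rad_sum {..<n} x = real n - 2 * real (\<Sum>j<n. digit x j)"
proof -
  have "rademacher j x = 1 - 2 * real (digit x j)" for j by (simp add: rademacher_def digit_def)
  then show ?thesis by (simp add: rad_sum_def sum_subtractf sum_distrib_left)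
qed

lemma majority_eq_indicator: "real (majority n (digit x)) = indicator {x. rad_sum {..<n} x < 0} x"
  by (auto simp: majority_def rad_sum_digit)

text \<open>Any cutoff that grows faster than \<open>log n\<close> and slower than \<open>\<surd>n\<close> would do.\<close>

definition cutoff :: "nat \<Rightarrow> nat" where "cutoff n = nat \<lfloor>real n powr (1 / 4)\<rfloor>"

lemma cutoff_bounds: "real (cutoff n) \<le> real n powr (1 / 4)" "real n powr (1 / 4) - 1 \<le> real (cutoff n)"
  by (auto simp: cutoff_def)

lemma cutoff_sqrt: "(\<lambda>n. real (cutoff n) / sqrt (real n)) \<longlonglongrightarrow> 0"
proof (rule tendsto_sandwich[OF _ _ tendsto_const])
  show "(\<lambda>n. real n powr (1 / 4) / sqrt (real n)) \<longlonglongrightarrow> 0" by real_asymp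
qed (auto intro!: always_eventually divide_right_mono cutoff_bounds)

lemma cutoff_exponential:
  "(\<lambda>n. real n ^ k / 2 ^ cutoff n) \<longlonglongrightarrow> 0"
proof (rule tendsto_sandwich[OF _ _ tendsto_const])
  show "(\<lambda>n. real n powr real k / 2 powr (real n powr (1 / 4) - 1)) \<longlonglongrightarrow> 0"
    by real_asymp
  show "\<forall>\<^sub>F n in sequentially. real n ^ k / 2 ^ cutoff n \<le> real n powr real k / 2 powr (real n powr (1 / 4) - 1)"
    using eventually_gt_at_top[of 0]
  proof eventually_elim
    case (elim n)
    have "2 powr (real n powr (1 / 4) - 1) \<le> 2 powr real (cutoff n)"
      by (intro powr_mono cutoff_bounds) auto
    also have "\<dots> = 2 ^ cutoff n" by (rule powr_realpow) simp
    finally have le: "2 powr (real n powr (1 / 4) - 1) \<le> (2::real) ^ cutoff n" .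
    have "real n ^ k = real n powr real k" using elim by (simp add: powr_realpow)
    then show ?case using le by (simp add: divide_left_mono)
  qed
qed auto

lemma cutoff_positive: "\<forall>\<^sub>F n in sequentially. cutoff n > 0"
  using eventually_ge_at_top[of 1]
proof eventually_elim
  case (elim n)
  then have "1 \<le> real n powr (1 / 4)" by (intro ge_one_powr_ge_zero) auto
  then show ?case by (simp add: cutoff_def)
qed

definition mangoldt_mass :: "nat \<Rightarrow> real" where
  "mangoldt_mass n = (\<Sum>x<2 ^ n. mangoldt x)"

lemma mangoldt_mass_eq: "mangoldt_mass n = psi (2 ^ n) - mangoldt (2 ^ n)"
proof -
  have "psi (2 ^ n) = (\<Sum>x\<in>{1..<2 ^ n}. mangoldt x) + mangoldt (2 ^ n)"
    unfolding psi_def by (subst sum.atLeastLessThan_Suc) auto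
  moreover have "mangoldt_mass n = (\<Sum>x\<in>{1..<2 ^ n}. mangoldt x)"
    unfolding mangoldt_mass_def by (rule sum.mono_neutral_right) (auto simp: not_less_eq_eq)
  ultimately show ?thesis by simp
qed

text \<open>The mass stops short of \<open>2^n\<close>, whose own weight \<open>ln 2\<close> is
  negligible.\<close>

lemma mangoldt_mass_tendsto: "(\<lambda>n. mangoldt_mass n / 2 ^ n) \<longlonglongrightarrow> 1"
proof -
  have sm: "strict_mono (\<lambda>n. 2 ^ n :: nat)" by (rule strict_monoI) simp
  have "(\<lambda>n. psi (2 ^ n) / real (2 ^ n)) \<longlonglongrightarrow> 1"
    using LIMSEQ_subseq_LIMSEQ[OF prime_number_theorem sm] by (simp add: o_def)
  moreover have "(\<lambda>n. ln 2 / 2 ^ n :: real) \<longlonglongrightarrow> 0" by real_asymp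
  ultimately have "(\<lambda>n. psi (2 ^ n) / real (2 ^ n) - ln 2 / 2 ^ n) \<longlonglongrightarrow> 1 - 0"
    by (rule tendsto_diff)
  moreover have "\<forall>\<^sub>F n in sequentially. psi (2 ^ n) / real (2 ^ n) - ln 2 / 2 ^ n = mangoldt_mass n / 2 ^ n"
    using eventually_gt_at_top[of 0]
  proof eventually_elim
    case (elim n)
    then have "(mangoldt (2 ^ n) :: real) = ln 2" by (subst mangoldt_primepow') auto
    then show ?case by (simp add: mangoldt_mass_eq diff_divide_distrib)
  qed
  ultimately show ?thesis by (auto intro: Lim_transform_eventually)
qed

lemma mangoldt_walsh_le:
  assumes w: "w > 0" and A: "A \<subseteq> {8 * w..<n - 8 * w}" "A \<noteq> {}" "card A \<le> K"
  shows "\<bar>\<Sum>x<2 ^ n. mangoldt x * walsh A x\<bar> \<le> (4 * real n) ^ K * (5 * real n ^ 3 * 2 ^ n / 2 ^ w)"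
proof -
  have fin: "finite A" using A(1) finite_subset by blast
  have "Max A \<in> A" using fin A(2) by (rule Max_in)
  then have "Max A \<in> {8 * w..<n - 8 * w}" using A(1) by blast
  then have m: "8 * w \<le> Suc (Max A)" "Suc (Max A) + 8 * w \<le> n" by auto
  have n: "n \<ge> 1" using m by simp
  have "(\<Sum>x<2 ^ n. mangoldt x * walsh A x) = (\<Sum>x\<in>{1..<2 ^ n}. mangoldt x * walsh A x)"
    by (rule sum.mono_neutral_right) (auto simp: not_less_eq_eq)
  also have "\<bar>\<dots>\<bar> \<le> (4 * real n) ^ card A * (5 * real n ^ 3 * 2 ^ n / 2 ^ w)"
    using m by (intro walsh_sum_le fin A mangoldt_exp_sum_bound w) auto
  also have "\<dots> \<le> (4 * real n) ^ K * (5 * real n ^ 3 * 2 ^ n / 2 ^ w)"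
    using A(3) n by (intro mult_right_mono power_increasing) auto
  finally show ?thesis .
qed

theorem theorem1:
  shows "((\<lambda>n::nat. (1 / 2 ^ n) * (\<Sum>x\<in>{1..<2 ^ n}. (mangoldt x :: real) * real (majority n (digit x))))
            \<longlongrightarrow> 1 / 2) (inf sequentially (principal {n. odd n}))"
proof -
  let ?W = mangoldt_mass
  \<comment> \<open>When the mass is 0 there is nothing to normalise and \<open>P n\<close> is
    arbitrary; eventually the mass is positive.\<close>
  have "\<exists>P. ?W n > 0 \<longrightarrow> (\<forall>x. pmf P x = (if x < 2 ^ n then mangoldt x / ?W n else 0))" for n
  proof (cases "?W n > 0")
    case True
    then have "\<exists>P. \<forall>x. pmf P x = (if x \<in> {..<2 ^ n} then mangoldt x / ?W n else 0)"
      by (intro exists_weighted_pmf) (auto simp: mangoldt_nonneg mangoldt_mass_def sum_divide_distrib[symmetric])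
    then show ?thesis by auto
  qed auto
  then obtain P :: "nat \<Rightarrow> nat pmf" where
    P: "\<And>n x. ?W n > 0 \<Longrightarrow> pmf (P n) x = (if x < 2 ^ n then mangoldt x / ?W n else 0)" by metis
  \<comment> \<open>Dividing by the mass then costs at most \<open>2 / 2^n\<close>; this 2 and the 5
    of the exponential sum bound make the 10 in \<open>\<delta>\<close>.\<close>
  have half: "\<forall>\<^sub>F n in sequentially. ?W n > 2 ^ n / 2"
  proof -
    have "\<forall>\<^sub>F n in sequentially. ?W n / 2 ^ n > 1 / 2"
      by (rule order_tendstoD[OF mangoldt_mass_tendsto]) simp
    then show ?thesis by eventually_elim (simp add: field_simps)
  qed
  have W0: "\<forall>\<^sub>F n in sequentially. ?W n > 0"
    using half by eventually_elim (rule less_trans[rotated], assumption, simp)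
  have supp: "\<forall>\<^sub>F n in sequentially. set_pmf (P n) \<subseteq> {..<2 ^ n}"
    using W0 by eventually_elim (auto simp: set_pmf_eq P split: if_splits)
  define \<delta> where "\<delta> K n = 10 * 4 ^ K * (real n ^ (K + 3) / 2 ^ cutoff n)" for K n
  have walsh: "\<forall>\<^sub>F n in sequentially. \<forall>A. A \<subseteq> {8 * cutoff n..<n - 8 * cutoff n} \<longrightarrow> A \<noteq> {} \<longrightarrow> card A \<le> K \<longrightarrow>
        \<bar>\<Sum>x<2 ^ n. pmf (P n) x * walsh A x\<bar> \<le> \<delta> K n" for K
    using half W0 cutoff_positive
  proof eventually_elim
    case (elim n)
    show ?case
    proof (intro allI impI)
      fix A assume A: "A \<subseteq> {8 * cutoff n..<n - 8 * cutoff n}" "A \<noteq> {}" "card A \<le> K"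
      have "(\<Sum>x<2 ^ n. pmf (P n) x * walsh A x) = (\<Sum>x<2 ^ n. mangoldt x * walsh A x) / ?W n"
        unfolding sum_divide_distrib by (rule sum.cong) (auto simp: P[OF elim(2)])
      then have "\<bar>\<Sum>x<2 ^ n. pmf (P n) x * walsh A x\<bar> = \<bar>\<Sum>x<2 ^ n. mangoldt x * walsh A x\<bar> / ?W n"
        using elim(2) by simp
      also have "\<dots> \<le> (4 * real n) ^ K * (5 * real n ^ 3 * 2 ^ n / 2 ^ cutoff n) / (2 ^ n / 2)"
        using elim by (intro frac_le mangoldt_walsh_le A) auto
      also have "\<dots> = \<delta> K n" by (simp add: \<delta>_def power_add power_mult_distrib)
      finally show "\<bar>\<Sum>x<2 ^ n. pmf (P n) x * walsh A x\<bar> \<le> \<delta> K n" .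
    qed
  qed
  have \<delta>: "(\<lambda>n. real n ^ K * \<delta> K n) \<longlonglongrightarrow> 0" for K
  proof -
    have "(\<lambda>n. 10 * 4 ^ K * (real n ^ (K + (K + 3)) / 2 ^ cutoff n)) \<longlonglongrightarrow> 10 * 4 ^ K * 0"
      by (intro tendsto_mult tendsto_const cutoff_exponential)
    moreover have "10 * 4 ^ K * (x ^ (K + (K + 3)) / c) = x ^ K * (10 * 4 ^ K * (x ^ (K + 3) / c))" for x c :: real
      unfolding power_add[of x K "K + 3"] by (simp only: mult_ac times_divide_eq_right times_divide_eq_left)
    ultimately show ?thesis by (simp only: \<delta>_def mult_zero_right)
  qed
  have lim: "(\<lambda>n. measure (P n) {x. rad_sum {..<n} x < 0}) \<longlonglongrightarrow> 1 / 2"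
    by (rule rad_sum_limit_half[OF supp walsh _ \<delta> cutoff_sqrt]) (simp add: \<delta>_def)
  have "(\<lambda>n. ?W n / 2 ^ n * measure (P n) {x. rad_sum {..<n} x < 0}) \<longlonglongrightarrow> 1 * (1 / 2)"
    by (intro tendsto_mult mangoldt_mass_tendsto lim)
  moreover have "\<forall>\<^sub>F n in sequentially. ?W n / 2 ^ n * measure (P n) {x. rad_sum {..<n} x < 0}
     = (1 / 2 ^ n) * (\<Sum>x\<in>{1..<2 ^ n}. mangoldt x * real (majority n (digit x)))"
    using W0 supp
  proof eventually_elim
    case (elim n)
    let ?E = "{x. rad_sum {..<n} x < 0}"
    have "measure (P n) ?E = measure (P n) (?E \<inter> {..<2 ^ n})"
      using elim(2) measure_Int_set_pmf[of "P n" ?E] measure_Int_set_pmf[of "P n" "?E \<inter> {..<2 ^ n}"]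
      by (metis Int_absorb1 Int_assoc)
    also have "\<dots> = (\<Sum>x\<in>?E \<inter> {..<2 ^ n}. pmf (P n) x)"
      by (rule measure_measure_pmf_finite) simp
    also have "\<dots> = (\<Sum>x\<in>?E \<inter> {..<2 ^ n}. mangoldt x / ?W n)"
      by (rule sum.cong) (auto simp: P[OF elim(1)])
    also have "\<dots> = (\<Sum>x\<in>{1..<2 ^ n}. mangoldt x * real (majority n (digit x)) / ?W n)"
      unfolding majority_eq_indicator
      by (rule sum.mono_neutral_cong) (auto simp: indicator_def not_less_eq_eq)
    finally show ?case using elim(1) by (simp add: sum_divide_distrib[symmetric])
  qed
  ultimately have "(\<lambda>n. (1 / 2 ^ n) * (\<Sum>x\<in>{1..<2 ^ n}. mangoldt x * real (majority n (digit x)))) \<longlonglongrightarrow> 1 / 2"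
    by (auto intro: Lim_transform_eventually)
  then show ?thesis by (rule tendsto_mono[OF inf_le1])
qed



end
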